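(* Let $R$ be a graded-commutative ring and $\mathcal{T}$ an $R$-linear triangulated category. Let $C, M \in \mathcal{T}$ and let $x_1, \ldots, x_t$ be a sequence in $R$. The following are equivalent: (1) $x_1, \ldots, x_t$ is weakly $\mathrm{Hom}^*_{\mathcal{T}}(C,M)$-regular in the classical sense; (2) each morphism in the composition $$\Sigma^{-t} M/\!\!/(x_1, \ldots, x_t) \to \Sigma^{-t+1} M/\!\!/(x_1, \ldots, x_{t-1}) \to \cdots \to \Sigma^{-1} M/\!\!/x_1 \to M$$ is $C$-ghost. If the ring $R$ is noetherian, the triangulated category $\mathcal{T}$ is compactly generated and $C$ is compact, then conditions (1) and (2) are equivalent to (3) each morphism in the composition $$\Gamma_{\mathcal{V}(x_1, \ldots, x_t)} M \to \Gamma_{\mathcal{V}(x_1, \ldots, x_{t-1})} M \to \cdots \to \Gamma_{\mathcal{V}(x_1)} M \to M$$ is $C$-ghost.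
   Context: A graded-commutative ring is a $\mathbb{Z}$-graded ring $R=\bigoplus_n R_n$ with $xy=(-1)^{|x||y|}yx$; all elements and ideals are homogeneous. A triangulated category $\mathcal{T}$ with suspension $\Sigma$ is $R$-linear if it is equipped with a homomorphism of graded rings $R\to Z^*(\mathcal{T})=\bigoplus_{n\in\mathbb{Z}}\{\alpha\colon \mathrm{id}_{\mathcal T}\to\Sigma^n \text{ natural}\mid \alpha\Sigma=(-1)^n\Sigma\alpha\}$. Thus $x\in R$ induces natural morphisms $x\colon M\to\Sigma^{|x|}M$, and $\mathrm{Hom}^*_{\mathcal T}(M,N)=\bigoplus_n\mathrm{Hom}_{\mathcal T}(M,\Sigma^nN)$ is a graded $R$-module. Koszul objects: $M/\!\!/x$ is the cone of $x\colon M\to\Sigma^{|x|}M$, so there is an exact triangle $M\xrightarrow{x}\Sigma^{|x|}M\to M/\!\!/x\to\Sigma M$; inductively $M/\!\!/(x_1,\ldots,x_t)=(M/\!\!/(x_1,\ldots,x_{t-1}))/\!\!/x_t$. The morphisms in (2) are the (de)suspensions of the last maps $N/\!\!/x_s\to\Sigma N$ of these triangles with $N=M/\!\!/(x_1,\ldots,x_{s-1})$. A morphism $f\colon M\to N$ is $C$-ghost if $\mathrm{Hom}^*_{\mathcal T}(C,f)=0$. A sequence $x_1,\ldots,x_t$ is weakly $N$-regular in the classical sense, for a graded $R$-module $N$, if $x_i$ is a non-zero divisor on (i.e. acts injectively on) $N/(x_1,\ldots,x_{i-1})N$ for $1\le i\le t$. Local cohomology functor (for $R$ noetherian and $\mathcal{T}$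 compactly generated): $\mathrm{Spec}(R)$ is the set of homogeneous primes, $\mathcal{V}(\mathfrak a)=\{\mathfrak p\mid\mathfrak a\subseteq\mathfrak p\}$. For $\mathcal{V}\subseteq\mathrm{Spec}(R)$ specialization closed, $\mathcal{T}_{\mathcal V}$ is the localizing subcategory generated by the compact objects $D$ with $\mathrm{End}^*_{\mathcal T}(D)_{\mathfrak p}=0$ for all $\mathfrak p\notin\mathcal V$. The functor $\Gamma_{\mathcal V}\colon\mathcal T\to\mathcal T$ is the composite of the right adjoint of the inclusion $\mathcal{T}_{\mathcal V}\to\mathcal{T}$ with the inclusion, equipped with the counit $\Gamma_{\mathcal V}M\to M$. For $\mathcal V\subseteq\mathcal U$ one has $\Gamma_{\mathcal V}\Gamma_{\mathcal U}\cong\Gamma_{\mathcal V}$, giving the canonical morphisms $\Gamma_{\mathcal V}M\cong \Gamma_{\mathcal V}\Gamma_{\mathcal U}M\to\Gamma_{\mathcal U}M$ in (3). *)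

theory Defs
  imports "HOL-Algebra.Product_Groups" "HOL-Algebra.Ideal" "HOL-Library.Equipollence"
begin

section \<open>Additive and triangulated categories\<close>

record ('o, 'm) category =
  Obj :: "'o set"
  Arr :: "'m set"
  Dom :: "'m \<Rightarrow> 'o"
  Cod :: "'m \<Rightarrow> 'o"
  Idn :: "'o \<Rightarrow> 'm"
  Comp :: "'m \<Rightarrow> 'm \<Rightarrow> 'm" (infixr \<open>\<cdot>\<index>\<close> 70)

record ('o, 'm) additive_category = "('o, 'm) category" +
  ZeroA :: "'o \<Rightarrow> 'o \<Rightarrow> 'm"
  Plus :: "'m \<Rightarrow> 'm \<Rightarrow> 'm"

record ('o, 'm) triangulated_category = "('o, 'm) additive_category" +
  SuspO :: "'o \<Rightarrow> 'o"
  SuspA :: "'m \<Rightarrow> 'm"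
  Tri :: "('m \<times> 'm \<times> 'm) set"

definition Hom :: "('o, 'm, 'z) category_scheme \<Rightarrow> 'o \<Rightarrow> 'o \<Rightarrow> 'm set" where
  "Hom T a b = {f \<in> Arr T. Dom T f = a \<and> Cod T f = b}"

locale category =
  fixes T :: "('o, 'm, 'z) category_scheme" (structure)
  assumes Dom_Obj: "f \<in> Arr T \<Longrightarrow> Dom T f \<in> Obj T"
    and Cod_Obj: "f \<in> Arr T \<Longrightarrow> Cod T f \<in> Obj T"
    and Idn_Hom: "a \<in> Obj T \<Longrightarrow> Idn T a \<in> Hom T a a"
    and Comp_Hom: "f \<in> Hom T a b \<Longrightarrow> g \<in> Hom T b c \<Longrightarrow> g \<cdot> f \<in> Hom T a c"
    and Comp_assoc: "f \<in> Hom T a b \<Longrightarrow> g \<in> Hom T b c \<Longrightarrow> h \<in> Hom T c d \<Longrightarrow>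
          (h \<cdot> g) \<cdot> f = h \<cdot> (g \<cdot> f)"
    and Comp_Idn_left: "f \<in> Hom T a b \<Longrightarrow> Idn T b \<cdot> f = f"
    and Comp_Idn_right: "f \<in> Hom T a b \<Longrightarrow> f \<cdot> Idn T a = f"

definition inverse_arr :: "('o, 'm, 'z) category_scheme \<Rightarrow> 'm \<Rightarrow> 'm \<Rightarrow> bool" where
  "inverse_arr T f g \<longleftrightarrow> f \<in> Arr T \<and> g \<in> Hom T (Cod T f) (Dom T f) \<and>
     g \<cdot>\<^bsub>T\<^esub> f = Idn T (Dom T f) \<and> f \<cdot>\<^bsub>T\<^esub> g = Idn T (Cod T f)"

definition iso_arr :: "('o, 'm, 'z) category_scheme \<Rightarrow> 'm \<Rightarrow> bool" where
  "iso_arr T f \<longleftrightarrow> (\<exists>g. inverse_arr T f g)"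

definition the_inverse :: "('o, 'm, 'z) category_scheme \<Rightarrow> 'm \<Rightarrow> 'm" where
  "the_inverse T f = (THE g. inverse_arr T f g)"

definition is_coproduct ::
    "('o, 'm, 'z) category_scheme \<Rightarrow> 'i set \<Rightarrow> ('i \<Rightarrow> 'o) \<Rightarrow> 'o \<Rightarrow> ('i \<Rightarrow> 'm) \<Rightarrow> bool" where
  "is_coproduct T I X S \<iota> \<longleftrightarrow>
     (\<forall>i\<in>I. X i \<in> Obj T) \<and> S \<in> Obj T \<and> (\<forall>i\<in>I. \<iota> i \<in> Hom T (X i) S) \<and>
     (\<forall>Y\<in>Obj T. \<forall>f. (\<forall>i\<in>I. f i \<in> Hom T (X i) Y) \<longrightarrow>
        (\<exists>!u. u \<in> Hom T S Y \<and> (\<forall>i\<in>I. u \<cdot>\<^bsub>T\<^esub> \<iota> i = f i)))"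

definition hom_group :: "('o, 'm, 'z) additive_category_scheme \<Rightarrow> 'o \<Rightarrow> 'o \<Rightarrow> 'm monoid" where
  "hom_group T a b = \<lparr>carrier = Hom T a b, monoid.mult = Plus T, one = ZeroA T a b\<rparr>"

definition neg :: "('o, 'm, 'z) additive_category_scheme \<Rightarrow> 'm \<Rightarrow> 'm" where
  "neg T f = inv\<^bsub>hom_group T (Dom T f) (Cod T f)\<^esub> f"

definition signed :: "('o, 'm, 'z) additive_category_scheme \<Rightarrow> int \<Rightarrow> 'm \<Rightarrow> 'm" where
  "signed T n f = (if even n then f else neg T f)"

definition zero_object :: "('o, 'm, 'z) additive_category_scheme \<Rightarrow> 'o \<Rightarrow> bool" where
  "zero_object T Z \<longleftrightarrow> Z \<in> Obj T \<and> Idn T Z = ZeroA T Z Z"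

locale additive_category = category T
  for T :: "('o, 'm, 'z) additive_category_scheme" (structure) +
  assumes hom_group: "a \<in> Obj T \<Longrightarrow> b \<in> Obj T \<Longrightarrow> comm_group (hom_group T a b)"
    and Comp_Plus_right: "f \<in> Hom T a b \<Longrightarrow> f' \<in> Hom T a b \<Longrightarrow> g \<in> Hom T b c \<Longrightarrow>
          g \<cdot> Plus T f f' = Plus T (g \<cdot> f) (g \<cdot> f')"
    and Comp_Plus_left: "f \<in> Hom T a b \<Longrightarrow> g \<in> Hom T b c \<Longrightarrow> g' \<in> Hom T b c \<Longrightarrow>
          Plus T g g' \<cdot> f = Plus T (g \<cdot> f) (g' \<cdot> f)"
    \<comment> \<open>The empty index set yields a zero object.\<close>
    and finite_coproducts: "finite (I :: nat set) \<Longrightarrow> (\<forall>i\<in>I. X i \<in> Obj T) \<Longrightarrow>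
          \<exists>S \<iota>. is_coproduct T I X S \<iota>"

definition candidate_triangle ::
    "('o, 'm, 'z) triangulated_category_scheme \<Rightarrow> 'm \<Rightarrow> 'm \<Rightarrow> 'm \<Rightarrow> bool" where
  "candidate_triangle T f g h \<longleftrightarrow> f \<in> Arr T \<and> g \<in> Arr T \<and> h \<in> Arr T \<and>
     Dom T g = Cod T f \<and> Dom T h = Cod T g \<and> Cod T h = SuspO T (Dom T f)"

definition triangle_morphism ::
    "('o, 'm, 'z) triangulated_category_scheme \<Rightarrow> 'm \<times> 'm \<times> 'm \<Rightarrow> 'm \<times> 'm \<times> 'm \<Rightarrow>
      'm \<Rightarrow> 'm \<Rightarrow> 'm \<Rightarrow> bool" where
  "triangle_morphism T = (\<lambda>(f, g, h) (f', g', h') r s t.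
     r \<in> Hom T (Dom T f) (Dom T f') \<and> s \<in> Hom T (Dom T g) (Dom T g') \<and>
     t \<in> Hom T (Dom T h) (Dom T h') \<and>
     s \<cdot>\<^bsub>T\<^esub> f = f' \<cdot>\<^bsub>T\<^esub> r \<and> t \<cdot>\<^bsub>T\<^esub> g = g' \<cdot>\<^bsub>T\<^esub> s \<and> SuspA T r \<cdot>\<^bsub>T\<^esub> h = h' \<cdot>\<^bsub>T\<^esub> t)"

text \<open>The suspension is an automorphism of the category, so that all its integer powers are
  defined and compose strictly.\<close>

locale triangulated_category = additive_category T
  for T :: "('o, 'm, 'z) triangulated_category_scheme" (structure) +
  assumes SuspO_bij: "bij_betw (SuspO T) (Obj T) (Obj T)"
    and SuspA_bij: "bij_betw (SuspA T) (Arr T) (Arr T)"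
    and SuspA_Hom: "f \<in> Hom T a b \<Longrightarrow> SuspA T f \<in> Hom T (SuspO T a) (SuspO T b)"
    and SuspA_Idn: "a \<in> Obj T \<Longrightarrow> SuspA T (Idn T a) = Idn T (SuspO T a)"
    and SuspA_Comp: "f \<in> Hom T a b \<Longrightarrow> g \<in> Hom T b c \<Longrightarrow>
          SuspA T (g \<cdot> f) = SuspA T g \<cdot> SuspA T f"
    and SuspA_Plus: "f \<in> Hom T a b \<Longrightarrow> f' \<in> Hom T a b \<Longrightarrow>
          SuspA T (Plus T f f') = Plus T (SuspA T f) (SuspA T f')"
    and Tri_candidate: "(f, g, h) \<in> Tri T \<Longrightarrow> candidate_triangle T f g h"
    and TR1_iso: "(f, g, h) \<in> Tri T \<Longrightarrow> candidate_triangle T f' g' h' \<Longrightarrow>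
          triangle_morphism T (f, g, h) (f', g', h') r s t \<Longrightarrow>
          iso_arr T r \<Longrightarrow> iso_arr T s \<Longrightarrow> iso_arr T t \<Longrightarrow> (f', g', h') \<in> Tri T"
    and TR1_id: "X \<in> Obj T \<Longrightarrow> zero_object T Z \<Longrightarrow>
          (Idn T X, ZeroA T X Z, ZeroA T Z (SuspO T X)) \<in> Tri T"
    and TR1_cone: "f \<in> Arr T \<Longrightarrow> \<exists>g h. (f, g, h) \<in> Tri T"
    and TR2: "candidate_triangle T f g h \<Longrightarrow>
          (f, g, h) \<in> Tri T \<longleftrightarrow> (g, h, neg T (SuspA T f)) \<in> Tri T"
    and TR3: "(f, g, h) \<in> Tri T \<Longrightarrow> (f', g', h') \<in> Tri T \<Longrightarrow>
          r \<in> Hom T (Dom T f) (Dom T f') \<Longrightarrow> s \<in> Hom T (Cod T f) (Cod T f') \<Longrightarrow>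
          s \<cdot> f = f' \<cdot> r \<Longrightarrow> \<exists>t. triangle_morphism T (f, g, h) (f', g', h') r s t"
    and TR4: "Cod T f = Dom T g \<Longrightarrow> (f, f', f'') \<in> Tri T \<Longrightarrow> (g, g', g'') \<in> Tri T \<Longrightarrow>
          (g \<cdot> f, h', h'') \<in> Tri T \<Longrightarrow>
          \<exists>u v. (u, v, SuspA T f' \<cdot> g'') \<in> Tri T \<and>
            u \<in> Hom T (Cod T f') (Cod T h') \<and> v \<in> Hom T (Cod T h') (Cod T g') \<and>
            u \<cdot> f' = h' \<cdot> g \<and> h'' \<cdot> u = f'' \<and> v \<cdot> h' = g' \<and> g'' \<cdot> v = SuspA T f \<cdot> h''"

definition susp_obj :: "('o, 'm, 'z) triangulated_category_scheme \<Rightarrow> int \<Rightarrow> 'o \<Rightarrow> 'o" where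
  "susp_obj T n = (if 0 \<le> n then SuspO T ^^ nat n else inv_into (Obj T) (SuspO T) ^^ nat (- n))"

definition susp_arr :: "('o, 'm, 'z) triangulated_category_scheme \<Rightarrow> int \<Rightarrow> 'm \<Rightarrow> 'm" where
  "susp_arr T n = (if 0 \<le> n then SuspA T ^^ nat n else inv_into (Arr T) (SuspA T) ^^ nat (- n))"


section \<open>Graded-commutative rings and their homogeneous ideals\<close>

text \<open>\<open>G n\<close> is the homogeneous component of degree \<open>n\<close>.\<close>

definition decomposition ::
    "('r, 'z) ring_scheme \<Rightarrow> (int \<Rightarrow> 'r set) \<Rightarrow> 'r \<Rightarrow> (int \<Rightarrow> 'r) \<Rightarrow> bool" where
  "decomposition R G r c \<longleftrightarrow> (\<forall>n. c n \<in> G n) \<and> finite {n. c n \<noteq> \<zero>\<^bsub>R\<^esub>} \<and>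
     r = (\<Oplus>\<^bsub>R\<^esub>n\<in>{n. c n \<noteq> \<zero>\<^bsub>R\<^esub>}. c n)"

locale graded_commutative_ring = ring R for R (structure) +
  fixes G :: "int \<Rightarrow> 'a set"
  assumes component_subgroup: "additive_subgroup (G n) R"
    and direct_sum: "r \<in> carrier R \<Longrightarrow> \<exists>!c. decomposition R G r c"
    and one_degree: "\<one> \<in> G 0"
    and mult_degree: "x \<in> G m \<Longrightarrow> y \<in> G n \<Longrightarrow> x \<otimes> y \<in> G (m + n)"
    and graded_commute: "x \<in> G m \<Longrightarrow> y \<in> G n \<Longrightarrow>
          x \<otimes> y = (if even (m * n) then y \<otimes> x else \<ominus> (y \<otimes> x))"

definition homogeneous_ideal ::
    "('r, 'z) ring_scheme \<Rightarrow> (int \<Rightarrow> 'r set) \<Rightarrow> 'r set \<Rightarrow> bool" where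
  "homogeneous_ideal R G I \<longleftrightarrow> ideal I R \<and>
     (\<forall>r\<in>I. \<forall>c. decomposition R G r c \<longrightarrow> (\<forall>n. c n \<in> I))"

definition graded_noetherian :: "('r, 'z) ring_scheme \<Rightarrow> (int \<Rightarrow> 'r set) \<Rightarrow> bool" where
  "graded_noetherian R G \<longleftrightarrow> (\<forall>I. homogeneous_ideal R G I \<longrightarrow>
     (\<exists>S. finite S \<and> S \<subseteq> (\<Union>n. G n) \<and> I = Idl\<^bsub>R\<^esub> S))"

definition Spec :: "('r, 'z) ring_scheme \<Rightarrow> (int \<Rightarrow> 'r set) \<Rightarrow> 'r set set" where
  "Spec R G = {\<pp>. homogeneous_ideal R G \<pp> \<and> \<pp> \<noteq> carrier R \<and>
     (\<forall>m n. \<forall>x\<in>G m. \<forall>y\<in>G n. x \<otimes>\<^bsub>R\<^esub> y \<in> \<pp> \<longrightarrow> x \<in> \<pp> \<or> y \<in> \<pp>)}"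

definition Vset :: "('r, 'z) ring_scheme \<Rightarrow> (int \<Rightarrow> 'r set) \<Rightarrow> 'r set \<Rightarrow> 'r set set" where
  "Vset R G \<aa> = {\<pp> \<in> Spec R G. \<aa> \<subseteq> \<pp>}"

definition specialization_closed ::
    "('r, 'z) ring_scheme \<Rightarrow> (int \<Rightarrow> 'r set) \<Rightarrow> 'r set set \<Rightarrow> bool" where
  "specialization_closed R G V \<longleftrightarrow> V \<subseteq> Spec R G \<and>
     (\<forall>\<pp>\<in>V. \<forall>\<qq>\<in>Spec R G. \<pp> \<subseteq> \<qq> \<longrightarrow> \<qq> \<in> V)"

text \<open>A homogeneous element comes together with its degree (the zero element lies in every
  component): the pair \<open>(d, x)\<close> stands for \<open>x \<in> G d\<close>. The following is the ideal generated by the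
  first \<open>i\<close> entries of a sequence.\<close>

definition initial_ideal :: "('r, 'z) ring_scheme \<Rightarrow> (int \<times> 'r) list \<Rightarrow> nat \<Rightarrow> 'r set" where
  "initial_ideal R xs i = Idl\<^bsub>R\<^esub> (snd ` set (take i xs))"


section \<open>Graded modules\<close>

text \<open>A graded module is given by its homogeneous components (abelian groups, written
  multiplicatively as in the library) and the action of homogeneous elements: \<open>act N d n x m\<close> is
  \<open>x m\<close> for \<open>x\<close> of degree \<open>d\<close> and \<open>m\<close> of degree \<open>n\<close>, which lies in degree \<open>d + n\<close>.\<close>

record ('r, 'm) graded_module =
  comp :: "int \<Rightarrow> 'm monoid"
  act :: "int \<Rightarrow> int \<Rightarrow> 'r \<Rightarrow> 'm \<Rightarrow> 'm"

definition ideal_times ::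
    "(int \<Rightarrow> 'r set) \<Rightarrow> 'r set \<Rightarrow> ('r, 'm) graded_module \<Rightarrow> int \<Rightarrow> 'm set" where
  "ideal_times G I N n = generate (comp N n)
     {act N d (n - d) a m | d a m. a \<in> I \<inter> G d \<and> m \<in> carrier (comp N (n - d))}"

text \<open>The action on a quotient sends the coset of \<open>m\<close> to the coset of \<open>x m\<close>; the union below runs
  over all representatives, which yield the same coset when \<open>S\<close> is a graded submodule.\<close>

definition quotient_module ::
    "('r, 'm) graded_module \<Rightarrow> (int \<Rightarrow> 'm set) \<Rightarrow> ('r, 'm set) graded_module" where
  "quotient_module N S =
     \<lparr>comp = (\<lambda>n. comp N n Mod S n),
      act = (\<lambda>d n x A. \<Union>m\<in>A. S (d + n) #>\<^bsub>comp N (d + n)\<^esub> act N d n x m)\<rparr>"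

definition nonzerodivisor_on :: "('r, 'm) graded_module \<Rightarrow> int \<Rightarrow> 'r \<Rightarrow> bool" where
  "nonzerodivisor_on N d x \<longleftrightarrow> (\<forall>n. inj_on (act N d n x) (carrier (comp N n)))"

definition weakly_regular ::
    "('r, 'z) ring_scheme \<Rightarrow> (int \<Rightarrow> 'r set) \<Rightarrow> ('r, 'm) graded_module \<Rightarrow> (int \<times> 'r) list \<Rightarrow> bool"
  where
  "weakly_regular R G N xs \<longleftrightarrow> (\<forall>i<length xs.
     nonzerodivisor_on (quotient_module N (ideal_times G (initial_ideal R xs i) N))
       (fst (xs ! i)) (snd (xs ! i)))"

text \<open>Localisation at a homogeneous prime \<open>\<pp>\<close>: the triple \<open>(a, s, m)\<close> represents the left fraction
  \<open>s\<^sup>-\<^sup>1 m\<close> with \<open>s\<close> of degree \<open>a\<close>. Two fractions are equal if they acquire the same numerator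
  and denominator after multiplication from the left (the Ore form of the relation, which avoids
  the signs of graded commutativity).\<close>

definition fractions ::
    "(int \<Rightarrow> 'r set) \<Rightarrow> 'r set \<Rightarrow> ('r, 'm) graded_module \<Rightarrow> int \<Rightarrow> (int \<times> 'r \<times> 'm) set" where
  "fractions G \<pp> N n = {(a, s, m). s \<in> G a - \<pp> \<and> m \<in> carrier (comp N (a + n))}"

definition fraction_rel ::
    "('r, 'z) ring_scheme \<Rightarrow> (int \<Rightarrow> 'r set) \<Rightarrow> 'r set \<Rightarrow> ('r, 'm) graded_module \<Rightarrow> int \<Rightarrow>
      ((int \<times> 'r \<times> 'm) \<times> (int \<times> 'r \<times> 'm)) set" where
  "fraction_rel R G \<pp> N n = {((a, s, m), (a', s', m')).
     (a, s, m) \<in> fractions G \<pp> N n \<and> (a', s', m') \<in> fractions G \<pp> N n \<and>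
     (\<exists>b b'. \<exists>u\<in>G b. \<exists>u'\<in>G b'. b + a = b' + a' \<and>
        u \<otimes>\<^bsub>R\<^esub> s = u' \<otimes>\<^bsub>R\<^esub> s' \<and> u \<otimes>\<^bsub>R\<^esub> s \<notin> \<pp> \<and>
        act N b (a + n) u m = act N b' (a' + n) u' m')}"

definition localization ::
    "('r, 'z) ring_scheme \<Rightarrow> (int \<Rightarrow> 'r set) \<Rightarrow> 'r set \<Rightarrow> ('r, 'm) graded_module \<Rightarrow> int \<Rightarrow>
      (int \<times> 'r \<times> 'm) set set" where
  "localization R G \<pp> N n = fractions G \<pp> N n // fraction_rel R G \<pp> N n"

definition localization_vanishes ::
    "('r, 'z) ring_scheme \<Rightarrow> (int \<Rightarrow> 'r set) \<Rightarrow> 'r set \<Rightarrow> ('r, 'm) graded_module \<Rightarrow> bool" where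
  "localization_vanishes R G \<pp> N \<longleftrightarrow> (\<forall>n. localization R G \<pp> N n =
     {fraction_rel R G \<pp> N n `` {(0, \<one>\<^bsub>R\<^esub>, \<one>\<^bsub>comp N n\<^esub>)}})"


section \<open>Linear triangulated categories\<close>

text \<open>The component of degree \<open>n\<close> of the graded centre.\<close>

definition graded_center ::
    "('o, 'm, 'z) triangulated_category_scheme \<Rightarrow> int \<Rightarrow> ('o \<Rightarrow> 'm) set" where
  "graded_center T n = {\<alpha>.
     (\<forall>M\<in>Obj T. \<alpha> M \<in> Hom T M (susp_obj T n M)) \<and>
     (\<forall>M\<in>Obj T. \<forall>N\<in>Obj T. \<forall>f\<in>Hom T M N. \<alpha> N \<cdot>\<^bsub>T\<^esub> f = susp_arr T n f \<cdot>\<^bsub>T\<^esub> \<alpha> M) \<and>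
     (\<forall>M\<in>Obj T. \<alpha> (SuspO T M) = signed T n (SuspA T (\<alpha> M)))}"

text \<open>\<open>\<phi> d x M\<close> is the morphism \<open>M \<rightarrow> \<Sigma>\<^sup>d M\<close> induced by \<open>x\<close> of degree \<open>d\<close>. The product of \<open>\<alpha>\<close> and
  \<open>\<beta>\<close> in the graded centre is \<open>\<Sigma>\<^sup>e(\<alpha> M) \<cdot> \<beta> M\<close>, where \<open>e\<close> is the degree of \<open>\<beta>\<close>.\<close>

locale linear_triangulated_category =
  graded_commutative_ring R G + triangulated_category T
  for R :: "('r, 'y) ring_scheme" and G :: "int \<Rightarrow> 'r set"
    and T :: "('o, 'm, 'z) triangulated_category_scheme" +
  fixes \<phi> :: "int \<Rightarrow> 'r \<Rightarrow> 'o \<Rightarrow> 'm"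
  assumes \<phi>_center: "x \<in> G d \<Longrightarrow> \<phi> d x \<in> graded_center T d"
    and \<phi>_add: "x \<in> G d \<Longrightarrow> y \<in> G d \<Longrightarrow> M \<in> Obj T \<Longrightarrow>
          \<phi> d (x \<oplus>\<^bsub>R\<^esub> y) M = Plus T (\<phi> d x M) (\<phi> d y M)"
    and \<phi>_mult: "x \<in> G d \<Longrightarrow> y \<in> G e \<Longrightarrow> M \<in> Obj T \<Longrightarrow>
          \<phi> (d + e) (x \<otimes>\<^bsub>R\<^esub> y) M = susp_arr T e (\<phi> d x M) \<cdot>\<^bsub>T\<^esub> \<phi> e y M"
    and \<phi>_one: "M \<in> Obj T \<Longrightarrow> \<phi> 0 \<one>\<^bsub>R\<^esub> M = Idn T M"

definition hom_module ::
    "('o, 'm, 'z) triangulated_category_scheme \<Rightarrow> (int \<Rightarrow> 'r \<Rightarrow> 'o \<Rightarrow> 'm) \<Rightarrow> 'o \<Rightarrow> 'o \<Rightarrow>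
      ('r, 'm) graded_module" where
  "hom_module T \<phi> C M =
     \<lparr>comp = (\<lambda>n. hom_group T C (susp_obj T n M)),
      act = (\<lambda>d n x f. susp_arr T n (\<phi> d x M) \<cdot>\<^bsub>T\<^esub> f)\<rparr>"

definition ghost :: "('o, 'm, 'z) triangulated_category_scheme \<Rightarrow> 'o \<Rightarrow> 'm \<Rightarrow> bool" where
  "ghost T C f \<longleftrightarrow> (\<forall>n. \<forall>g\<in>Hom T C (susp_obj T n (Dom T f)).
     susp_arr T n f \<cdot>\<^bsub>T\<^esub> g = ZeroA T C (susp_obj T n (Cod T f)))"

text \<open>A choice of Koszul objects \<open>K i = M//(x\<^sub>1, \<dots>, x\<^sub>i)\<close> together with the exact triangles
  \<open>K i \<rightarrow> \<Sigma>\<^sup>d K i \<rightarrow> K (i + 1) \<rightarrow> \<Sigma> K i\<close> defining them.\<close>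

definition koszul_triangles ::
    "('o, 'm, 'z) triangulated_category_scheme \<Rightarrow> (int \<Rightarrow> 'r \<Rightarrow> 'o \<Rightarrow> 'm) \<Rightarrow> 'o \<Rightarrow> (int \<times> 'r) list \<Rightarrow>
      (nat \<Rightarrow> 'o) \<Rightarrow> (nat \<Rightarrow> 'm) \<Rightarrow> (nat \<Rightarrow> 'm) \<Rightarrow> bool" where
  "koszul_triangles T \<phi> M xs K q \<delta> \<longleftrightarrow> K 0 = M \<and> (\<forall>i<length xs.
     (\<phi> (fst (xs ! i)) (snd (xs ! i)) (K i), q i, \<delta> i) \<in> Tri T \<and> Cod T (q i) = K (Suc i))"


section \<open>Compact generation and local cohomology\<close>

text \<open>Smallness is relative to a set \<open>U\<close> playing the role of the universe of index sets: a set is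
  small if its cardinality is strictly below that of \<open>U\<close>. The notions below make sense for every
  \<open>U\<close>; for \<open>U\<close> of (strongly) inaccessible cardinality, ``small set'' has its usual meaning of a
  set as opposed to a proper class. Every small set is in bijection with a subset of \<open>U\<close>, so it
  suffices to consider index sets drawn from the type of elements of \<open>U\<close>.\<close>

definition small :: "'u set \<Rightarrow> 'i set \<Rightarrow> bool" where
  "small U I \<longleftrightarrow> I \<prec> U"

definition has_small_coproducts :: "'u set \<Rightarrow> ('o, 'm, 'z) category_scheme \<Rightarrow> bool" where
  "has_small_coproducts U T \<longleftrightarrow> (\<forall>(I :: 'u set) X. small U I \<longrightarrow> (\<forall>i\<in>I. X i \<in> Obj T) \<longrightarrow>
     (\<exists>S \<iota>. is_coproduct T I X S \<iota>))"

text \<open>\<open>C\<close> is compact if the canonical map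
  \<open>\<Oplus>\<^sub>i Hom(C, X\<^sub>i) \<rightarrow> Hom(C, \<Coprod>\<^sub>i X\<^sub>i)\<close> is always an isomorphism.\<close>

definition compact_object :: "'u set \<Rightarrow> ('o, 'm, 'z) additive_category_scheme \<Rightarrow> 'o \<Rightarrow> bool" where
  "compact_object U T C \<longleftrightarrow> C \<in> Obj T \<and>
     (\<forall>(I :: 'u set) X S \<iota>. small U I \<longrightarrow> is_coproduct T I X S \<iota> \<longrightarrow>
        (\<lambda>g. finprod (hom_group T C S) (\<lambda>i. \<iota> i \<cdot>\<^bsub>T\<^esub> g i) {i \<in> I. g i \<noteq> ZeroA T C (X i)})
          \<in> iso (sum_group I (\<lambda>i. hom_group T C (X i))) (hom_group T C S))"

definition compactly_generated ::
    "'u set \<Rightarrow> ('o, 'm, 'z) triangulated_category_scheme \<Rightarrow> bool" where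
  "compactly_generated U T \<longleftrightarrow> has_small_coproducts U T \<and>
     (\<exists>S. small U S \<and> (\<forall>D\<in>S. compact_object U T D) \<and>
        (\<forall>X\<in>Obj T. (\<forall>D\<in>S. \<forall>n. Hom T D (susp_obj T n X) = {ZeroA T D (susp_obj T n X)}) \<longrightarrow>
           zero_object T X))"

definition localizing :: "'u set \<Rightarrow> ('o, 'm, 'z) triangulated_category_scheme \<Rightarrow> 'o set \<Rightarrow> bool" where
  "localizing U T L \<longleftrightarrow> L \<subseteq> Obj T \<and> (\<exists>Z\<in>L. zero_object T Z) \<and>
     (\<forall>X\<in>L. susp_obj T 1 X \<in> L \<and> susp_obj T (- 1) X \<in> L) \<and>
     (\<forall>(f, g, h)\<in>Tri T.
        (Dom T f \<in> L \<and> Dom T g \<in> L \<longrightarrow> Dom T h \<in> L) \<and>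
        (Dom T g \<in> L \<and> Dom T h \<in> L \<longrightarrow> Dom T f \<in> L) \<and>
        (Dom T f \<in> L \<and> Dom T h \<in> L \<longrightarrow> Dom T g \<in> L)) \<and>
     (\<forall>(I :: 'u set) X S \<iota>. small U I \<longrightarrow> (\<forall>i\<in>I. X i \<in> L) \<longrightarrow> is_coproduct T I X S \<iota> \<longrightarrow> S \<in> L)"

definition Loc :: "'u set \<Rightarrow> ('o, 'm, 'z) triangulated_category_scheme \<Rightarrow> 'o set \<Rightarrow> 'o set" where
  "Loc U T D = \<Inter>{L. localizing U T L \<and> D \<subseteq> L}"

definition torsion_subcategory ::
    "'u set \<Rightarrow> ('r, 'y) ring_scheme \<Rightarrow> (int \<Rightarrow> 'r set) \<Rightarrow> ('o, 'm, 'z) triangulated_category_scheme \<Rightarrow>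
      (int \<Rightarrow> 'r \<Rightarrow> 'o \<Rightarrow> 'm) \<Rightarrow> 'r set set \<Rightarrow> 'o set" where
  "torsion_subcategory U R G T \<phi> V = Loc U T {D. compact_object U T D \<and>
     (\<forall>\<pp> \<in> Spec R G - V. localization_vanishes R G \<pp> (hom_module T \<phi> D D))}"

text \<open>\<open>(Fo, Fa)\<close> is the object and arrow part of the composite of a right adjoint of the inclusion
  of the full subcategory on \<open>L\<close> with this inclusion, and \<open>\<theta>\<close> is the counit.\<close>

definition coreflection ::
    "('o, 'm, 'z) category_scheme \<Rightarrow> 'o set \<Rightarrow> ('o \<Rightarrow> 'o) \<Rightarrow> ('m \<Rightarrow> 'm) \<Rightarrow> ('o \<Rightarrow> 'm) \<Rightarrow> bool" where
  "coreflection T L Fo Fa \<theta> \<longleftrightarrow>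
     (\<forall>M\<in>Obj T. Fo M \<in> L) \<and>
     (\<forall>M\<in>Obj T. \<forall>N\<in>Obj T. \<forall>f\<in>Hom T M N. Fa f \<in> Hom T (Fo M) (Fo N)) \<and>
     (\<forall>M\<in>Obj T. Fa (Idn T M) = Idn T (Fo M)) \<and>
     (\<forall>f\<in>Arr T. \<forall>g\<in>Arr T. Cod T f = Dom T g \<longrightarrow> Fa (g \<cdot>\<^bsub>T\<^esub> f) = Fa g \<cdot>\<^bsub>T\<^esub> Fa f) \<and>
     (\<forall>M\<in>Obj T. \<theta> M \<in> Hom T (Fo M) M) \<and>
     (\<forall>M\<in>Obj T. \<forall>N\<in>Obj T. \<forall>f\<in>Hom T M N. \<theta> N \<cdot>\<^bsub>T\<^esub> Fa f = f \<cdot>\<^bsub>T\<^esub> \<theta> M) \<and>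
     (\<forall>D\<in>L. \<forall>M\<in>Obj T. bij_betw (\<lambda>g. \<theta> M \<cdot>\<^bsub>T\<^esub> g) (Hom T D (Fo M)) (Hom T D M))"

text \<open>A choice of the functors \<open>\<Gamma>\<^sub>V\<close> with their counits; each is unique up to unique isomorphism.\<close>

definition local_cohomology ::
    "'u set \<Rightarrow> ('r, 'y) ring_scheme \<Rightarrow> (int \<Rightarrow> 'r set) \<Rightarrow> ('o, 'm, 'z) triangulated_category_scheme \<Rightarrow>
      (int \<Rightarrow> 'r \<Rightarrow> 'o \<Rightarrow> 'm) \<Rightarrow> ('r set set \<Rightarrow> 'o \<Rightarrow> 'o) \<Rightarrow> ('r set set \<Rightarrow> 'm \<Rightarrow> 'm) \<Rightarrow>
      ('r set set \<Rightarrow> 'o \<Rightarrow> 'm) \<Rightarrow> bool" where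
  "local_cohomology U R G T \<phi> \<Gamma>o \<Gamma>a \<theta> \<longleftrightarrow> (\<forall>V. specialization_closed R G V \<longrightarrow>
     coreflection T (torsion_subcategory U R G T \<phi> V) (\<Gamma>o V) (\<Gamma>a V) (\<theta> V))"

text \<open>For \<open>V \<subseteq> W\<close>, the composite \<open>\<Gamma>\<^sub>V M \<cong> \<Gamma>\<^sub>V \<Gamma>\<^sub>W M \<rightarrow> \<Gamma>\<^sub>W M\<close>, where the isomorphism is the inverse
  of \<open>\<Gamma>\<^sub>V\<close> applied to the counit of \<open>\<Gamma>\<^sub>W\<close> at \<open>M\<close>, and the second map is the counit of \<open>\<Gamma>\<^sub>V\<close>.\<close>

definition canonical_map ::
    "('o, 'm, 'z) category_scheme \<Rightarrow> ('r set set \<Rightarrow> 'o \<Rightarrow> 'o) \<Rightarrow> ('r set set \<Rightarrow> 'm \<Rightarrow> 'm) \<Rightarrow>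
      ('r set set \<Rightarrow> 'o \<Rightarrow> 'm) \<Rightarrow> 'r set set \<Rightarrow> 'r set set \<Rightarrow> 'o \<Rightarrow> 'm" where
  "canonical_map T \<Gamma>o \<Gamma>a \<theta> V W M = \<theta> V (\<Gamma>o W M) \<cdot>\<^bsub>T\<^esub> the_inverse T (\<Gamma>a V (\<theta> W M))"

definition local_cohomology_map ::
    "('r, 'y) ring_scheme \<Rightarrow> (int \<Rightarrow> 'r set) \<Rightarrow> ('o, 'm, 'z) category_scheme \<Rightarrow>
      ('r set set \<Rightarrow> 'o \<Rightarrow> 'o) \<Rightarrow> ('r set set \<Rightarrow> 'm \<Rightarrow> 'm) \<Rightarrow> ('r set set \<Rightarrow> 'o \<Rightarrow> 'm) \<Rightarrow>
      (int \<times> 'r) list \<Rightarrow> 'o \<Rightarrow> nat \<Rightarrow> 'm" where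
  "local_cohomology_map R G T \<Gamma>o \<Gamma>a \<theta> xs M i =
     (let V = (\<lambda>j. Vset R G (initial_ideal R xs j)) in
      if i = 0 then \<theta> (V 1) M else canonical_map T \<Gamma>o \<Gamma>a \<theta> (V (Suc i)) (V i) M)"

end

theory Submission
  imports Defs
begin

text \<open>
  Write \<open>H(X)\<close> for the graded module \<open>Hom\<^sup>*(C, X)\<close>. All three conditions are reduced to the same kind
  of statement: the \<open>i\<close>-th element of the sequence acts injectively on \<open>H\<close> of the \<open>i\<close>-th object of some
  chain, with \<open>M\<close> as the object at the start.

  \<^item> For Koszul objects the long exact sequence of \<open>K \<rightarrow> \<Sigma>\<^sup>d K \<rightarrow> K//x \<rightarrow> \<Sigma> K\<close> shows that the last map is
    ghost iff \<open>x\<close> is injective on \<open>H(K)\<close>, and that in this case \<open>H(K//x)\<close> is \<open>H(K)/x H(K)\<close> up to a shift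
    (\<open>ghost_koszul_iff\<close>, \<open>regular_mod_koszul\<close>). So regularity of the rest of the sequence on
    \<open>H(K)/x H(K)\<close> is regularity on \<open>H(K//x)\<close>, and the equivalence of \<open>cond1\<close> and \<open>cond2\<close> follows along the chain
    (\<open>regular_mod_chain\<close>).

  \<^item> For local cohomology let \<open>A'\<close> be the next object after \<open>A\<close>, with the canonical map \<open>c\<close> from \<open>A'\<close> to
    \<open>A\<close> and its cone \<open>E\<close>. Then \<open>H(A')\<close> is \<open>x\<close>-torsion and \<open>x\<close> is bijective on \<open>H(E)\<close>
    (\<open>coreflection_torsion\<close>). Hence \<open>c\<close> is ghost iff \<open>x\<close> is injective on \<open>H(A)\<close>, and in this case there is
    an exact sequence \<open>0 \<rightarrow> H(A) \<rightarrow> H(E) \<rightarrow> H(\<Sigma> A') \<rightarrow> 0\<close>. The algebra of such sequences shows that the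
    rest of the sequence is regular on \<open>H(A)/x H(A)\<close> iff it is regular on \<open>H(A')\<close>
    (\<open>regular_mod_torsion\<close>), because \<open>H(A)/x H(A)\<close> is the annihilator of \<open>x\<close> in the \<open>x\<close>-torsion,
    \<open>x\<close>-divisible module \<open>H(\<Sigma> A')\<close>. The equivalence of \<open>cond1\<close> and \<open>cond3\<close> again follows
    along the chain.

  The two properties used for local cohomology need no homotopy colimits. For the first, the objects
  \<open>X\<close> with \<open>H(X)\<close> torsion form a localizing subcategory, since \<open>C\<close> is compact; it contains every compact
  \<open>D\<close> supported where \<open>x\<close> vanishes, for otherwise Krull's lemma would yield a homogeneous prime in the
  support of \<open>D\<close> that does not contain \<open>x\<close> (\<open>power_annihilates_torsion_compact\<close>). For the second, one
  shows \<open>Hom\<^sup>*(C, E//x) = 0\<close>. If \<open>D\<close> is a generator of the torsion subcategory that contains \<open>A\<close>, then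
  \<open>D//x\<close> is a generator of the next one, to which \<open>E\<close> is right orthogonal, so \<open>Hom\<^sup>*(D, E//x) = 0\<close>. As
  \<open>E//x\<close> lies in the localizing subcategory generated by these \<open>D\<close>, it vanishes. At the start of the
  chain \<open>C\<close> itself is one of the \<open>D\<close>.
\<close>

section \<open>Integer powers of a bijection\<close>

text \<open>The common pattern behind \<^const>\<open>susp_obj\<close> and \<^const>\<open>susp_arr\<close>.\<close>

definition int_power :: "'a set \<Rightarrow> ('a \<Rightarrow> 'a) \<Rightarrow> int \<Rightarrow> 'a \<Rightarrow> 'a" where
  "int_power A f n = (if 0 \<le> n then f ^^ nat n else inv_into A f ^^ nat (- n))"

context
  fixes A :: "'a set" and f :: "'a \<Rightarrow> 'a"
  assumes bij: "bij_betw f A A"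
begin

lemma int_power_closed:
  assumes "a \<in> A"
  shows "int_power A f n a \<in> A"
proof -
  have "(f ^^ k) a \<in> A" for k
    using assms bij by (induction k) (auto simp: bij_betw_def)
  moreover have "(inv_into A f ^^ k) a \<in> A" for k
    using assms bij_betw_inv_into[OF bij] by (induction k) (auto simp: bij_betw_def)
  ultimately show ?thesis
    by (simp add: int_power_def)
qed

lemma int_power_plus_one:
  assumes "a \<in> A"
  shows "int_power A f (n + 1) a = f (int_power A f n a)"
proof (cases "0 \<le> n")
  case True
  then have "nat (n + 1) = Suc (nat n)" by simp
  then show ?thesis using True by (simp add: int_power_def)
next
  case False
  then obtain k where k: "nat (- n) = Suc k" "nat (- (n + 1)) = k"
    using that[of "nat (- n) - 1"] by simp
  have "(inv_into A f ^^ k) a \<in> A"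
    using assms bij_betw_inv_into[OF bij] by (induction k) (auto simp: bij_betw_def)
  then have "f (inv_into A f ((inv_into A f ^^ k) a)) = (inv_into A f ^^ k) a"
    by (rule bij_betw_inv_into_right[OF bij])
  moreover have "int_power A f n a = inv_into A f ((inv_into A f ^^ k) a)"
    using False k by (simp add: int_power_def)
  moreover have "int_power A f (n + 1) a = (inv_into A f ^^ k) a"
  proof (cases "n = -1")
    case True
    then show ?thesis using k by (simp add: int_power_def)
  next
    case False
    then show ?thesis using \<open>\<not> 0 \<le> n\<close> k by (simp add: int_power_def)
  qed
  ultimately show ?thesis by simp
qed

lemma int_power_zero: "int_power A f 0 a = a"
  by (simp add: int_power_def)

lemma int_power_add:
  assumes "a \<in> A"
  shows "int_power A f (m + n) a = int_power A f m (int_power A f n a)"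
proof (induction m rule: int_induct[where k = 0])
  case base
  then show ?case by (simp add: int_power_zero)
next
  case (step1 i)
  have "int_power A f (i + 1 + n) a = f (int_power A f (i + n) a)"
    using int_power_plus_one[OF assms, of "i + n"] by (simp add: ac_simps)
  then show ?case
    using step1 int_power_plus_one int_power_closed assms by simp
next
  case (step2 i)
  have "f (int_power A f (i - 1 + n) a) = int_power A f (i + n) a"
    using int_power_plus_one[OF assms, of "i - 1 + n"] by (simp add: algebra_simps)
  also have "\<dots> = f (int_power A f (i - 1) (int_power A f n a))"
    using step2 int_power_plus_one[of "int_power A f n a" "i - 1"] int_power_closed assms by simp
  finally show ?case
    using bij assms by (metis bij_betw_inv_into_left int_power_closed)
qed

end


section \<open>Additive categories\<close>

context category
begin

lemma HomD:
  assumes "f \<in> Hom T a b"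
  shows "f \<in> Arr T" "Dom T f = a" "Cod T f = b" "a \<in> Obj T" "b \<in> Obj T"
  using assms Dom_Obj Cod_Obj by (auto simp: Hom_def)

lemma Arr_Hom: "f \<in> Arr T \<Longrightarrow> f \<in> Hom T (Dom T f) (Cod T f)"
  by (simp add: Hom_def)

lemma inverse_arr_unique:
  assumes "inverse_arr T f g" "inverse_arr T f g'"
  shows "g = g'"
proof -
  have f: "f \<in> Hom T (Dom T f) (Cod T f)"
    and g: "g \<in> Hom T (Cod T f) (Dom T f)" "g \<cdot> f = Idn T (Dom T f)"
    and g': "g' \<in> Hom T (Cod T f) (Dom T f)" "f \<cdot> g' = Idn T (Cod T f)"
    using assms by (auto simp: inverse_arr_def Hom_def)
  have "g = g \<cdot> (f \<cdot> g')" using g g' Comp_Idn_right by simp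
  also have "\<dots> = (g \<cdot> f) \<cdot> g'" using Comp_assoc[OF g'(1) f g(1)] by simp
  also have "\<dots> = g'" using g g' Comp_Idn_left by simp
  finally show ?thesis .
qed

lemma the_inverse_eq: "inverse_arr T f g \<Longrightarrow> the_inverse T f = g"
  unfolding the_inverse_def using inverse_arr_unique by blast

lemma coproduct_eqI:
  assumes cp: "is_coproduct T I X S \<iota>" and u: "u \<in> Hom T S Y" and v: "v \<in> Hom T S Y"
    and eq: "\<And>i. i \<in> I \<Longrightarrow> u \<cdot> \<iota> i = v \<cdot> \<iota> i"
  shows "u = v"
proof -
  have Y: "Y \<in> Obj T" using HomD[OF u] by simp
  have h: "\<forall>i\<in>I. u \<cdot> \<iota> i \<in> Hom T (X i) Y"
    using cp u Comp_Hom by (auto simp: is_coproduct_def)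
  have "\<exists>!w. w \<in> Hom T S Y \<and> (\<forall>i\<in>I. w \<cdot> \<iota> i = u \<cdot> \<iota> i)"
    using cp Y h unfolding is_coproduct_def
    by (elim conjE) (drule bspec[OF _ Y], drule spec[of _ "\<lambda>i. u \<cdot> \<iota> i"], blast)
  then show ?thesis using u v eq by metis
qed

lemma coproduct_exists:
  assumes cp: "is_coproduct T I X S \<iota>" and Y: "Y \<in> Obj T"
    and f: "\<And>i. i \<in> I \<Longrightarrow> f i \<in> Hom T (X i) Y"
  shows "\<exists>u \<in> Hom T S Y. \<forall>i\<in>I. u \<cdot> \<iota> i = f i"
proof -
  have "\<exists>!u. u \<in> Hom T S Y \<and> (\<forall>i\<in>I. u \<cdot> \<iota> i = f i)"
    using cp f unfolding is_coproduct_def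
    by (elim conjE) (drule bspec[OF _ Y], drule spec[of _ f], blast)
  then show ?thesis by blast
qed

end

lemma hom_group_simps [simp]:
  "carrier (hom_group T a b) = Hom T a b"
  "monoid.mult (hom_group T a b) = Plus T"
  "one (hom_group T a b) = ZeroA T a b"
  by (simp_all add: hom_group_def)

context additive_category
begin

lemma Zero_Hom: "a \<in> Obj T \<Longrightarrow> b \<in> Obj T \<Longrightarrow> ZeroA T a b \<in> Hom T a b"
  using comm_group.axioms(2)[OF hom_group, THEN group.is_monoid, THEN monoid.one_closed] by simp

lemma Hom_group: "a \<in> Obj T \<Longrightarrow> b \<in> Obj T \<Longrightarrow> group (hom_group T a b)"
  using hom_group comm_group.axioms(2) by blast

lemma Plus_Hom: "f \<in> Hom T a b \<Longrightarrow> g \<in> Hom T a b \<Longrightarrow> Plus T f g \<in> Hom T a b"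
  using Hom_group[THEN group.is_monoid, THEN monoid.m_closed] HomD by (metis hom_group_simps(1,2))

lemma neg_eq_inv: "f \<in> Hom T a b \<Longrightarrow> neg T f = inv\<^bsub>hom_group T a b\<^esub> f"
  by (simp add: neg_def Hom_def)

lemma neg_Hom: "f \<in> Hom T a b \<Longrightarrow> neg T f \<in> Hom T a b"
  using Hom_group[THEN group.inv_closed] HomD neg_eq_inv by (metis hom_group_simps(1))

lemma signed_Hom: "f \<in> Hom T a b \<Longrightarrow> signed T n f \<in> Hom T a b"
  by (simp add: signed_def neg_Hom)

lemma Comp_left_hom:
  assumes "g \<in> Hom T b c" "a \<in> Obj T"
  shows "(\<lambda>f. g \<cdot> f) \<in> hom (hom_group T a b) (hom_group T a c)"
  using assms Comp_Hom Comp_Plus_right by (auto simp: hom_def)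

lemma Comp_right_hom:
  assumes "f \<in> Hom T a b" "c \<in> Obj T"
  shows "(\<lambda>g. g \<cdot> f) \<in> hom (hom_group T b c) (hom_group T a c)"
  using assms Comp_Hom Comp_Plus_left by (auto simp: hom_def)

lemma Comp_Zero_right:
  assumes "g \<in> Hom T b c" "a \<in> Obj T"
  shows "g \<cdot> ZeroA T a b = ZeroA T a c"
  using hom_one[OF Comp_left_hom[OF assms]] Hom_group HomD[OF assms(1)] assms by simp

lemma Comp_Zero_left:
  assumes "f \<in> Hom T a b" "c \<in> Obj T"
  shows "ZeroA T b c \<cdot> f = ZeroA T a c"
  using hom_one[OF Comp_right_hom[OF assms]] Hom_group HomD[OF assms(1)] assms by simp

lemma Comp_neg_right:
  assumes "f \<in> Hom T a b" "g \<in> Hom T b c"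
  shows "g \<cdot> neg T f = neg T (g \<cdot> f)"
proof -
  have "group_hom (hom_group T a b) (hom_group T a c) (\<lambda>f. g \<cdot> f)"
    using assms HomD Comp_left_hom Hom_group by (auto simp: group_hom_def group_hom_axioms_def)
  from group_hom.hom_inv[OF this, of f] show ?thesis
    using assms neg_eq_inv Comp_Hom by (metis hom_group_simps(1))
qed

lemma Comp_neg_left:
  assumes "f \<in> Hom T a b" "g \<in> Hom T b c"
  shows "neg T g \<cdot> f = neg T (g \<cdot> f)"
proof -
  have "group_hom (hom_group T b c) (hom_group T a c) (\<lambda>g. g \<cdot> f)"
    using assms HomD Comp_right_hom Hom_group by (auto simp: group_hom_def group_hom_axioms_def)
  from group_hom.hom_inv[OF this, of g] show ?thesis
    using assms neg_eq_inv Comp_Hom by (metis hom_group_simps(1))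
qed

lemma neg_eq_Zero_iff:
  assumes "f \<in> Hom T a b"
  shows "neg T f = ZeroA T a b \<longleftrightarrow> f = ZeroA T a b"
proof -
  interpret H: group "hom_group T a b" using Hom_group HomD[OF assms] by blast
  show ?thesis using H.inv_eq_1_iff[of f] neg_eq_inv[OF assms] assms by simp
qed

lemma neg_neg: "f \<in> Hom T a b \<Longrightarrow> neg T (neg T f) = f"
proof -
  assume f: "f \<in> Hom T a b"
  interpret H: group "hom_group T a b" using Hom_group HomD[OF f] by blast
  show ?thesis using f neg_Hom neg_eq_inv H.inv_inv by (metis hom_group_simps(1))
qed

lemma signed_eq_Zero_iff:
  "f \<in> Hom T a b \<Longrightarrow> signed T n f = ZeroA T a b \<longleftrightarrow> f = ZeroA T a b"
  by (simp add: signed_def neg_eq_Zero_iff)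

lemma Comp_signed_right:
  "f \<in> Hom T a b \<Longrightarrow> g \<in> Hom T b c \<Longrightarrow> g \<cdot> signed T n f = signed T n (g \<cdot> f)"
  by (simp add: signed_def Comp_neg_right)

lemma Comp_signed_left:
  "f \<in> Hom T a b \<Longrightarrow> g \<in> Hom T b c \<Longrightarrow> signed T n g \<cdot> f = signed T n (g \<cdot> f)"
  by (simp add: signed_def Comp_neg_left)

lemma signed_signed: "f \<in> Hom T a b \<Longrightarrow> signed T m (signed T n f) = signed T (m + n) f"
  by (auto simp: signed_def neg_neg)

lemma neg_Zero: "a \<in> Obj T \<Longrightarrow> b \<in> Obj T \<Longrightarrow> neg T (ZeroA T a b) = ZeroA T a b"
  using neg_eq_Zero_iff Zero_Hom by blast

lemma zero_object_Hom_from: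
  assumes "zero_object T Z" "f \<in> Hom T Z Y"
  shows "f = ZeroA T Z Y"
  using assms Comp_Idn_right[of f Z Y] Comp_Zero_right[of f Z Y Z] by (simp add: zero_object_def)

lemma zero_object_Hom_to:
  assumes "zero_object T Z" "f \<in> Hom T Y Z"
  shows "f = ZeroA T Y Z"
  using assms Comp_Idn_left[of f Y Z] Comp_Zero_left[of f Y Z Z] by (simp add: zero_object_def)

lemma zero_object_exists: "\<exists>Z. zero_object T Z"
proof -
  obtain Z \<iota> where Z: "is_coproduct T ({} :: nat set) (\<lambda>_. undefined) Z \<iota>"
    using finite_coproducts[of "{}" "\<lambda>_. undefined"] by auto
  then have "Z \<in> Obj T" by (simp add: is_coproduct_def)
  then show ?thesis
    using coproduct_eqI[OF Z Idn_Hom Zero_Hom] by (auto simp: zero_object_def)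
qed

end


section \<open>Triangulated categories\<close>

subsection \<open>Integer suspensions\<close>

lemma susp_obj_int_power: "susp_obj T n = int_power (Obj T) (SuspO T) n"
  by (simp add: susp_obj_def int_power_def)

lemma susp_arr_int_power: "susp_arr T n = int_power (Arr T) (SuspA T) n"
  by (simp add: susp_arr_def int_power_def)

context triangulated_category
begin

lemma susp_obj_Obj: "a \<in> Obj T \<Longrightarrow> susp_obj T n a \<in> Obj T"
  by (simp add: susp_obj_int_power int_power_closed SuspO_bij)

lemma susp_obj_zero [simp]: "susp_obj T 0 a = a"
  by (simp add: susp_obj_int_power int_power_def)

lemma susp_obj_one [simp]: "susp_obj T 1 a = SuspO T a"
  by (simp add: susp_obj_def)

lemma susp_obj_susp_obj: "a \<in> Obj T \<Longrightarrow> susp_obj T m (susp_obj T n a) = susp_obj T (m + n) a"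
  by (simp add: susp_obj_int_power int_power_add SuspO_bij)

lemma susp_obj_SuspO: "a \<in> Obj T \<Longrightarrow> susp_obj T n (SuspO T a) = susp_obj T (n + 1) a"
  using susp_obj_susp_obj[of a n 1] by simp

lemma SuspO_susp_obj: "a \<in> Obj T \<Longrightarrow> SuspO T (susp_obj T n a) = susp_obj T (n + 1) a"
  using susp_obj_susp_obj[of a 1 n] by (simp add: add.commute)

lemma susp_arr_Arr: "f \<in> Arr T \<Longrightarrow> susp_arr T n f \<in> Arr T"
  by (simp add: susp_arr_int_power int_power_closed SuspA_bij)

lemma susp_arr_zero [simp]: "susp_arr T 0 f = f"
  by (simp add: susp_arr_int_power int_power_def)

lemma susp_arr_one [simp]: "susp_arr T 1 f = SuspA T f"
  by (simp add: susp_arr_def)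

lemma susp_arr_susp_arr: "f \<in> Arr T \<Longrightarrow> susp_arr T m (susp_arr T n f) = susp_arr T (m + n) f"
  by (simp add: susp_arr_int_power int_power_add SuspA_bij)

lemma susp_arr_inverse [simp]: "f \<in> Arr T \<Longrightarrow> susp_arr T n (susp_arr T (- n) f) = f"
  "f \<in> Arr T \<Longrightarrow> susp_arr T (- n) (susp_arr T n f) = f"
  by (simp_all add: susp_arr_susp_arr)

lemma susp_obj_inverse [simp]: "a \<in> Obj T \<Longrightarrow> susp_obj T n (susp_obj T (- n) a) = a"
  "a \<in> Obj T \<Longrightarrow> susp_obj T (- n) (susp_obj T n a) = a"
  by (simp_all add: susp_obj_susp_obj)

lemma susp_arr_plus_one: "f \<in> Arr T \<Longrightarrow> susp_arr T (n + 1) f = SuspA T (susp_arr T n f)"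
  using susp_arr_susp_arr[of f 1 n] by (simp add: add.commute)

lemma susp_arr_minus_one: "f \<in> Arr T \<Longrightarrow> SuspA T (susp_arr T (n - 1) f) = susp_arr T n f"
  using susp_arr_plus_one[of f "n - 1"] by simp

lemma SuspA_inject: "f \<in> Arr T \<Longrightarrow> g \<in> Arr T \<Longrightarrow> SuspA T f = SuspA T g \<Longrightarrow> f = g"
  using SuspA_bij by (auto simp: bij_betw_def inj_on_def)

lemma SuspA_Hom_reflect:
  assumes "f \<in> Arr T" "a \<in> Obj T" "b \<in> Obj T" "SuspA T f \<in> Hom T (SuspO T a) (SuspO T b)"
  shows "f \<in> Hom T a b"
proof -
  have "SuspA T f \<in> Hom T (SuspO T (Dom T f)) (SuspO T (Cod T f))"
    using assms Arr_Hom SuspA_Hom by blast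
  then have "SuspO T (Dom T f) = SuspO T a" "SuspO T (Cod T f) = SuspO T b"
    using assms(4) by (auto simp: Hom_def)
  moreover have "inj_on (SuspO T) (Obj T)" using SuspO_bij by (simp add: bij_betw_def)
  ultimately show ?thesis
    using assms Dom_Obj Cod_Obj by (auto simp: Hom_def inj_on_def)
qed

lemma susp_arr_Hom:
  assumes f: "f \<in> Hom T a b"
  shows "susp_arr T n f \<in> Hom T (susp_obj T n a) (susp_obj T n b)"
proof (induction n rule: int_induct[where k = 0])
  case base
  then show ?case using f by simp
next
  case (step1 i)
  then show ?case
    using SuspA_Hom[OF step1(2)] f HomD[OF f] by (simp add: susp_arr_plus_one SuspO_susp_obj)
next
  case (step2 i)
  have "SuspA T (susp_arr T (i - 1) f) \<in>
      Hom T (SuspO T (susp_obj T (i - 1) a)) (SuspO T (susp_obj T (i - 1) b))"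
    using step2 HomD[OF f] by (simp add: susp_arr_minus_one SuspO_susp_obj)
  then show ?case
    using SuspA_Hom_reflect susp_arr_Arr susp_obj_Obj HomD[OF f] by blast
qed

lemma susp_arr_Comp:
  assumes f: "f \<in> Hom T a b" and g: "g \<in> Hom T b c"
  shows "susp_arr T n (g \<cdot> f) = susp_arr T n g \<cdot> susp_arr T n f"
proof (induction n rule: int_induct[where k = 0])
  case base
  then show ?case by simp
next
  case (step1 i)
  then show ?case
    using SuspA_Comp[OF susp_arr_Hom[OF f] susp_arr_Hom[OF g]] HomD(1)[OF f] HomD(1)[OF g]
      HomD(1)[OF Comp_Hom[OF f g]] by (simp add: susp_arr_plus_one)
next
  case (step2 i)
  have "SuspA T (susp_arr T (i - 1) (g \<cdot> f)) =
      SuspA T (susp_arr T (i - 1) g \<cdot> susp_arr T (i - 1) f)"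
    using step2 SuspA_Comp[OF susp_arr_Hom[OF f] susp_arr_Hom[OF g]] HomD(1)[OF f]
      HomD(1)[OF g] HomD(1)[OF Comp_Hom[OF f g]] by (simp add: susp_arr_minus_one)
  moreover have "susp_arr T (i - 1) g \<cdot> susp_arr T (i - 1) f \<in> Arr T"
    using Comp_Hom[OF susp_arr_Hom[OF f] susp_arr_Hom[OF g]] HomD by blast
  ultimately show ?case
    using SuspA_inject susp_arr_Arr HomD(1)[OF Comp_Hom[OF f g]] by blast
qed

lemma susp_arr_Plus:
  assumes f: "f \<in> Hom T a b" and g: "g \<in> Hom T a b"
  shows "susp_arr T n (Plus T f g) = Plus T (susp_arr T n f) (susp_arr T n g)"
proof (induction n rule: int_induct[where k = 0])
  case base
  then show ?case by simp
next
  case (step1 i)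
  then show ?case
    using SuspA_Plus[OF susp_arr_Hom[OF f] susp_arr_Hom[OF g]] HomD(1)[OF f] HomD(1)[OF g]
      HomD(1)[OF Plus_Hom[OF f g]] by (simp add: susp_arr_plus_one)
next
  case (step2 i)
  have "SuspA T (susp_arr T (i - 1) (Plus T f g)) =
      SuspA T (Plus T (susp_arr T (i - 1) f) (susp_arr T (i - 1) g))"
    using step2 SuspA_Plus[OF susp_arr_Hom[OF f] susp_arr_Hom[OF g]] HomD(1)[OF f]
      HomD(1)[OF g] HomD(1)[OF Plus_Hom[OF f g]] by (simp add: susp_arr_minus_one)
  moreover have "Plus T (susp_arr T (i - 1) f) (susp_arr T (i - 1) g) \<in> Arr T"
    using Plus_Hom[OF susp_arr_Hom[OF f] susp_arr_Hom[OF g]] HomD by blast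
  ultimately show ?case
    using SuspA_inject susp_arr_Arr HomD(1)[OF Plus_Hom[OF f g]] by blast
qed

lemma susp_arr_inject:
  "f \<in> Arr T \<Longrightarrow> g \<in> Arr T \<Longrightarrow> susp_arr T n f = susp_arr T n g \<longleftrightarrow> f = g"
  by (metis susp_arr_inverse(2))

lemma susp_arr_hom:
  assumes "a \<in> Obj T" "b \<in> Obj T"
  shows "susp_arr T n \<in> hom (hom_group T a b) (hom_group T (susp_obj T n a) (susp_obj T n b))"
  using assms susp_arr_Hom susp_arr_Plus by (auto simp: hom_def)

lemma susp_arr_Zero:
  assumes "a \<in> Obj T" "b \<in> Obj T"
  shows "susp_arr T n (ZeroA T a b) = ZeroA T (susp_obj T n a) (susp_obj T n b)"
  using hom_one[OF susp_arr_hom[OF assms]] Hom_group assms susp_obj_Obj by simp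

lemma susp_arr_neg:
  assumes f: "f \<in> Hom T a b"
  shows "susp_arr T n (neg T f) = neg T (susp_arr T n f)"
proof -
  have "group_hom (hom_group T a b) (hom_group T (susp_obj T n a) (susp_obj T n b)) (susp_arr T n)"
    using HomD[OF f] susp_arr_hom Hom_group susp_obj_Obj
    by (auto simp: group_hom_def group_hom_axioms_def)
  from group_hom.hom_inv[OF this, of f] show ?thesis
    using f neg_eq_inv susp_arr_Hom by (metis hom_group_simps(1))
qed

lemma susp_arr_signed:
  "f \<in> Hom T a b \<Longrightarrow> susp_arr T n (signed T k f) = signed T k (susp_arr T n f)"
  by (simp add: signed_def susp_arr_neg)

lemma susp_arr_Idn:
  assumes a: "a \<in> Obj T"
  shows "susp_arr T n (Idn T a) = Idn T (susp_obj T n a)"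
proof -
  \<comment> \<open>A left unit among the endomorphisms of \<open>\<Sigma>\<^sup>n a\<close>, as these are all suspended.\<close>
  let ?b = "susp_obj T n a" and ?u = "susp_arr T (- n) (Idn T (susp_obj T n a))"
  have u: "?u \<in> Hom T a a"
    using susp_arr_Hom[OF Idn_Hom[OF susp_obj_Obj[OF a, of n]], of "- n"] a by simp
  have "?u = Idn T a \<cdot> ?u" using Comp_Idn_left[OF u] by simp
  then have "susp_arr T n ?u = susp_arr T n (Idn T a) \<cdot> susp_arr T n ?u"
    using susp_arr_Comp[OF u Idn_Hom[OF a]] by simp
  moreover have "susp_arr T n ?u = Idn T ?b"
    using HomD(1)[OF Idn_Hom[OF susp_obj_Obj[OF a]]] by simp
  ultimately show ?thesis
    using Comp_Idn_right[OF susp_arr_Hom[OF Idn_Hom[OF a]]] by simp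
qed

lemma susp_arr_eq_Zero_iff:
  assumes "f \<in> Hom T a b"
  shows "susp_arr T n f = ZeroA T (susp_obj T n a) (susp_obj T n b) \<longleftrightarrow> f = ZeroA T a b"
  using assms susp_arr_Zero susp_arr_inject Zero_Hom HomD by metis

lemma susp_arr_obtain:
  assumes "f \<in> Hom T (susp_obj T n a) (susp_obj T n b)" "a \<in> Obj T" "b \<in> Obj T"
  obtains g where "g \<in> Hom T a b" "f = susp_arr T n g"
proof
  show "susp_arr T (- n) f \<in> Hom T a b"
    using susp_arr_Hom[OF assms(1), of "- n"] assms by simp
  show "f = susp_arr T n (susp_arr T (- n) f)"
    using HomD(1)[OF assms(1)] by simp
qed

lemma zero_object_susp:
  assumes "zero_object T Z"
  shows "zero_object T (susp_obj T n Z)"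
  using assms susp_arr_Idn[of Z n] susp_arr_Zero[of Z Z n] susp_obj_Obj
  by (auto simp: zero_object_def)

end

subsection \<open>Long exact sequences\<close>

context triangulated_category
begin

lemma TriD:
  assumes "(f, g, h) \<in> Tri T"
  shows "f \<in> Hom T (Dom T f) (Dom T g)" "g \<in> Hom T (Dom T g) (Dom T h)"
    "h \<in> Hom T (Dom T h) (SuspO T (Dom T f))"
    "Cod T f = Dom T g" "Cod T g = Dom T h" "Cod T h = SuspO T (Dom T f)"
    "Dom T f \<in> Obj T" "Dom T g \<in> Obj T" "Dom T h \<in> Obj T"
  using Tri_candidate[OF assms] Dom_Obj Cod_Obj by (auto simp: candidate_triangle_def Hom_def)

lemma Tri_rotate:
  assumes "(f, g, h) \<in> Tri T"
  shows "(g, h, neg T (SuspA T f)) \<in> Tri T"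
  using assms TR2[OF Tri_candidate[OF assms]] by simp

text \<open>The contractible triangles on an identity, in the two positions in which they are used.\<close>

lemma Tri_identity_first:
  assumes "X \<in> Obj T" "zero_object T Z"
  shows "(ZeroA T X Z, ZeroA T Z (SuspO T X), neg T (Idn T (SuspO T X))) \<in> Tri T"
  using Tri_rotate[OF TR1_id[OF assms]] SuspA_Idn[OF assms(1)] by simp

lemma Tri_identity_second:
  assumes X: "X \<in> Obj T" and Z: "zero_object T Z"
  shows "(ZeroA T Z X, Idn T X, ZeroA T X (SuspO T Z)) \<in> Tri T"
proof -
  have ZO: "Z \<in> Obj T" using Z by (simp add: zero_object_def)
  have Z': "zero_object T (SuspO T Z)" using zero_object_susp[OF Z, of 1] by simp
  then have SZ: "SuspO T Z \<in> Obj T" by (simp add: zero_object_def)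
  have SX: "SuspO T X \<in> Obj T" using susp_obj_Obj[OF X, of 1] by simp
  have "neg T (SuspA T (ZeroA T Z X)) = ZeroA T (SuspO T Z) (SuspO T X)"
    using susp_arr_Zero[OF ZO X, of 1] neg_Zero[OF SZ SX] by simp
  moreover have "candidate_triangle T (ZeroA T Z X) (Idn T X) (ZeroA T X (SuspO T Z))"
    using Zero_Hom[OF ZO X] Zero_Hom[OF X SZ] Idn_Hom[OF X]
    by (auto simp: candidate_triangle_def Hom_def)
  ultimately show ?thesis
    using TR2 TR1_id[OF X Z'] by simp
qed

lemma Tri_Comp_zero:
  assumes t: "(f, g, h) \<in> Tri T"
  shows "g \<cdot> f = ZeroA T (Dom T f) (Dom T h)"
proof -
  obtain Z where Z: "zero_object T Z" using zero_object_exists by blast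
  then have ZO: "Z \<in> Obj T" by (simp add: zero_object_def)
  let ?X = "Dom T f"
  have X: "?X \<in> Obj T" using TriD[OF t] by blast
  have d: "Dom T (Idn T ?X) = ?X" "Cod T (Idn T ?X) = ?X" "Dom T (ZeroA T ?X Z) = ?X"
    "Dom T (ZeroA T Z (SuspO T ?X)) = Z"
    using HomD[OF Idn_Hom[OF X]] HomD[OF Zero_Hom[OF X ZO]]
      HomD[OF Zero_Hom[OF ZO susp_obj_Obj[OF X, of 1]]] by auto
  obtain s where "triangle_morphism T (Idn T ?X, ZeroA T ?X Z, ZeroA T Z (SuspO T ?X)) (f, g, h)
      (Idn T ?X) f s"
    using TR3[OF TR1_id[OF X Z] t, of "Idn T ?X" f] d Idn_Hom[OF X] TriD[OF t] by auto
  then have "s \<in> Hom T Z (Dom T h)" "s \<cdot> ZeroA T ?X Z = g \<cdot> f"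
    using d by (auto simp: triangle_morphism_def)
  then show ?thesis using Comp_Zero_right X by metis
qed

lemma Tri_exact_covariant:
  assumes t: "(f, g, h) \<in> Tri T" and u: "u \<in> Hom T D (Dom T g)"
    and gu: "g \<cdot> u = ZeroA T D (Dom T h)"
  shows "\<exists>v \<in> Hom T D (Dom T f). u = f \<cdot> v"
proof -
  obtain Z where Z: "zero_object T Z" using zero_object_exists by blast
  then have ZO: "Z \<in> Obj T" by (simp add: zero_object_def)
  let ?Z0 = "ZeroA T Z (Dom T h)"
  note TD = TriD[OF t]
  have D: "D \<in> Obj T" using HomD[OF u] by simp
  have SD: "SuspO T D \<in> Obj T" using susp_obj_Obj[OF D, of 1] by simp
  note t1 = Tri_identity_first[OF D Z] and t2 = Tri_rotate[OF t]
  have d: "Dom T (ZeroA T D Z) = D" "Cod T (ZeroA T D Z) = Z"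
    "Dom T (neg T (Idn T (SuspO T D))) = SuspO T D"
    using HomD[OF Zero_Hom[OF D ZO]] HomD[OF neg_Hom[OF Idn_Hom[OF SD]]] by auto
  have Sf: "SuspA T f \<in> Hom T (SuspO T (Dom T f)) (SuspO T (Dom T g))"
    using SuspA_Hom[OF TD(1)] .
  have "?Z0 \<cdot> ZeroA T D Z = g \<cdot> u"
    using Comp_Zero_right[OF Zero_Hom[OF ZO TD(9)] D] gu by simp
  \<comment> \<open>The pair of \<open>u\<close> and \<open>0\<close> extends to a morphism of triangles from \<open>D \<rightarrow> 0 \<rightarrow> \<Sigma> D\<close>.\<close>
  then obtain w where "triangle_morphism T (ZeroA T D Z, ZeroA T Z (SuspO T D),
      neg T (Idn T (SuspO T D))) (g, h, neg T (SuspA T f)) u ?Z0 w"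
    using TR3[OF t1 t2, of u ?Z0] d u TD Zero_Hom[OF ZO TD(9)] by auto
  then have w: "w \<in> Hom T (SuspO T D) (SuspO T (Dom T f))"
    and eq: "SuspA T u \<cdot> neg T (Idn T (SuspO T D)) = neg T (SuspA T f) \<cdot> w"
    using d HomD[OF neg_Hom[OF Sf]] by (auto simp: triangle_morphism_def)
  obtain v where v: "v \<in> Hom T D (Dom T f)" "w = SuspA T v"
    using susp_arr_obtain[of w 1] w D TD by auto
  have Su: "SuspA T u \<in> Hom T (SuspO T D) (SuspO T (Dom T g))" using SuspA_Hom[OF u] .
  have "neg T (SuspA T u) = neg T (SuspA T f \<cdot> w)"
    using eq Comp_neg_right[OF Idn_Hom[OF SD] Su] Comp_neg_left[OF w Sf] Comp_Idn_right[OF Su]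
    by simp
  then have "SuspA T u = SuspA T f \<cdot> w"
    using neg_neg[OF Su] neg_neg[OF Comp_Hom[OF w Sf]] by metis
  also have "\<dots> = SuspA T (f \<cdot> v)"
    using v SuspA_Comp[OF v(1) TD(1)] by simp
  finally show ?thesis
    using v SuspA_inject HomD(1)[OF u] HomD(1)[OF Comp_Hom[OF v(1) TD(1)]] by blast
qed

lemma Tri_exact_contravariant:
  assumes t: "(f, g, h) \<in> Tri T" and u: "u \<in> Hom T (Dom T g) W"
    and uf: "u \<cdot> f = ZeroA T (Dom T f) W"
  shows "\<exists>v \<in> Hom T (Dom T h) W. u = v \<cdot> g"
proof -
  obtain Z where Z: "zero_object T Z" using zero_object_exists by blast
  then have ZO: "Z \<in> Obj T" by (simp add: zero_object_def)
  note TD = TriD[OF t]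
  have W: "W \<in> Obj T" using HomD[OF u] by simp
  have SZ: "SuspO T Z \<in> Obj T" using susp_obj_Obj[OF ZO, of 1] by simp
  have d: "Dom T (ZeroA T Z W) = Z" "Cod T (ZeroA T Z W) = W" "Dom T (Idn T W) = W"
    "Dom T (ZeroA T W (SuspO T Z)) = W"
    using HomD[OF Zero_Hom[OF ZO W]] HomD[OF Idn_Hom[OF W]] HomD[OF Zero_Hom[OF W SZ]] by auto
  have "u \<cdot> f = ZeroA T Z W \<cdot> ZeroA T (Dom T f) Z"
    using uf Comp_Zero_right[OF Zero_Hom[OF ZO W] TD(7)] by simp
  then obtain v where "triangle_morphism T (f, g, h)
      (ZeroA T Z W, Idn T W, ZeroA T W (SuspO T Z)) (ZeroA T (Dom T f) Z) u v"
    using TR3[OF t Tri_identity_second[OF W Z], of "ZeroA T (Dom T f) Z" u]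
      d u TD Zero_Hom[OF TD(7) ZO] by auto
  then have "v \<in> Hom T (Dom T h) W" "v \<cdot> g = Idn T W \<cdot> u"
    using d by (auto simp: triangle_morphism_def)
  then show ?thesis using Comp_Idn_left[OF u] by auto
qed

text \<open>The remaining places of the long exact sequences for \<open>Hom(-, W)\<close> and \<open>Hom\<^sup>*(D, -)\<close>. The sign in the
  rotated triangle affects neither kernels nor images.\<close>

lemma Tri_exact_contravariant_last:
  assumes t: "(f, g, h) \<in> Tri T" and u: "u \<in> Hom T (Dom T h) W"
    and ug: "u \<cdot> g = ZeroA T (Dom T g) W"
  shows "\<exists>v \<in> Hom T (SuspO T (Dom T f)) W. u = v \<cdot> h"
proof -
  have "Dom T (neg T (SuspA T f)) = SuspO T (Dom T f)"
    using HomD[OF neg_Hom[OF SuspA_Hom[OF TriD(1)[OF t]]]] by auto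
  then show ?thesis
    using Tri_exact_contravariant[OF Tri_rotate[OF t] u ug] by simp
qed

lemma Tri_Comp_zero_second:
  assumes t: "(f, g, h) \<in> Tri T"
  shows "h \<cdot> g = ZeroA T (Dom T g) (SuspO T (Dom T f))"
  using Tri_Comp_zero[OF Tri_rotate[OF t]]
    HomD[OF neg_Hom[OF SuspA_Hom[OF TriD(1)[OF t]]]] by auto

lemma Tri_Comp_zero_last:
  assumes t: "(f, g, h) \<in> Tri T"
  shows "SuspA T f \<cdot> h = ZeroA T (Dom T h) (SuspO T (Dom T g))"
proof -
  note TD = TriD[OF t]
  have Sf: "SuspA T f \<in> Hom T (SuspO T (Dom T f)) (SuspO T (Dom T g))"
    using SuspA_Hom[OF TD(1)] .
  have "neg T (SuspA T f) \<cdot> h = ZeroA T (Dom T h) (SuspO T (Dom T g))"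
    using Tri_Comp_zero[OF Tri_rotate[OF Tri_rotate[OF t]]]
      HomD[OF neg_Hom[OF SuspA_Hom[OF TD(2)]]] by simp
  then show ?thesis
    using Comp_neg_left[OF TD(3) Sf] neg_eq_Zero_iff[OF Comp_Hom[OF TD(3) Sf]] by simp
qed

lemma graded_exact_covariant:
  assumes t: "(f, g, h) \<in> Tri T" and u: "u \<in> Hom T D (susp_obj T n (Dom T g))"
    and gu: "susp_arr T n g \<cdot> u = ZeroA T D (susp_obj T n (Dom T h))"
  shows "\<exists>v \<in> Hom T D (susp_obj T n (Dom T f)). u = susp_arr T n f \<cdot> v"
proof -
  note TD = TriD[OF t]
  have D: "D \<in> Obj T" using HomD[OF u] by simp
  let ?D = "susp_obj T (- n) D"
  have D': "?D \<in> Obj T" using D susp_obj_Obj by blast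
  have DD: "susp_obj T n ?D = D" using D by simp
  obtain u' where u': "u' \<in> Hom T ?D (Dom T g)" "u = susp_arr T n u'"
    using susp_arr_obtain[of u n ?D] u D' TD DD by auto
  have "susp_arr T n (g \<cdot> u') = ZeroA T (susp_obj T n ?D) (susp_obj T n (Dom T h))"
    using gu u' susp_arr_Comp[OF u'(1) TD(2)] DD by simp
  then have "g \<cdot> u' = ZeroA T ?D (Dom T h)"
    using susp_arr_eq_Zero_iff[OF Comp_Hom[OF u'(1) TD(2)]] by simp
  then obtain v where v: "v \<in> Hom T ?D (Dom T f)" "u' = f \<cdot> v"
    using Tri_exact_covariant[OF t u'(1)] by blast
  then show ?thesis
    using susp_arr_Hom[OF v(1), of n] susp_arr_Comp[OF v(1) TD(1), of n] u' DD by auto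
qed

lemma graded_exact_covariant_second:
  assumes t: "(f, g, h) \<in> Tri T" and u: "u \<in> Hom T D (susp_obj T n (Dom T h))"
    and hu: "susp_arr T n h \<cdot> u = ZeroA T D (susp_obj T n (SuspO T (Dom T f)))"
  shows "\<exists>v \<in> Hom T D (susp_obj T n (Dom T g)). u = susp_arr T n g \<cdot> v"
  using graded_exact_covariant[OF Tri_rotate[OF t] u] hu
    HomD[OF neg_Hom[OF SuspA_Hom[OF TriD(1)[OF t]]]] by auto

lemma graded_exact_covariant_last:
  assumes t: "(f, g, h) \<in> Tri T" and u: "u \<in> Hom T D (susp_obj T n (SuspO T (Dom T f)))"
    and fu: "susp_arr T n (SuspA T f) \<cdot> u = ZeroA T D (susp_obj T n (SuspO T (Dom T g)))"
  shows "\<exists>v \<in> Hom T D (susp_obj T n (Dom T h)). u = susp_arr T n h \<cdot> v"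
proof -
  note TD = TriD[OF t]
  have Sf: "SuspA T f \<in> Hom T (SuspO T (Dom T f)) (SuspO T (Dom T g))"
    using SuspA_Hom[OF TD(1)] .
  have "susp_arr T n (neg T (SuspA T f)) \<cdot> u = ZeroA T D (susp_obj T n (SuspO T (Dom T g)))"
    using Comp_neg_left[OF u susp_arr_Hom[OF Sf]] fu neg_Zero HomD[OF u]
      HomD[OF susp_arr_Hom[OF Sf, of n]] susp_arr_neg[OF Sf] by simp
  moreover have "Dom T (neg T (SuspA T f)) = SuspO T (Dom T f)"
    "Dom T (neg T (SuspA T g)) = SuspO T (Dom T g)"
    using HomD[OF neg_Hom[OF Sf]] HomD[OF neg_Hom[OF SuspA_Hom[OF TD(2)]]] by auto
  ultimately show ?thesis
    using graded_exact_covariant[OF Tri_rotate[OF Tri_rotate[OF t]], of u D n] u by simp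
qed

lemma graded_Comp_zero:
  assumes f: "f \<in> Hom T a b" and g: "g \<in> Hom T b c" and gf: "g \<cdot> f = ZeroA T a c"
    and u: "u \<in> Hom T D (susp_obj T n a)"
  shows "susp_arr T n g \<cdot> (susp_arr T n f \<cdot> u) = ZeroA T D (susp_obj T n c)"
proof -
  have "susp_arr T n g \<cdot> (susp_arr T n f \<cdot> u) = susp_arr T n (g \<cdot> f) \<cdot> u"
    using Comp_assoc[OF u susp_arr_Hom[OF f] susp_arr_Hom[OF g]] susp_arr_Comp[OF f g] by simp
  also have "\<dots> = ZeroA T D (susp_obj T n c)"
    using gf susp_arr_Zero HomD[OF f] HomD[OF g] Comp_Zero_left[OF u] susp_obj_Obj by simp
  finally show ?thesis .
qed

lemma ghost_iff:
  assumes f: "f \<in> Hom T a b"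
  shows "ghost T C f \<longleftrightarrow> (\<forall>n. \<forall>g \<in> Hom T C (susp_obj T n a).
    susp_arr T n f \<cdot> g = ZeroA T C (susp_obj T n b))"
  using HomD[OF f] by (simp add: ghost_def)

lemma ghost_susp_arr:
  assumes f: "f \<in> Hom T a b"
  shows "ghost T C (susp_arr T k f) \<longleftrightarrow> ghost T C f"
proof -
  have *: "(\<forall>n::int. P (n + k)) \<longleftrightarrow> (\<forall>n. P n)" for P
    by (metis diff_add_cancel)
  have "ghost T C (susp_arr T k f) \<longleftrightarrow> (\<forall>n. \<forall>g \<in> Hom T C (susp_obj T (n + k) a).
    susp_arr T (n + k) f \<cdot> g = ZeroA T C (susp_obj T (n + k) b))"
    unfolding ghost_iff[OF susp_arr_Hom[OF f]]
    using HomD[OF f] by (simp add: susp_obj_susp_obj susp_arr_susp_arr)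
  also have "\<dots> \<longleftrightarrow> ghost T C f"
    unfolding ghost_iff[OF f] by (rule *)
  finally show ?thesis .
qed

end

section \<open>Graded ideals of a graded-commutative ring\<close>

text \<open>A homogeneous ideal seen through its homogeneous components. By graded commutativity, closure
  under multiplication from the left suffices.\<close>

definition graded_ideal ::
    "('r, 'z) ring_scheme \<Rightarrow> (int \<Rightarrow> 'r set) \<Rightarrow> (int \<Rightarrow> 'r set) \<Rightarrow> bool" where
  "graded_ideal R G P \<longleftrightarrow> (\<forall>n. P n \<subseteq> G n \<and> additive_subgroup (P n) R) \<and>
     (\<forall>m n. \<forall>r\<in>G m. \<forall>p\<in>P n. r \<otimes>\<^bsub>R\<^esub> p \<in> P (m + n))"

text \<open>The ideal of all sums of homogeneous elements from the components.\<close>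

definition total_ideal :: "('r, 'z) ring_scheme \<Rightarrow> (int \<Rightarrow> 'r set) \<Rightarrow> 'r set" where
  "total_ideal R P = {r. \<exists>c. decomposition R P r c}"

context graded_commutative_ring
begin

lemma G_carrier: "x \<in> G n \<Longrightarrow> x \<in> carrier R"
  using additive_subgroup.a_subset[OF component_subgroup] by blast

lemma G_closed [intro]:
  "x \<in> G n \<Longrightarrow> y \<in> G n \<Longrightarrow> x \<oplus> y \<in> G n" "\<zero> \<in> G n" "x \<in> G n \<Longrightarrow> \<ominus> x \<in> G n"
  using additive_subgroup.a_closed[OF component_subgroup]
    additive_subgroup.zero_closed[OF component_subgroup]
    additive_subgroup.a_inv_closed[OF component_subgroup] by blast+

lemma G_pow: "x \<in> G d \<Longrightarrow> x [^] (k::nat) \<in> G (int k * d)"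
proof (induction k)
  case 0
  then show ?case using one_degree by simp
next
  case (Suc k)
  then have "x [^] k \<otimes> x \<in> G (int k * d + d)" using mult_degree by blast
  then show ?case by (simp add: algebra_simps)
qed

lemma decomposition_finsum_superset:
  assumes c: "\<And>n. c n \<in> carrier R" and F: "finite F" "\<And>n. n \<notin> F \<Longrightarrow> c n = \<zero>"
  shows "(\<Oplus>n\<in>{n. c n \<noteq> \<zero>}. c n) = (\<Oplus>n\<in>F. c n)"
  by (rule add.finprod_mono_neutral_cong_left) (use assms in auto)

lemma decompositionI:
  assumes P: "\<And>n. P n \<subseteq> carrier R" and c: "\<And>n. c n \<in> P n"
    and F: "finite F" "\<And>n. n \<notin> F \<Longrightarrow> c n = \<zero>" and r: "r = (\<Oplus>n\<in>F. c n)"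
  shows "decomposition R P r c"
proof -
  have "{n. c n \<noteq> \<zero>} \<subseteq> F" using F(2) by blast
  moreover have "(\<Oplus>n\<in>{n. c n \<noteq> \<zero>}. c n) = (\<Oplus>n\<in>F. c n)"
    using P c by (intro decomposition_finsum_superset F) blast
  ultimately show ?thesis
    using c r F(1) by (simp add: decomposition_def finite_subset)
qed

lemma decomposition_single:
  assumes P: "\<And>n. P n \<subseteq> carrier R" "\<And>n. \<zero> \<in> P n" and p: "p \<in> P k"
  shows "decomposition R P p (\<lambda>n. if n = k then p else \<zero>)"
proof (rule decompositionI[where F = "{k}"])
  show "p = (\<Oplus>n\<in>{k}. if n = k then p else \<zero>)"
    using p P(1)[of k] by auto
qed (use assms in auto)

lemma decomposition_add:
  assumes P: "\<And>n. additive_subgroup (P n) R"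
    and r: "decomposition R P r c" and s: "decomposition R P s c'"
  shows "decomposition R P (r \<oplus> s) (\<lambda>n. c n \<oplus> c' n)"
proof -
  have PR: "P n \<subseteq> carrier R" for n
    using additive_subgroup.a_subset[OF P] .
  have c: "c n \<in> carrier R" "c' n \<in> carrier R" for n
    using PR r s unfolding decomposition_def by blast+
  let ?F = "{n. c n \<noteq> \<zero>} \<union> {n. c' n \<noteq> \<zero>}"
  have F: "finite ?F" using r s by (simp add: decomposition_def)
  have "(\<Oplus>n\<in>{n. c n \<noteq> \<zero>}. c n) = (\<Oplus>n\<in>?F. c n)"
    using decomposition_finsum_superset[of c ?F] c F by blast
  then have "r = (\<Oplus>n\<in>?F. c n)"
    using r unfolding decomposition_def by metis
  moreover have "(\<Oplus>n\<in>{n. c' n \<noteq> \<zero>}. c' n) = (\<Oplus>n\<in>?F. c' n)"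
    using decomposition_finsum_superset[of c' ?F] c F by blast
  then have "s = (\<Oplus>n\<in>?F. c' n)"
    using s unfolding decomposition_def by metis
  ultimately have "r \<oplus> s = (\<Oplus>n\<in>?F. c n \<oplus> c' n)"
    using c by (simp add: finsum_addf)
  moreover have "c n \<oplus> c' n \<in> P n" for n
    using additive_subgroup.a_closed[OF P] r s unfolding decomposition_def by blast
  moreover have "c n \<oplus> c' n = \<zero>" if "n \<notin> ?F" for n
    using that by simp
  ultimately show ?thesis
    by (intro decompositionI[of P, OF PR _ F])
qed

lemma decomposition_carrier:
  assumes P: "\<And>n. P n \<subseteq> carrier R" and r: "decomposition R P r c"
  shows "r \<in> carrier R"
proof -
  have "c n \<in> carrier R" for n using assms unfolding decomposition_def by blast
  then have "(\<Oplus>n\<in>{n. c n \<noteq> \<zero>}. c n) \<in> carrier R" by simp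
  then show ?thesis using r by (simp add: decomposition_def)
qed

context
  fixes P
  assumes P: "graded_ideal R G P"
begin

lemma graded_idealD:
  "P n \<subseteq> G n" "additive_subgroup (P n) R" "r \<in> G m \<Longrightarrow> p \<in> P n \<Longrightarrow> r \<otimes> p \<in> P (m + n)"
  using P by (auto simp: graded_ideal_def)

lemma graded_ideal_carrier: "P n \<subseteq> carrier R"
  using graded_idealD(1) G_carrier by blast

lemma graded_ideal_closed:
  "\<zero> \<in> P n" "p \<in> P n \<Longrightarrow> q \<in> P n \<Longrightarrow> p \<oplus> q \<in> P n" "p \<in> P n \<Longrightarrow> \<ominus> p \<in> P n"
  using additive_subgroup.zero_closed[OF graded_idealD(2)]
    additive_subgroup.a_closed[OF graded_idealD(2)]
    additive_subgroup.a_inv_closed[OF graded_idealD(2)] by auto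

lemma graded_ideal_r_closed:
  assumes "r \<in> G m" "p \<in> P n"
  shows "p \<otimes> r \<in> P (n + m)"
  using graded_commute[of p n r m] graded_idealD(1)[of n] graded_idealD(3)[OF assms]
    graded_ideal_closed(3) assms by (auto simp: add.commute split: if_splits)

lemma total_ideal_carrier: "total_ideal R P \<subseteq> carrier R"
  using decomposition_carrier[of P, OF graded_ideal_carrier] by (auto simp: total_ideal_def)

lemma component_in_total_ideal: "p \<in> P n \<Longrightarrow> p \<in> total_ideal R P"
  using decomposition_single[of P, OF graded_ideal_carrier graded_ideal_closed(1)]
  by (auto simp: total_ideal_def)

lemma total_ideal_add: "r \<in> total_ideal R P \<Longrightarrow> s \<in> total_ideal R P \<Longrightarrow> r \<oplus> s \<in> total_ideal R P"
  using decomposition_add[of P, OF graded_idealD(2)] unfolding total_ideal_def by blast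

lemma total_ideal_finsum:
  "finite F \<Longrightarrow> (\<And>i. i \<in> F \<Longrightarrow> f i \<in> total_ideal R P) \<Longrightarrow> finsum R f F \<in> total_ideal R P"
proof (induction F rule: finite_induct)
  case empty
  then show ?case using component_in_total_ideal[OF graded_ideal_closed(1)] by simp
next
  case (insert i F)
  then have "f \<in> F \<rightarrow> carrier R" "f i \<in> carrier R" using total_ideal_carrier by auto
  then show ?case using insert total_ideal_add by (simp add: finsum_insert)
qed

text \<open>Homogeneity of \<^const>\<open>total_ideal\<close>: the decompositions into components in \<open>P\<close> are
  decompositions in \<open>R\<close>, and those are unique.\<close>

lemma total_ideal_components:
  assumes r: "r \<in> total_ideal R P" and c: "decomposition R G r c"
  shows "c n \<in> P n"
proof -
  obtain c' where c': "decomposition R P r c'" using r by (auto simp: total_ideal_def)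
  then have "decomposition R G r c'"
    using graded_idealD(1) unfolding decomposition_def by blast
  then have "c = c'"
    using direct_sum[of r] r c total_ideal_carrier by blast
  then show ?thesis using c' by (simp add: decomposition_def)
qed

lemma total_ideal_homogeneous_iff:
  assumes r: "r \<in> G n"
  shows "r \<in> total_ideal R P \<longleftrightarrow> r \<in> P n"
  using component_in_total_ideal total_ideal_components[of r _ n]
    decomposition_single[of G r n] G_carrier r G_closed(2) by force

lemma total_ideal_ideal: "homogeneous_ideal R G (total_ideal R P)"
proof -
  have mult: "t \<otimes> r \<in> total_ideal R P \<and> r \<otimes> t \<in> total_ideal R P"
    if r: "r \<in> total_ideal R P" and t: "t \<in> carrier R" for r t
  proof -
    obtain a where a: "decomposition R P r a" using r by (auto simp: total_ideal_def)
    obtain b where b: "decomposition R G t b" using direct_sum[OF t] by blast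
    let ?A = "{n. a n \<noteq> \<zero>}" and ?B = "{n. b n \<noteq> \<zero>}"
    have fin: "finite ?A" "finite ?B" using a b by (simp_all add: decomposition_def)
    have aP: "a n \<in> P n" and bG: "b n \<in> G n" for n
      using a b by (simp_all add: decomposition_def)
    have ac: "a n \<in> carrier R" and bc: "b n \<in> carrier R" for n
      using graded_ideal_carrier aP bG G_carrier by blast+
    have rt: "r = (\<Oplus>n\<in>?A. a n)" "t = (\<Oplus>n\<in>?B. b n)"
      using a b by (simp_all add: decomposition_def)
    have rc: "r \<in> carrier R" using r total_ideal_carrier by blast
    have "t \<otimes> r = (\<Oplus>m\<in>?B. b m \<otimes> r)"
      unfolding rt(2) using fin rc bc by (intro finsum_ldistr) auto
    moreover have "b m \<otimes> r = (\<Oplus>n\<in>?A. b m \<otimes> a n)" for m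
      unfolding rt(1) using fin ac bc by (intro finsum_rdistr) auto
    moreover have "r \<otimes> t = (\<Oplus>m\<in>?B. r \<otimes> b m)"
      unfolding rt(2) using fin rc bc by (intro finsum_rdistr) auto
    moreover have "r \<otimes> b m = (\<Oplus>n\<in>?A. a n \<otimes> b m)" for m
      unfolding rt(1) using fin ac bc by (intro finsum_ldistr) auto
    moreover have "b m \<otimes> a n \<in> total_ideal R P" "a n \<otimes> b m \<in> total_ideal R P" for m n
      using component_in_total_ideal graded_idealD(3)[OF bG aP] graded_ideal_r_closed[OF bG aP]
      by blast+
    ultimately show ?thesis
      using fin by (simp add: total_ideal_finsum)
  qed
  have "subgroup (total_ideal R P) (add_monoid R)"
  proof (rule add.subgroupI)
    show "total_ideal R P \<noteq> {}" using component_in_total_ideal graded_ideal_closed(1) by blast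
    fix r assume r: "r \<in> total_ideal R P"
    have "r \<in> carrier R" using r total_ideal_carrier by blast
    then have "\<ominus> r = (\<ominus> \<one>) \<otimes> r" using l_minus[of \<one> r] by simp
    then show "\<ominus> r \<in> total_ideal R P"
      using mult[OF r, of "\<ominus> \<one>"] by simp
  qed (use total_ideal_carrier total_ideal_add in auto)
  then have "ideal (total_ideal R P) R"
    using mult ring_axioms by (intro idealI) auto
  moreover have "c n \<in> total_ideal R P"
    if "r \<in> total_ideal R P" "decomposition R G r c" for r c n
    using total_ideal_components[OF that] component_in_total_ideal by blast
  ultimately show ?thesis by (auto simp: homogeneous_ideal_def)
qed

end

text \<open>The graded ideal generated by a graded ideal and one homogeneous element.\<close>

definition adjoin :: "(int \<Rightarrow> 'a set) \<Rightarrow> int \<Rightarrow> 'a \<Rightarrow> int \<Rightarrow> 'a set" where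
  "adjoin Q m y = (\<lambda>n. {q \<oplus> r \<otimes> y | q r. q \<in> Q n \<and> r \<in> G (n - m)})"

lemma adjoin_graded_ideal:
  assumes Q: "graded_ideal R G Q" and y: "y \<in> G m"
  shows "graded_ideal R G (adjoin Q m y)"
proof -
  note QD = graded_idealD[OF Q] and QC = graded_ideal_closed[OF Q]
  have yc: "y \<in> carrier R" using y G_carrier by blast
  have Qc: "q \<in> carrier R" if "q \<in> Q n" for q n using that QD(1) G_carrier by blast
  have sub: "adjoin Q m y n \<subseteq> G n" for n
  proof
    fix a assume "a \<in> adjoin Q m y n"
    then obtain q r where a: "a = q \<oplus> r \<otimes> y" and q: "q \<in> Q n" and r: "r \<in> G (n - m)"
      by (auto simp: adjoin_def)
    have "r \<otimes> y \<in> G n" using mult_degree[OF r y] by simp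
    then show "a \<in> G n" using a q QD(1) by blast
  qed
  have "subgroup (adjoin Q m y n) (add_monoid R)" for n
  proof (rule add.subgroupI)
    show "adjoin Q m y n \<subseteq> carrier R" using sub G_carrier by blast
    show "adjoin Q m y n \<noteq> {}" using QC(1) G_closed(2) by (auto simp: adjoin_def)
  next
    fix a assume "a \<in> adjoin Q m y n"
    then obtain q r where a: "a = q \<oplus> r \<otimes> y" and q: "q \<in> Q n" and r: "r \<in> G (n - m)"
      by (auto simp: adjoin_def)
    have rc: "r \<in> carrier R" using r G_carrier by blast
    have "\<ominus> a = \<ominus> q \<oplus> (\<ominus> r) \<otimes> y"
      using a q rc yc Qc[OF q] by (simp add: minus_add l_minus)
    then show "\<ominus> a \<in> adjoin Q m y n"
      using QC(3)[OF q] G_closed(3)[OF r] by (auto simp: adjoin_def)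
  next
    fix a b assume "a \<in> adjoin Q m y n" "b \<in> adjoin Q m y n"
    then obtain q r q' r' where a: "a = q \<oplus> r \<otimes> y" and q: "q \<in> Q n" and r: "r \<in> G (n - m)"
      and b: "b = q' \<oplus> r' \<otimes> y" and q': "q' \<in> Q n" and r': "r' \<in> G (n - m)"
      by (auto simp: adjoin_def)
    have "r \<in> carrier R" "r' \<in> carrier R" "q \<in> carrier R" "q' \<in> carrier R"
      using r r' q q' G_carrier Qc by blast+
    then have "a \<oplus> b = (q \<oplus> q') \<oplus> (r \<oplus> r') \<otimes> y"
      using a b yc by (simp add: l_distr a_ac)
    then show "a \<oplus> b \<in> adjoin Q m y n"
      using QC(2)[OF q q'] G_closed(1)[OF r r'] by (auto simp: adjoin_def)
  qed
  moreover have "s \<otimes> a \<in> adjoin Q m y (k + n)" if s: "s \<in> G k" and a: "a \<in> adjoin Q m y n"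
    for s a k n
  proof -
    obtain q r where a: "a = q \<oplus> r \<otimes> y" and q: "q \<in> Q n" and r: "r \<in> G (n - m)"
      using a by (auto simp: adjoin_def)
    have "s \<in> carrier R" "r \<in> carrier R" "q \<in> carrier R"
      using s r q G_carrier Qc by blast+
    then have "s \<otimes> a = s \<otimes> q \<oplus> (s \<otimes> r) \<otimes> y"
      using a yc by (simp add: r_distr m_assoc)
    moreover have "s \<otimes> r \<in> G (k + n - m)"
      using mult_degree[OF s r] by (simp add: algebra_simps)
    ultimately show ?thesis
      using QD(3)[OF s q] by (auto simp: adjoin_def)
  qed
  ultimately show ?thesis
    using sub by (auto simp: graded_ideal_def additive_subgroup_def)
qed

lemma subset_adjoin:
  assumes Q: "graded_ideal R G Q" and y: "y \<in> G m"
  shows "Q n \<subseteq> adjoin Q m y n" "y \<in> adjoin Q m y m"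
proof -
  have yc: "y \<in> carrier R" using y G_carrier by blast
  have "q = q \<oplus> \<zero> \<otimes> y" if "q \<in> Q n" for q
    using subsetD[OF graded_ideal_carrier[OF Q] that] yc by simp
  then show "Q n \<subseteq> adjoin Q m y n"
    using G_closed(2) by (auto simp: adjoin_def)
  have "y = \<zero> \<oplus> \<one> \<otimes> y" using yc by simp
  moreover have "\<one> \<in> G (m - m)" using one_degree by simp
  ultimately show "y \<in> adjoin Q m y m"
    using graded_ideal_closed(1)[OF Q, of m] unfolding adjoin_def by blast
qed

lemma adjoin_mult:
  assumes Q: "graded_ideal R G Q" and y: "y \<in> G m" and z: "z \<in> G l" and yz: "y \<otimes> z \<in> Q (m + l)"
    and a: "a \<in> adjoin Q m y i" and b: "b \<in> adjoin Q l z j"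
  shows "a \<otimes> b \<in> Q (i + j)"
proof -
  note QD = graded_idealD[OF Q] and QC = graded_ideal_closed[OF Q]
  obtain q r where a_eq: "a = q \<oplus> r \<otimes> y" and q: "q \<in> Q i" and r: "r \<in> G (i - m)"
    using a by (auto simp: adjoin_def)
  obtain p s where b_eq: "b = p \<oplus> s \<otimes> z" and p: "p \<in> Q j" and s: "s \<in> G (j - l)"
    using b by (auto simp: adjoin_def)
  have bG: "b \<in> G j" using adjoin_graded_ideal[OF Q z] b by (auto simp: graded_ideal_def)
  have ry: "r \<otimes> y \<in> G i" using mult_degree[OF r y] by simp
  have car: "q \<in> carrier R" "p \<in> carrier R" "r \<in> carrier R" "s \<in> carrier R"
      "y \<in> carrier R" "z \<in> carrier R" "b \<in> carrier R"
    using q p r s y z bG QD(1) G_carrier by blast+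
  have "a \<otimes> b = q \<otimes> b \<oplus> ((r \<otimes> y) \<otimes> p \<oplus> (r \<otimes> y) \<otimes> (s \<otimes> z))"
    using car by (simp add: a_eq l_distr) (simp add: b_eq car r_distr)
  moreover have "q \<otimes> b \<in> Q (i + j)" using graded_ideal_r_closed[OF Q bG q] .
  moreover have "(r \<otimes> y) \<otimes> p \<in> Q (i + j)" using QD(3)[OF ry p] .
  moreover have "(r \<otimes> y) \<otimes> (s \<otimes> z) \<in> Q (i + j)"
  proof -
    have *: "(r \<otimes> s) \<otimes> (y \<otimes> z) \<in> Q (i + j)"
      using QD(3)[OF mult_degree[OF r s] yz] by (simp add: algebra_simps)
    have "(r \<otimes> y) \<otimes> (s \<otimes> z) = r \<otimes> ((y \<otimes> s) \<otimes> z)"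
      using car by (simp add: m_assoc)
    also have "\<dots> = (if even (m * (j - l)) then (r \<otimes> s) \<otimes> (y \<otimes> z)
        else \<ominus> ((r \<otimes> s) \<otimes> (y \<otimes> z)))"
      using graded_commute[OF y s] car by (simp add: m_assoc l_minus r_minus)
    finally show ?thesis using * QC(3)[OF *] by (simp split: if_splits)
  qed
  ultimately show ?thesis using QC(2) by simp
qed

text \<open>Krull's lemma: a graded ideal containing no power of \<open>x\<close> lies in a homogeneous prime that
  does not contain \<open>x\<close>, namely in a maximal graded ideal without powers of \<open>x\<close>. Graded ideals are
  ordered by inclusion of the sets of pairs of a degree and an element of this degree.\<close>

lemma exists_prime_avoiding_powers:
  assumes J: "graded_ideal R G J" and x: "x \<in> G d" and pow: "\<And>k::nat. x [^] k \<notin> J (int k * d)"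
  shows "\<exists>\<pp> \<in> Spec R G. (\<forall>n. J n \<subseteq> \<pp>) \<and> x \<notin> \<pp>"
proof -
  define fam :: "(int \<times> 'a) set \<Rightarrow> int \<Rightarrow> 'a set" where "fam M = (\<lambda>n. {r. (n, r) \<in> M})" for M
  define \<A> where "\<A> = {M. graded_ideal R G (fam M) \<and> (\<forall>n. J n \<subseteq> fam M n) \<and>
    (\<forall>k::nat. x [^] k \<notin> fam M (int k * d))}"
  have fam_Sigma [simp]: "fam (Sigma UNIV Q) = Q" for Q by (simp add: fam_def)
  have "\<exists>M\<in>\<A>. \<forall>X\<in>\<A>. M \<subseteq> X \<longrightarrow> X = M"
  proof (rule subset_Zorn_nonempty)
    have "Sigma UNIV J \<in> \<A>" using J pow by (simp add: \<A>_def)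
    then show "\<A> \<noteq> {}" by blast
  next
    fix \<C> assume ne: "\<C> \<noteq> {}" and ch: "subset.chain \<A> \<C>"
    have CA: "\<C> \<subseteq> \<A>" using ch by (simp add: subset_chain_def)
    have gi: "graded_ideal R G (fam M)" if "M \<in> \<C>" for M using that CA by (auto simp: \<A>_def)
    have fam_Un: "r \<in> fam (\<Union>\<C>) n \<longleftrightarrow> (\<exists>M\<in>\<C>. r \<in> fam M n)" for r n by (auto simp: fam_def)
    have two: "\<exists>M\<in>\<C>. a \<in> fam M n \<and> b \<in> fam M n"
      if ab: "a \<in> fam (\<Union>\<C>) n" "b \<in> fam (\<Union>\<C>) n" for a b n
    proof -
      obtain M N where MN: "M \<in> \<C>" "N \<in> \<C>" "a \<in> fam M n" "b \<in> fam N n"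
        using ab fam_Un by blast
      then have "M \<subseteq> N \<or> N \<subseteq> M" using ch by (auto simp: subset_chain_def)
      then show ?thesis using MN by (auto simp: fam_def)
    qed
    have "subgroup (fam (\<Union>\<C>) n) (add_monoid R)" for n
    proof (rule add.subgroupI)
      show "fam (\<Union>\<C>) n \<subseteq> carrier R"
        using fam_Un graded_ideal_carrier[OF gi] by blast
      show "fam (\<Union>\<C>) n \<noteq> {}"
        using ne fam_Un graded_ideal_closed(1)[OF gi] by blast
    next
      fix a assume "a \<in> fam (\<Union>\<C>) n"
      then show "\<ominus> a \<in> fam (\<Union>\<C>) n"
        using fam_Un graded_ideal_closed(3)[OF gi] by blast
    next
      fix a b assume "a \<in> fam (\<Union>\<C>) n" "b \<in> fam (\<Union>\<C>) n"
      then show "a \<oplus> b \<in> fam (\<Union>\<C>) n"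
        using two fam_Un graded_ideal_closed(2)[OF gi] by blast
    qed
    moreover have "fam (\<Union>\<C>) n \<subseteq> G n" for n
      using fam_Un graded_idealD(1)[OF gi] by blast
    moreover have "r \<otimes> p \<in> fam (\<Union>\<C>) (m + n)" if "r \<in> G m" "p \<in> fam (\<Union>\<C>) n" for r p m n
      using that fam_Un graded_idealD(3)[OF gi] by blast
    ultimately have "graded_ideal R G (fam (\<Union>\<C>))"
      by (auto simp: graded_ideal_def additive_subgroup_def)
    moreover have "J n \<subseteq> fam (\<Union>\<C>) n" for n
      using ne CA fam_Un by (fastforce simp: \<A>_def)
    moreover have "x [^] k \<notin> fam (\<Union>\<C>) (int k * d)" for k :: nat
      using CA fam_Un by (auto simp: \<A>_def)
    ultimately show "\<Union>\<C> \<in> \<A>" by (simp add: \<A>_def)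
  qed
  then obtain M where M: "M \<in> \<A>" and max: "\<And>X. X \<in> \<A> \<Longrightarrow> M \<subseteq> X \<Longrightarrow> X = M" by blast
  define Q where "Q = fam M"
  have Q: "graded_ideal R G Q" and JQ: "\<And>n. J n \<subseteq> Q n"
    and powQ: "\<And>k::nat. x [^] k \<notin> Q (int k * d)"
    using M by (auto simp: \<A>_def Q_def)
  have MQ: "M = Sigma UNIV Q" by (auto simp: Q_def fam_def)
  have pow_adjoin: "\<exists>k::nat. x [^] k \<in> adjoin Q m y (int k * d)"
    if y: "y \<in> G m" "y \<notin> Q m" for y m
  proof (rule ccontr)
    assume "\<not> ?thesis"
    then have "Sigma UNIV (adjoin Q m y) \<in> \<A>"
      using adjoin_graded_ideal[OF Q y(1)] subset_adjoin(1)[OF Q y(1)] JQ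
      by (fastforce simp: \<A>_def)
    moreover have "M \<subseteq> Sigma UNIV (adjoin Q m y)"
      using subset_adjoin(1)[OF Q y(1)] MQ by auto
    ultimately have "Sigma UNIV (adjoin Q m y) = M" using max by blast
    then have "y \<in> Q m" using subset_adjoin(2)[OF Q y(1)] MQ by auto
    then show False using y by blast
  qed
  have prime: "y \<in> Q m \<or> z \<in> Q n"
    if y: "y \<in> G m" and z: "z \<in> G n" and yz: "y \<otimes> z \<in> Q (m + n)" for y z m n
  proof (rule ccontr)
    assume "\<not> ?thesis"
    then have "y \<notin> Q m" "z \<notin> Q n" by auto
    then obtain k l :: nat where "x [^] k \<in> adjoin Q m y (int k * d)"
      "x [^] l \<in> adjoin Q n z (int l * d)"
      using pow_adjoin[OF y] pow_adjoin[OF z] by auto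
    then have "x [^] k \<otimes> x [^] l \<in> Q (int k * d + int l * d)"
      using adjoin_mult[OF Q y z yz] by blast
    moreover have "x [^] k \<otimes> x [^] l = x [^] (k + l)"
      using G_carrier[OF x] by (simp add: nat_pow_mult)
    ultimately show False using powQ[of "k + l"] by (simp add: algebra_simps)
  qed
  let ?p = "total_ideal R Q"
  have xp: "x \<notin> ?p"
    using powQ[of 1] total_ideal_homogeneous_iff[OF Q x] G_carrier[OF x] by simp
  then have "?p \<noteq> carrier R" using G_carrier[OF x] by blast
  moreover have "y \<in> ?p \<or> z \<in> ?p" if "y \<in> G m" "z \<in> G n" "y \<otimes> z \<in> ?p" for y z m n
    using prime[OF that(1,2)] that(3) total_ideal_homogeneous_iff[OF Q that(1)]
      total_ideal_homogeneous_iff[OF Q that(2)]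
      total_ideal_homogeneous_iff[OF Q mult_degree[OF that(1,2)]] by simp
  ultimately have "?p \<in> Spec R G"
    using total_ideal_ideal[OF Q] unfolding Spec_def by blast
  moreover have "J n \<subseteq> ?p" for n
    using JQ component_in_total_ideal[OF Q] by blast
  ultimately show ?thesis using xp by blast
qed

end

section \<open>Graded modules and regular sequences\<close>

text \<open>The components of a graded module are abelian groups written multiplicatively, so below
  products in a component and inverses are the sums and negatives of the informal language.\<close>

locale graded_module_over = graded_commutative_ring R G
  for R (structure) and G :: "int \<Rightarrow> 'a set" +
  fixes N :: "('a, 'm) graded_module"
  assumes comp_group: "comm_group (comp N n)"
    and act_hom: "x \<in> G d \<Longrightarrow> act N d n x \<in> hom (comp N n) (comp N (d + n))"
    and act_add: "x \<in> G d \<Longrightarrow> y \<in> G d \<Longrightarrow> m \<in> carrier (comp N n) \<Longrightarrow>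
          act N d n (x \<oplus> y) m = act N d n x m \<otimes>\<^bsub>comp N (d + n)\<^esub> act N d n y m"
    and act_mult: "x \<in> G d \<Longrightarrow> y \<in> G e \<Longrightarrow> m \<in> carrier (comp N n) \<Longrightarrow>
          act N (d + e) n (x \<otimes> y) m = act N d (e + n) x (act N e n y m)"
    and act_one: "m \<in> carrier (comp N n) \<Longrightarrow> act N 0 n \<one> m = m"
begin

sublocale N: comm_group "comp N n" for n
  by (rule comp_group)

lemma act_group_hom: "x \<in> G d \<Longrightarrow> group_hom (comp N n) (comp N (d + n)) (act N d n x)"
  using act_hom by unfold_locales auto

lemma act_closed [intro, simp]:
  "x \<in> G d \<Longrightarrow> m \<in> carrier (comp N n) \<Longrightarrow> act N d n x m \<in> carrier (comp N (d + n))"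
  using act_hom by (auto simp: hom_def)

lemma act_zero [simp]: "x \<in> G d \<Longrightarrow> act N d n x \<one>\<^bsub>comp N n\<^esub> = \<one>\<^bsub>comp N (d + n)\<^esub>"
  using group_hom.hom_one[OF act_group_hom] .

lemma act_plus: "x \<in> G d \<Longrightarrow> m \<in> carrier (comp N n) \<Longrightarrow> m' \<in> carrier (comp N n) \<Longrightarrow>
    act N d n x (m \<otimes>\<^bsub>comp N n\<^esub> m') = act N d n x m \<otimes>\<^bsub>comp N (d + n)\<^esub> act N d n x m'"
  using act_hom[of x d n] by (simp add: hom_def)

lemma act_inv: "x \<in> G d \<Longrightarrow> m \<in> carrier (comp N n) \<Longrightarrow>
    act N d n x (inv\<^bsub>comp N n\<^esub> m) = inv\<^bsub>comp N (d + n)\<^esub> act N d n x m"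
  using group_hom.hom_inv[OF act_group_hom] .

lemma zero_act:
  assumes "m \<in> carrier (comp N n)"
  shows "act N d n \<zero> m = \<one>\<^bsub>comp N (d + n)\<^esub>"
proof -
  have z: "\<zero> \<in> G d" by (rule G_closed)
  have "act N d n \<zero> m \<otimes>\<^bsub>comp N (d + n)\<^esub> act N d n \<zero> m = act N d n \<zero> m"
    using act_add[OF z z assms] by simp
  then show ?thesis
    using N.l_cancel_one[of "act N d n \<zero> m" "d + n" "act N d n \<zero> m"] act_closed[OF z assms]
    by simp
qed

lemma minus_act:
  assumes x: "x \<in> G d" and m: "m \<in> carrier (comp N n)"
  shows "act N d n (\<ominus> x) m = inv\<^bsub>comp N (d + n)\<^esub> act N d n x m"
proof (rule N.inv_equality[symmetric])
  have "act N d n (\<ominus> x) m \<otimes>\<^bsub>comp N (d + n)\<^esub> act N d n x m = act N d n (\<ominus> x \<oplus> x) m"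
    using act_add[OF G_closed(3)[OF x] x m] by simp
  also have "\<dots> = \<one>\<^bsub>comp N (d + n)\<^esub>"
    using zero_act[OF m] G_carrier[OF x] by (simp add: l_neg)
  finally show "act N d n (\<ominus> x) m \<otimes>\<^bsub>comp N (d + n)\<^esub> act N d n x m = \<one>\<^bsub>comp N (d + n)\<^esub>" .
qed (use assms G_closed(3) in auto)

text \<open>The sign of graded commutativity, moved to the element of the module.\<close>

definition twist :: "int \<Rightarrow> int \<Rightarrow> 'm \<Rightarrow> 'm" where
  "twist k n m = (if even k then m else inv\<^bsub>comp N n\<^esub> m)"

lemma twist_closed [intro, simp]: "m \<in> carrier (comp N n) \<Longrightarrow> twist k n m \<in> carrier (comp N n)"
  by (simp add: twist_def)

lemma twist_subgroup:
  "subgroup H (comp N n) \<Longrightarrow> m \<in> carrier (comp N n) \<Longrightarrow> twist k n m \<in> H \<longleftrightarrow> m \<in> H"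
  using subgroup.m_inv_closed[of H "comp N n" m]
    subgroup.m_inv_closed[of H "comp N n" "inv\<^bsub>comp N n\<^esub> m"]
  by (auto simp: twist_def)

lemma act_twist: "x \<in> G d \<Longrightarrow> m \<in> carrier (comp N n) \<Longrightarrow>
    act N d n x (twist k n m) = twist k (d + n) (act N d n x m)"
  by (simp add: twist_def act_inv)

lemma act_swap:
  assumes x: "x \<in> G d" and y: "y \<in> G e" and m: "m \<in> carrier (comp N n)"
  shows "act N d (e + n) x (act N e n y m) = act N e (d + n) y (act N d n x (twist (d * e) n m))"
proof -
  have yx: "y \<otimes> x \<in> G (e + d)" using mult_degree[OF y x] .
  have "act N d (e + n) x (act N e n y m) = act N (e + d) n (x \<otimes> y) m"
    using act_mult[OF x y m] by (simp add: add.commute)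
  also have "\<dots> = act N (e + d) n (y \<otimes> x) (twist (d * e) n m)"
    using graded_commute[OF x y] minus_act[OF yx m] act_inv[OF yx m] by (simp add: twist_def)
  also have "\<dots> = act N e (d + n) y (act N d n x (twist (d * e) n m))"
    using act_mult[OF y x] m by simp
  finally show ?thesis .
qed

lemma act_pow_Suc:
  assumes x: "x \<in> G d" and m: "m \<in> carrier (comp N n)"
  shows "act N (int (Suc k) * d) n (x [^] Suc k) m =
    act N (int k * d) (d + n) (x [^] k) (act N d n x m)"
  using act_mult[OF G_pow[OF x] x m, of k] by (simp add: algebra_simps)

end

text \<open>A family of subgroups \<open>S\<close> of the components stands for a submodule. The sum \<open>S + x N\<close>:\<close>

definition add_multiples ::
    "('r, 'm) graded_module \<Rightarrow> (int \<Rightarrow> 'm set) \<Rightarrow> int \<Rightarrow> 'r \<Rightarrow> int \<Rightarrow> 'm set" where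
  "add_multiples N S d x n = {s \<otimes>\<^bsub>comp N n\<^esub> act N d (n - d) x m | s m.
     s \<in> S n \<and> m \<in> carrier (comp N (n - d))}"

text \<open>The zero submodule.\<close>

definition zero_sub :: "('r, 'm) graded_module \<Rightarrow> int \<Rightarrow> 'm set" where
  "zero_sub N n = {\<one>\<^bsub>comp N n\<^esub>}"

text \<open>The element \<open>x\<close> of degree \<open>d\<close> acts injectively on \<open>N/S\<close>.\<close>

definition injective_mod ::
    "('r, 'm) graded_module \<Rightarrow> (int \<Rightarrow> 'm set) \<Rightarrow> int \<Rightarrow> 'r \<Rightarrow> bool" where
  "injective_mod N S d x \<longleftrightarrow>
     (\<forall>n. \<forall>m\<in>carrier (comp N n). act N d n x m \<in> S (d + n) \<longrightarrow> m \<in> S n)"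

text \<open>The sequence is weakly regular on \<open>N/S\<close>, without mention of quotient modules.\<close>

fun regular_mod :: "('r, 'm) graded_module \<Rightarrow> (int \<Rightarrow> 'm set) \<Rightarrow> (int \<times> 'r) list \<Rightarrow> bool" where
  "regular_mod N S [] \<longleftrightarrow> True"
| "regular_mod N S ((d, x) # xs) \<longleftrightarrow>
     injective_mod N S d x \<and> regular_mod N (add_multiples N S d x) xs"

text \<open>A family of subgroups that is closed under the action of the homogeneous ring elements.\<close>

definition submodule :: "(int \<Rightarrow> 'r set) \<Rightarrow> ('r, 'm) graded_module \<Rightarrow> (int \<Rightarrow> 'm set) \<Rightarrow> bool" where
  "submodule G N S \<longleftrightarrow> (\<forall>n. subgroup (S n) (comp N n)) \<and>
     (\<forall>d n. \<forall>r\<in>G d. \<forall>s\<in>S n. act N d n r s \<in> S (d + n))"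

lemma regular_mod_iff_injective_mod:
  "regular_mod N S xs \<longleftrightarrow> (\<forall>i<length xs. injective_mod N
     (foldl (\<lambda>S (d, x). add_multiples N S d x) S (take i xs)) (fst (xs ! i)) (snd (xs ! i)))"
proof (induction xs arbitrary: S)
  case Nil
  then show ?case by simp
next
  case (Cons a xs)
  obtain d x where a: "a = (d, x)" by (cases a)
  show ?case
    unfolding a regular_mod.simps Cons length_Cons All_less_Suc2 by simp
qed

context graded_module_over
begin

lemma submoduleD:
  assumes "submodule G N S"
  shows "subgroup (S n) (comp N n)" "r \<in> G d \<Longrightarrow> s \<in> S n \<Longrightarrow> act N d n r s \<in> S (d + n)"
  using assms by (auto simp: submodule_def)

lemma submodule_carrier: "submodule G N S \<Longrightarrow> s \<in> S n \<Longrightarrow> s \<in> carrier (comp N n)"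
  using submoduleD(1) subgroup.subset by blast

lemma zero_sub_submodule: "submodule G N (zero_sub N)"
  using N.triv_subgroup by (auto simp: submodule_def zero_sub_def)

lemma add_multiples_subgroup:
  assumes S: "\<And>n. subgroup (S n) (comp N n)" and x: "x \<in> G d"
  shows "subgroup (add_multiples N S d x n) (comp N n)"
proof -
  have Sc: "s \<in> carrier (comp N n)" if "s \<in> S n" for s n
    using subgroup.subset[OF S] that by blast
  have xc: "act N d (n - d) x m \<in> carrier (comp N n)" if "m \<in> carrier (comp N (n - d))" for m
    using act_closed[OF x that] by simp
  show ?thesis
  proof (rule N.subgroupI)
    show "add_multiples N S d x n \<subseteq> carrier (comp N n)"
      using Sc xc by (auto simp: add_multiples_def)
    show "add_multiples N S d x n \<noteq> {}"
      using subgroup.one_closed[OF S] N.one_closed by (auto simp: add_multiples_def)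
  next
    fix a assume "a \<in> add_multiples N S d x n"
    then obtain s m where a: "a = s \<otimes>\<^bsub>comp N n\<^esub> act N d (n - d) x m"
      and s: "s \<in> S n" and m: "m \<in> carrier (comp N (n - d))"
      by (auto simp: add_multiples_def)
    have "inv\<^bsub>comp N n\<^esub> a =
        inv\<^bsub>comp N n\<^esub> s \<otimes>\<^bsub>comp N n\<^esub> act N d (n - d) x (inv\<^bsub>comp N (n - d)\<^esub> m)"
      using Sc[OF s] xc[OF m] act_inv[OF x m] by (simp add: a N.inv_mult)
    then show "inv\<^bsub>comp N n\<^esub> a \<in> add_multiples N S d x n"
      using subgroup.m_inv_closed[OF S s] N.inv_closed[OF m] by (auto simp: add_multiples_def)
  next
    fix a b assume "a \<in> add_multiples N S d x n" "b \<in> add_multiples N S d x n"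
    then obtain s m s' m' where a: "a = s \<otimes>\<^bsub>comp N n\<^esub> act N d (n - d) x m"
      and s: "s \<in> S n" and m: "m \<in> carrier (comp N (n - d))"
      and b: "b = s' \<otimes>\<^bsub>comp N n\<^esub> act N d (n - d) x m'"
      and s': "s' \<in> S n" and m': "m' \<in> carrier (comp N (n - d))"
      by (auto simp: add_multiples_def)
    have "a \<otimes>\<^bsub>comp N n\<^esub> b =
        (s \<otimes>\<^bsub>comp N n\<^esub> s') \<otimes>\<^bsub>comp N n\<^esub> act N d (n - d) x (m \<otimes>\<^bsub>comp N (n - d)\<^esub> m')"
      using Sc[OF s] xc[OF m] Sc[OF s'] xc[OF m'] act_plus[OF x m m'] by (simp add: a b N.m_ac)
    then show "a \<otimes>\<^bsub>comp N n\<^esub> b \<in> add_multiples N S d x n"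
      using subgroup.m_closed[OF S s s'] N.m_closed[OF m m'] by (auto simp: add_multiples_def)
  qed
qed

lemma add_multiplesI:
  assumes "s \<in> S (d + n)" "m \<in> carrier (comp N n)"
  shows "s \<otimes>\<^bsub>comp N (d + n)\<^esub> act N d n x m \<in> add_multiples N S d x (d + n)"
  unfolding add_multiples_def using assms by (intro CollectI exI[of _ s] exI[of _ m]) simp

lemma subset_add_multiples:
  assumes S: "\<And>n. subgroup (S n) (comp N n)" and x: "x \<in> G d"
  shows "S n \<subseteq> add_multiples N S d x n"
    "m \<in> carrier (comp N k) \<Longrightarrow> act N d k x m \<in> add_multiples N S d x (d + k)"
proof -
  show "S n \<subseteq> add_multiples N S d x n"
  proof
    fix s assume s: "s \<in> S n"
    then have "s = s \<otimes>\<^bsub>comp N n\<^esub> act N d (n - d) x \<one>\<^bsub>comp N (n - d)\<^esub>"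
      using subgroup.subset[OF S, of n] x by auto
    then show "s \<in> add_multiples N S d x n"
      using s N.one_closed unfolding add_multiples_def by blast
  qed
  assume "m \<in> carrier (comp N k)"
  then show "act N d k x m \<in> add_multiples N S d x (d + k)"
    using add_multiplesI[of "\<one>\<^bsub>comp N (d + k)\<^esub>" S d k m x] subgroup.one_closed[OF S] x
    by simp
qed

lemma add_multiples_submodule:
  assumes S: "submodule G N S" and x: "x \<in> G d"
  shows "submodule G N (add_multiples N S d x)"
proof -
  have "act N e n r a \<in> add_multiples N S d x (e + n)"
    if r: "r \<in> G e" and a: "a \<in> add_multiples N S d x n" for e n r a
  proof -
    obtain s m where a: "a = s \<otimes>\<^bsub>comp N n\<^esub> act N d (n - d) x m"
      and s: "s \<in> S n" and m: "m \<in> carrier (comp N (n - d))"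
      using a by (auto simp: add_multiples_def)
    let ?m = "act N e (n - d) r (twist (e * d) (n - d) m)"
    have m1: "?m \<in> carrier (comp N (e + n - d))"
      using act_closed[OF r twist_closed[OF m]] by (simp add: algebra_simps)
    have xm: "act N d (n - d) x m \<in> carrier (comp N n)" using act_closed[OF x m] by simp
    have "act N e n r a = act N e n r s \<otimes>\<^bsub>comp N (e + n)\<^esub> act N d (e + n - d) x ?m"
      using act_plus[OF r submodule_carrier[OF S s] xm] act_swap[OF r x m]
      by (simp add: a algebra_simps)
    then show ?thesis
      using submoduleD(2)[OF S r s] m1 unfolding add_multiples_def by blast
  qed
  then show ?thesis
    using add_multiples_subgroup[OF submoduleD(1)[OF S] x] by (simp add: submodule_def)
qed

lemma foldl_add_multiples_submodule:
  assumes "\<And>d x. (d, x) \<in> set xs \<Longrightarrow> x \<in> G d"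
  shows "submodule G N (foldl (\<lambda>S (d, x). add_multiples N S d x) (zero_sub N) xs)"
  using assms
proof (induction xs rule: rev_induct)
  case Nil
  then show ?case using zero_sub_submodule by simp
next
  case (snoc a xs)
  obtain d x where "a = (d, x)" by (cases a)
  then show ?case using add_multiples_submodule[OF snoc.IH, of x d] snoc.prems by simp
qed

text \<open>The submodule generated by the products with elements of the ideal \<open>(x\<^sub>1, \<dots>, x\<^sub>i)\<close> is
  \<open>x\<^sub>1 N + \<dots> + x\<^sub>i N\<close>: the homogeneous elements mapping \<open>N\<close> into the latter form a graded ideal.\<close>

lemma ideal_times_eq:
  assumes xs: "\<And>d x. (d, x) \<in> set xs \<Longrightarrow> x \<in> G d"
  shows "ideal_times G (Idl (snd ` set xs)) N =
    foldl (\<lambda>S (d, x). add_multiples N S d x) (zero_sub N) xs" (is "_ = ?S xs")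
proof -
  have sub: "submodule G N (?S ys)" if "set ys \<subseteq> set xs" for ys
    using foldl_add_multiples_submodule[of ys] that xs by blast
  have S: "submodule G N (?S xs)" using sub by simp
  have mult_S: "act N d k x m \<in> ?S xs (d + k)"
    if "(d, x) \<in> set xs" and m: "m \<in> carrier (comp N k)" for d k x m
  proof -
    have "set ys \<subseteq> set xs \<Longrightarrow> (d, x) \<in> set ys \<Longrightarrow> act N d k x m \<in> ?S ys (d + k)" for ys
    proof (induction ys rule: rev_induct)
      case (snoc a ys)
      obtain e y where a: "a = (e, y)" by (cases a)
      have y: "y \<in> G e" using snoc.prems a xs by auto
      have sg: "subgroup (?S ys n) (comp N n)" for n
        using submoduleD(1)[OF sub] snoc.prems by simp
      show ?case
        using snoc a subset_add_multiples[of "?S ys", OF sg y] m by auto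
    qed simp
    then show ?thesis using that by blast
  qed
  have gen_closed: "\<And>n. {act N d (n - d) a m | d a m. a \<in> I \<inter> G d \<and> m \<in> carrier (comp N (n - d))}
      \<subseteq> carrier (comp N n)" for I
  proof -
    have "act N d (n - d) a m \<in> carrier (comp N n)"
      if "a \<in> G d" "m \<in> carrier (comp N (n - d))" for a d n m
      using act_closed[OF that] by simp
    then show "\<And>n. ?thesis n" by auto
  qed
  show ?thesis
  proof (intro ext equalityI subsetI)
    fix n s
    define P where "P k = {a \<in> G k. \<forall>l. \<forall>m\<in>carrier (comp N l). act N k l a m \<in> ?S xs (k + l)}"
      for k
    have Psub: "subgroup (P k) (add_monoid R)" for k
    proof (rule add.subgroupI)
      show "P k \<subseteq> carrier R" using G_carrier by (auto simp: P_def)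
      have "\<zero> \<in> P k"
        using zero_act subgroup.one_closed[OF submoduleD(1)[OF S]] G_closed(2)
        by (simp add: P_def)
      then show "P k \<noteq> {}" by blast
    next
      fix a assume "a \<in> P k"
      then show "\<ominus> a \<in> P k"
        using G_closed(3) minus_act subgroup.m_inv_closed[OF submoduleD(1)[OF S]]
        by (simp add: P_def)
    next
      fix a b assume "a \<in> P k" "b \<in> P k"
      then show "a \<oplus> b \<in> P k"
        using G_closed(1) act_add subgroup.m_closed[OF submoduleD(1)[OF S]]
        by (simp add: P_def)
    qed
    have Pmult: "r \<otimes> p \<in> P (k + l)" if r: "r \<in> G k" and p: "p \<in> P l" for r p k l
    proof -
      have pG: "p \<in> G l" using p by (simp add: P_def)
      have "act N (k + l) j (r \<otimes> p) m \<in> ?S xs (k + l + j)" if m: "m \<in> carrier (comp N j)" for j m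
      proof -
        have "act N l j p m \<in> ?S xs (l + j)" using p m by (simp add: P_def)
        then have "act N k (l + j) r (act N l j p m) \<in> ?S xs (k + (l + j))"
          by (rule submoduleD(2)[OF S r])
        then show ?thesis using act_mult[OF r pG m] by (simp add: add.assoc)
      qed
      then show ?thesis using mult_degree[OF r pG] by (simp add: P_def)
    qed
    have P: "graded_ideal R G P"
      unfolding graded_ideal_def using Psub Pmult by (auto simp: P_def additive_subgroup_def)
    have "snd ` set xs \<subseteq> total_ideal R P"
    proof
      fix x assume "x \<in> snd ` set xs"
      then obtain d where d: "(d, x) \<in> set xs" by auto
      then have "x \<in> P d" using xs mult_S[OF d] by (auto simp: P_def)
      then show "x \<in> total_ideal R P" by (rule component_in_total_ideal[OF P])
    qed
    then have I: "Idl (snd ` set xs) \<subseteq> total_ideal R P"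
      using genideal_minimal total_ideal_ideal[OF P] by (auto simp: homogeneous_ideal_def)
    have gen: "{act N d (n - d) a m | d a m. a \<in> Idl (snd ` set xs) \<inter> G d \<and>
        m \<in> carrier (comp N (n - d))} \<subseteq> ?S xs n"
    proof
      fix z assume "z \<in> {act N d (n - d) a m | d a m. a \<in> Idl (snd ` set xs) \<inter> G d \<and>
        m \<in> carrier (comp N (n - d))}"
      then obtain d a m where z: "z = act N d (n - d) a m" and a: "a \<in> Idl (snd ` set xs)" "a \<in> G d"
        and m: "m \<in> carrier (comp N (n - d))" by blast
      have "a \<in> P d" using a I total_ideal_homogeneous_iff[OF P] by blast
      then have "z \<in> ?S xs (d + (n - d))" using m z unfolding P_def by blast
      then show "z \<in> ?S xs n" by simp
    qed
    assume "s \<in> ideal_times G (Idl (snd ` set xs)) N n"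
    then show "s \<in> ?S xs n"
      using N.generate_subgroup_incl[OF gen submoduleD(1)[OF S]] by (auto simp: ideal_times_def)
  next
    have xsR: "snd ` set xs \<subseteq> carrier R" using G_carrier[OF xs] by auto
    have Isub: "subgroup (ideal_times G (Idl (snd ` set xs)) N n) (comp N n)" for n
      unfolding ideal_times_def using N.generate_is_subgroup[OF gen_closed] .
    have "set ys \<subseteq> set xs \<Longrightarrow> ?S ys n \<subseteq> ideal_times G (Idl (snd ` set xs)) N n" for ys n
    proof (induction ys arbitrary: n rule: rev_induct)
      case Nil
      then show ?case using subgroup.one_closed[OF Isub] by (simp add: zero_sub_def)
    next
      case (snoc a ys)
      obtain e y where a: "a = (e, y)" by (cases a)
      have y: "y \<in> G e" "y \<in> Idl (snd ` set xs)"
        using snoc.prems a xs genideal_self[OF xsR] by force+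
      have "act N e (n - e) y m \<in> ideal_times G (Idl (snd ` set xs)) N n"
        if "m \<in> carrier (comp N (n - e))" for m
        unfolding ideal_times_def using y that by (intro generate.incl) blast
      moreover have "?S ys n \<subseteq> ideal_times G (Idl (snd ` set xs)) N n"
        using snoc by simp
      ultimately have "add_multiples N (?S ys) e y n \<subseteq> ideal_times G (Idl (snd ` set xs)) N n"
        unfolding add_multiples_def[of N "?S ys"] using subgroup.m_closed[OF Isub] by blast
      then show ?case by (simp add: a)
    qed
    then show "\<And>n s. s \<in> ?S xs n \<Longrightarrow> s \<in> ideal_times G (Idl (snd ` set xs)) N n"
      by blast
  qed
qed

lemma nonzerodivisor_on_quotient_iff:
  assumes S: "submodule G N S" and x: "x \<in> G d"
  shows "nonzerodivisor_on (quotient_module N S) d x \<longleftrightarrow> injective_mod N S d x"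
proof -
  note sg = submoduleD(1)[OF S]
  let ?c = "\<lambda>n m. S n #>\<^bsub>comp N n\<^esub> m"
  have act_coset: "act (quotient_module N S) d n x (?c n m) = ?c (d + n) (act N d n x m)"
    if m: "m \<in> carrier (comp N n)" for n m
  proof -
    have eq: "?c (d + n) (act N d n x a) = ?c (d + n) (act N d n x m)" if a: "a \<in> ?c n m" for a
    proof -
      obtain s where s: "s \<in> S n" "a = s \<otimes>\<^bsub>comp N n\<^esub> m" using a by (auto simp: r_coset_def)
      have sc: "s \<in> carrier (comp N n)" using submodule_carrier[OF S s(1)] .
      have xs: "act N d n x s \<in> S (d + n)" using submoduleD(2)[OF S x s(1)] .
      have "act N d n x a = act N d n x s \<otimes>\<^bsub>comp N (d + n)\<^esub> act N d n x m"
        using act_plus[OF x sc m] s(2) by simp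
      then have "act N d n x a \<in> ?c (d + n) (act N d n x m)"
        using xs by (auto simp: r_coset_def)
      then show ?thesis using N.repr_independence[OF _ act_closed[OF x m] sg] by simp
    qed
    have "m \<in> ?c n m" using N.rcos_self[OF m sg] .
    then have "(\<Union>a\<in>?c n m. ?c (d + n) (act N d n x a)) = ?c (d + n) (act N d n x m)"
      using eq by blast
    then show ?thesis by (simp add: quotient_module_def)
  qed
  have eq_iff: "?c k a = ?c k b \<longleftrightarrow> a \<otimes>\<^bsub>comp N k\<^esub> inv\<^bsub>comp N k\<^esub> b \<in> S k"
    if a: "a \<in> carrier (comp N k)" and b: "b \<in> carrier (comp N k)" for a b k
  proof
    assume "?c k a = ?c k b"
    then have "a \<in> ?c k b" using N.rcos_self[OF a sg] by simp
    then obtain s where "s \<in> S k" "a = s \<otimes>\<^bsub>comp N k\<^esub> b" by (auto simp: r_coset_def)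
    then show "a \<otimes>\<^bsub>comp N k\<^esub> inv\<^bsub>comp N k\<^esub> b \<in> S k"
      using submodule_carrier[OF S] b by (simp add: N.m_assoc)
  next
    assume s: "a \<otimes>\<^bsub>comp N k\<^esub> inv\<^bsub>comp N k\<^esub> b \<in> S k"
    have "a = (a \<otimes>\<^bsub>comp N k\<^esub> inv\<^bsub>comp N k\<^esub> b) \<otimes>\<^bsub>comp N k\<^esub> b" using a b by (simp add: N.m_assoc)
    then have "a \<in> ?c k b" using s by (auto simp: r_coset_def)
    then show "?c k a = ?c k b" using N.repr_independence[OF _ b sg] by blast
  qed
  have carr: "carrier (comp (quotient_module N S) n) = ?c n ` carrier (comp N n)" for n
    by (auto simp: quotient_module_def FactGroup_def RCOSETS_def)
  show ?thesis
    unfolding nonzerodivisor_on_def injective_mod_def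
  proof (intro iff_allI iffI ballI impI)
    fix n m assume inj: "inj_on (act (quotient_module N S) d n x) (carrier (comp (quotient_module N S) n))"
      and m: "m \<in> carrier (comp N n)" and xm: "act N d n x m \<in> S (d + n)"
    have "?c (d + n) (act N d n x m) = ?c (d + n) (act N d n x \<one>\<^bsub>comp N n\<^esub>)"
      using xm eq_iff[of "act N d n x m" "d + n" "\<one>\<^bsub>comp N (d + n)\<^esub>"] x m by simp
    then have "act (quotient_module N S) d n x (?c n m) =
        act (quotient_module N S) d n x (?c n \<one>\<^bsub>comp N n\<^esub>)"
      using act_coset[OF m] act_coset[OF N.one_closed] by simp
    moreover have "?c n m \<in> carrier (comp (quotient_module N S) n)"
      "?c n \<one>\<^bsub>comp N n\<^esub> \<in> carrier (comp (quotient_module N S) n)"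
      unfolding carr using m N.one_closed by blast+
    ultimately have "?c n m = ?c n \<one>\<^bsub>comp N n\<^esub>"
      by (rule inj_onD[OF inj])
    then show "m \<in> S n" using eq_iff[of m n "\<one>\<^bsub>comp N n\<^esub>"] m by simp
  next
    fix n assume inj: "\<forall>m\<in>carrier (comp N n). act N d n x m \<in> S (d + n) \<longrightarrow> m \<in> S n"
    show "inj_on (act (quotient_module N S) d n x) (carrier (comp (quotient_module N S) n))"
      unfolding carr
    proof (rule inj_onI, elim imageE, hypsubst)
      fix a b assume a: "a \<in> carrier (comp N n)" and b: "b \<in> carrier (comp N n)"
        and eq: "act (quotient_module N S) d n x (?c n a) = act (quotient_module N S) d n x (?c n b)"
      have "act N d n x (a \<otimes>\<^bsub>comp N n\<^esub> inv\<^bsub>comp N n\<^esub> b) \<in> S (d + n)"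
        using eq a b x act_coset eq_iff by (simp add: act_plus act_inv)
      then show "?c n a = ?c n b" using inj a b eq_iff by simp
    qed
  qed
qed

lemma weakly_regular_iff:
  assumes xs: "\<And>d x. (d, x) \<in> set xs \<Longrightarrow> x \<in> G d"
  shows "weakly_regular R G N xs \<longleftrightarrow> regular_mod N (zero_sub N) xs"
proof -
  have "nonzerodivisor_on (quotient_module N (ideal_times G (initial_ideal R xs i) N))
       (fst (xs ! i)) (snd (xs ! i)) \<longleftrightarrow>
     injective_mod N (foldl (\<lambda>S (d, x). add_multiples N S d x) (zero_sub N) (take i xs))
       (fst (xs ! i)) (snd (xs ! i))" if i: "i < length xs" for i
  proof -
    have h: "x \<in> G d" if "(d, x) \<in> set (take i xs)" for d x
      using that xs set_take_subset by fastforce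
    have "snd (xs ! i) \<in> G (fst (xs ! i))" using xs i by (metis nth_mem prod.collapse)
    then show ?thesis
      using nonzerodivisor_on_quotient_iff[OF foldl_add_multiples_submodule[of "take i xs"]]
        ideal_times_eq[of "take i xs"] h by (simp add: initial_ideal_def)
  qed
  then show ?thesis
    unfolding weakly_regular_def regular_mod_iff_injective_mod by blast
qed

end

subsection \<open>Change of modules\<close>

text \<open>If \<open>S\<close> is the preimage of \<open>S'\<close> under a surjective map \<open>p\<close> of graded modules, of some degree \<open>k\<close> and
  linear up to signs, then \<open>N/S\<close> and \<open>N'/S'\<close> are isomorphic and have the same weakly regular
  sequences. For bijective \<open>p\<close> this is the invariance under shifts.\<close>

lemma regular_mod_surjection:
  assumes NM: "graded_module_over R G N" and NM': "graded_module_over R G N'"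
    and p_hom: "\<And>n. p n \<in> hom (comp N n) (comp N' (n + k))"
    and p_surj: "\<And>n. carrier (comp N' (n + k)) \<subseteq> p n ` carrier (comp N n)"
    and p_act: "\<And>d x n m. x \<in> G d \<Longrightarrow> m \<in> carrier (comp N n) \<Longrightarrow>
      \<exists>m'. (m' = m \<or> m' = inv\<^bsub>comp N n\<^esub> m) \<and> p (d + n) (act N d n x m) = act N' d (n + k) x (p n m')"
    and xs: "\<And>d x. (d, x) \<in> set xs \<Longrightarrow> x \<in> G d"
    and S: "\<And>n. S n = {m \<in> carrier (comp N n). p n m \<in> S' (n + k)}"
    and S': "\<And>n. subgroup (S' n) (comp N' n)"
  shows "regular_mod N S xs \<longleftrightarrow> regular_mod N' S' xs"
  using xs S S'
proof (induction xs arbitrary: S S')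
  case Nil
  then show ?case by simp
next
  case (Cons a xs)
  interpret N: graded_module_over R G N by (rule NM)
  interpret N': graded_module_over R G N' by (rule NM')
  obtain d x where a: "a = (d, x)" by (cases a)
  have x: "x \<in> G d" using Cons.prems(1) a by simp
  note S = Cons.prems(2) and S' = Cons.prems(3)
  have p_group_hom: "group_hom (comp N n) (comp N' (n + k)) (p n)" for n
    using p_hom by unfold_locales auto
  have p_closed: "m \<in> carrier (comp N n) \<Longrightarrow> p n m \<in> carrier (comp N' (n + k))" for m n
    using p_hom by (auto simp: hom_def)
  have p_inv: "m \<in> carrier (comp N n) \<Longrightarrow> p n (inv\<^bsub>comp N n\<^esub> m) = inv\<^bsub>comp N' (n + k)\<^esub> p n m" for m n
    using group_hom.hom_inv[OF p_group_hom] .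
  have p_mult: "m \<in> carrier (comp N n) \<Longrightarrow> m' \<in> carrier (comp N n) \<Longrightarrow>
      p n (m \<otimes>\<^bsub>comp N n\<^esub> m') = p n m \<otimes>\<^bsub>comp N' (n + k)\<^esub> p n m'" for m m' n
    using p_hom[of n] by (simp add: hom_def)
  \<comment> \<open>The sign is invisible to subgroups.\<close>
  have p_act_iff: "p (d + n) (act N d n x m) \<in> H \<longleftrightarrow> act N' d (n + k) x (p n m) \<in> H"
    if m: "m \<in> carrier (comp N n)" and H: "subgroup H (comp N' (d + (n + k)))" for n m H
  proof -
    let ?z = "act N' d (n + k) x (p n m)"
    have z: "?z \<in> carrier (comp N' (d + (n + k)))" using N'.act_closed[OF x p_closed[OF m]] .
    have "inv\<^bsub>comp N' (d + (n + k))\<^esub> ?z \<in> H \<longleftrightarrow> ?z \<in> H"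
      using subgroup.m_inv_closed[OF H] N'.N.inv_inv[OF z] by metis
    then show ?thesis
      using p_act[OF x m] p_inv[OF m] N'.act_inv[OF x p_closed[OF m]] by auto
  qed
  have inj: "injective_mod N S d x \<longleftrightarrow> injective_mod N' S' d x"
  proof
    assume i: "injective_mod N S d x"
    show "injective_mod N' S' d x"
      unfolding injective_mod_def
    proof (intro allI ballI impI)
      fix n m' assume "m' \<in> carrier (comp N' n)" and xm': "act N' d n x m' \<in> S' (d + n)"
      then obtain m where m: "m \<in> carrier (comp N (n - k))" "m' = p (n - k) m"
        using p_surj[of "n - k"] by auto
      have "p (d + (n - k)) (act N d (n - k) x m) \<in> S' (d + n)"
        using p_act_iff[OF m(1), of "S' (d + n)"] S'[of "d + n"] xm' m(2) by simp
      then have "act N d (n - k) x m \<in> S (d + (n - k))"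
        using m x by (simp add: S algebra_simps N.act_closed[of x d m "n - k", simplified algebra_simps])
      then have "m \<in> S (n - k)" using i m(1) by (auto simp: injective_mod_def)
      then show "m' \<in> S' n" using m(2) by (simp add: S)
    qed
  next
    assume i: "injective_mod N' S' d x"
    show "injective_mod N S d x"
      unfolding injective_mod_def
    proof (intro allI ballI impI)
      fix n m assume m: "m \<in> carrier (comp N n)" and "act N d n x m \<in> S (d + n)"
      then have "p (d + n) (act N d n x m) \<in> S' (d + (n + k))"
        by (simp add: S add.assoc)
      then have "act N' d (n + k) x (p n m) \<in> S' (d + (n + k))"
        using p_act_iff[OF m S'] by blast
      then have "p n m \<in> S' (n + k)" using i p_closed[OF m] by (auto simp: injective_mod_def)
      then show "m \<in> S n" using m by (simp add: S)
    qed
  qed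
  have "add_multiples N S d x n =
      {m \<in> carrier (comp N n). p n m \<in> add_multiples N' S' d x (n + k)}" (is "?L = ?R") for n
  proof (intro equalityI subsetI)
    fix m assume "m \<in> ?L"
    then obtain s l where m: "m = s \<otimes>\<^bsub>comp N n\<^esub> act N d (n - d) x l"
      and s: "s \<in> S n" and l: "l \<in> carrier (comp N (n - d))"
      by (auto simp: add_multiples_def)
    have sc: "s \<in> carrier (comp N n)" and ps: "p n s \<in> S' (n + k)" using s by (simp_all add: S)
    have xl: "act N d (n - d) x l \<in> carrier (comp N n)" using N.act_closed[OF x l] by simp
    obtain l' where l': "l' = l \<or> l' = inv\<^bsub>comp N (n - d)\<^esub> l"
      and eq: "p (d + (n - d)) (act N d (n - d) x l) = act N' d (n - d + k) x (p (n - d) l')"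
      using p_act[OF x l] by blast
    have l'c: "l' \<in> carrier (comp N (n - d))" using l l' by auto
    have "p n m = p n s \<otimes>\<^bsub>comp N' (n + k)\<^esub> act N' d (n + k - d) x (p (n - d) l')"
      using p_mult[OF sc xl] eq m by (simp add: algebra_simps)
    moreover have "p (n - d) l' \<in> carrier (comp N' (n + k - d))"
      using p_closed[OF l'c] by (simp add: algebra_simps)
    ultimately have "p n m \<in> add_multiples N' S' d x (n + k)"
      using ps unfolding add_multiples_def by blast
    then show "m \<in> ?R" using m sc xl by simp
  next
    fix m assume "m \<in> ?R"
    then obtain s l where m: "m \<in> carrier (comp N n)"
      and pm: "p n m = s \<otimes>\<^bsub>comp N' (n + k)\<^esub> act N' d (n + k - d) x l"
      and s: "s \<in> S' (n + k)" and l: "l \<in> carrier (comp N' (n + k - d))"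
      by (auto simp: add_multiples_def)
    have e: "n + k - d = n - d + k" by simp
    obtain l1 where l1: "l1 \<in> carrier (comp N (n - d))" "l = p (n - d) l1"
      using p_surj[of "n - d"] l e by auto
    obtain l2 where l2: "l2 \<in> carrier (comp N (n - d))"
      and eq: "p n (act N d (n - d) x l2) = act N' d (n - d + k) x l"
    proof -
      obtain l' where "l' = l1 \<or> l' = inv\<^bsub>comp N (n - d)\<^esub> l1"
        and *: "p n (act N d (n - d) x l1) = act N' d (n - d + k) x (p (n - d) l')"
        using p_act[OF x l1(1)] by auto
      then consider "l' = l1" | "l' = inv\<^bsub>comp N (n - d)\<^esub> l1" by blast
      then show ?thesis
      proof cases
        case 1
        then show ?thesis using that[OF l1(1)] * l1(2) by simp
      next
        case 2
        have xl1: "act N d (n - d) x l1 \<in> carrier (comp N n)"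
          using N.act_closed[OF x l1(1)] by simp
        have e': "d + (n - d + k) = n + k" by simp
        have "l \<in> carrier (comp N' (n - d + k))" using l e by simp
        then have "act N' d (n - d + k) x l \<in> carrier (comp N' (n + k))"
          using N'.act_closed[OF x, of l "n - d + k"] unfolding e' by simp
        moreover have "p n (act N d (n - d) x (inv\<^bsub>comp N (n - d)\<^esub> l1)) =
            inv\<^bsub>comp N' (n + k)\<^esub> (inv\<^bsub>comp N' (n + k)\<^esub> act N' d (n - d + k) x l)"
          using * 2 p_inv[OF l1(1)] p_inv[OF xl1] N.act_inv[OF x l1(1)] l1(2)
            N'.act_inv[OF x, of l "n - d + k"] l e e' by simp
        ultimately show ?thesis using that[of "inv\<^bsub>comp N (n - d)\<^esub> l1"] l1(1) by simp
      qed
    qed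
    let ?z = "act N d (n - d) x l2"
    have z: "?z \<in> carrier (comp N n)" using N.act_closed[OF x l2] by simp
    have sc: "s \<in> carrier (comp N' (n + k))" using s subgroup.subset[OF S'] by blast
    have "p n (m \<otimes>\<^bsub>comp N n\<^esub> inv\<^bsub>comp N n\<^esub> ?z) = s"
      using m z sc p_mult p_inv[OF z] pm eq e p_closed[OF z] by (simp add: N'.N.m_assoc)
    then have "m \<otimes>\<^bsub>comp N n\<^esub> inv\<^bsub>comp N n\<^esub> ?z \<in> S n" using s m z by (simp add: S)
    moreover have "m = (m \<otimes>\<^bsub>comp N n\<^esub> inv\<^bsub>comp N n\<^esub> ?z) \<otimes>\<^bsub>comp N n\<^esub> ?z"
      using m z by (simp add: N.N.m_assoc)
    ultimately show "m \<in> ?L" using l2 unfolding add_multiples_def by blast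
  qed
  moreover have "subgroup (add_multiples N' S' d x n) (comp N' n)" for n
    using N'.add_multiples_subgroup[OF S' x] .
  ultimately have "regular_mod N (add_multiples N S d x) xs \<longleftrightarrow>
      regular_mod N' (add_multiples N' S' d x) xs"
    using Cons.prems(1) by (intro Cons.IH) auto
  then show ?case using inj by (simp add: a)
qed

text \<open>An exact sequence \<open>0 \<rightarrow> N \<rightarrow> E \<rightarrow> W \<rightarrow> 0\<close> of graded modules in which \<open>x\<close> acts bijectively on \<open>E\<close>
  and \<open>W\<close> is \<open>x\<close>-torsion; thus \<open>E\<close> is the localisation \<open>N[x\<^sup>-\<^sup>1]\<close> and \<open>W\<close> the first local cohomology of
  \<open>N\<close> at \<open>x\<close>.\<close>

locale torsion_sequence =
  N: graded_module_over R G N + E: graded_module_over R G E + W: graded_module_over R G W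
  for R (structure) and G :: "int \<Rightarrow> 'a set" and N :: "('a, 'm) graded_module"
    and E :: "('a, 'n) graded_module" and W :: "('a, 'p) graded_module" +
  fixes \<alpha> :: "int \<Rightarrow> 'm \<Rightarrow> 'n" and \<beta> :: "int \<Rightarrow> 'n \<Rightarrow> 'p" and d :: int and x :: 'a
  assumes \<alpha>_hom: "\<alpha> n \<in> hom (comp N n) (comp E n)"
    and \<beta>_hom: "\<beta> n \<in> hom (comp E n) (comp W n)"
    and \<alpha>_act: "y \<in> G e \<Longrightarrow> m \<in> carrier (comp N n) \<Longrightarrow> \<alpha> (e + n) (act N e n y m) = act E e n y (\<alpha> n m)"
    and \<beta>_act: "y \<in> G e \<Longrightarrow> m' \<in> carrier (comp E n) \<Longrightarrow> \<beta> (e + n) (act E e n y m') = act W e n y (\<beta> n m')"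
    and \<alpha>_inj: "inj_on (\<alpha> n) (carrier (comp N n))"
    and \<beta>_surj: "carrier (comp W n) \<subseteq> \<beta> n ` carrier (comp E n)"
    and exact: "m' \<in> carrier (comp E n) \<Longrightarrow>
      \<beta> n m' = \<one>\<^bsub>comp W n\<^esub> \<longleftrightarrow> m' \<in> \<alpha> n ` carrier (comp N n)"
    and x: "x \<in> G d"
    and x_bij: "bij_betw (act E d n x) (carrier (comp E n)) (carrier (comp E (d + n)))"
    and torsion: "w \<in> carrier (comp W n) \<Longrightarrow>
      \<exists>k::nat. act W (int k * d) n (x [^] k) w = \<one>\<^bsub>comp W (int k * d + n)\<^esub>"
begin

lemma \<alpha>_group_hom: "group_hom (comp N n) (comp E n) (\<alpha> n)"
  using \<alpha>_hom by unfold_locales auto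

lemma \<beta>_group_hom: "group_hom (comp E n) (comp W n) (\<beta> n)"
  using \<beta>_hom by unfold_locales auto

lemma \<alpha>_closed: "m \<in> carrier (comp N n) \<Longrightarrow> \<alpha> n m \<in> carrier (comp E n)"
  using \<alpha>_hom by (auto simp: hom_def)

lemma \<beta>_closed: "m \<in> carrier (comp E n) \<Longrightarrow> \<beta> n m \<in> carrier (comp W n)"
  using \<beta>_hom by (auto simp: hom_def)

lemma \<alpha>_mult: "m \<in> carrier (comp N n) \<Longrightarrow> m' \<in> carrier (comp N n) \<Longrightarrow>
    \<alpha> n (m \<otimes>\<^bsub>comp N n\<^esub> m') = \<alpha> n m \<otimes>\<^bsub>comp E n\<^esub> \<alpha> n m'"
  using \<alpha>_hom[of n] by (simp add: hom_def)

lemma \<beta>_mult: "m \<in> carrier (comp E n) \<Longrightarrow> m' \<in> carrier (comp E n) \<Longrightarrow>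
    \<beta> n (m \<otimes>\<^bsub>comp E n\<^esub> m') = \<beta> n m \<otimes>\<^bsub>comp W n\<^esub> \<beta> n m'"
  using \<beta>_hom[of n] by (simp add: hom_def)

lemma \<alpha>_twist: "m \<in> carrier (comp N n) \<Longrightarrow> \<alpha> n (N.twist k n m) = E.twist k n (\<alpha> n m)"
  using group_hom.hom_inv[OF \<alpha>_group_hom] by (simp add: N.twist_def E.twist_def)

lemma \<beta>_\<alpha>: "m \<in> carrier (comp N n) \<Longrightarrow> \<beta> n (\<alpha> n m) = \<one>\<^bsub>comp W n\<^esub>"
  using exact \<alpha>_closed by blast

lemma x_E_surj:
  assumes "f \<in> carrier (comp E (d + n))"
  obtains e where "e \<in> carrier (comp E n)" "f = act E d n x e"
  using x_bij[of n] assms by (auto simp: bij_betw_def)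

lemma x_E_inj: "e \<in> carrier (comp E n) \<Longrightarrow> e' \<in> carrier (comp E n) \<Longrightarrow>
    act E d n x e = act E d n x e' \<Longrightarrow> e = e'"
  using x_bij[of n] by (auto simp: bij_betw_def inj_on_def)

lemma x_W_surj:
  assumes "w \<in> carrier (comp W (d + n))"
  obtains w' where "w' \<in> carrier (comp W n)" "w = act W d n x w'"
proof -
  obtain f where "f \<in> carrier (comp E (d + n))" "w = \<beta> (d + n) f"
    using \<beta>_surj assms by blast
  moreover then obtain e where "e \<in> carrier (comp E n)" "f = act E d n x e"
    using x_E_surj by blast
  ultimately show ?thesis using that[of "\<beta> n e"] \<beta>_closed \<beta>_act[OF x] by simp
qed

text \<open>The annihilator of \<open>x\<close> in \<open>W\<close> is isomorphic to \<open>N/xN\<close>: for \<open>w = \<beta> e\<close> with \<open>x w = 0\<close>, the element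
  \<open>x e\<close> comes from \<open>N\<close>. The following relation between \<open>S \<subseteq> N\<close> and \<open>S' \<subseteq> W\<close> says that \<open>S\<close> contains
  \<open>xN\<close> and corresponds to the intersection of \<open>S'\<close> with this annihilator, where \<open>S'\<close> is divisible
  by \<open>x\<close>. Then \<open>N/S\<close> is the annihilator of \<open>x\<close> in \<open>W/S'\<close>.\<close>

definition corresponds :: "(int \<Rightarrow> 'm set) \<Rightarrow> (int \<Rightarrow> 'p set) \<Rightarrow> bool" where
  "corresponds S S' \<longleftrightarrow> (\<forall>n. subgroup (S n) (comp N n)) \<and>
     (\<forall>n. \<forall>m\<in>carrier (comp N n). act N d n x m \<in> S (d + n)) \<and>
     submodule G W S' \<and>
     (\<forall>n. \<forall>s\<in>S' (d + n). \<exists>s'\<in>S' n. s = act W d n x s') \<and>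
     (\<forall>n. \<forall>e\<in>carrier (comp E n). \<forall>m\<in>carrier (comp N (d + n)).
        \<alpha> (d + n) m = act E d n x e \<longrightarrow> (m \<in> S (d + n) \<longleftrightarrow> \<beta> n e \<in> S' n))"

context
  fixes S S'
  assumes corr: "corresponds S S'"
begin

lemma corrD:
  "subgroup (S n) (comp N n)"
  "m \<in> carrier (comp N n) \<Longrightarrow> act N d n x m \<in> S (d + n)"
  "submodule G W S'"
  "s \<in> S' (d + n) \<Longrightarrow> \<exists>s'\<in>S' n. s = act W d n x s'"
  "e \<in> carrier (comp E n) \<Longrightarrow> m \<in> carrier (comp N (d + n)) \<Longrightarrow>
    \<alpha> (d + n) m = act E d n x e \<Longrightarrow> m \<in> S (d + n) \<longleftrightarrow> \<beta> n e \<in> S' n"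
  using corr by (auto simp: corresponds_def)

text \<open>Elements of \<open>W\<close> mapped by \<open>x\<close> into \<open>S'\<close> differ by \<open>S'\<close> from the annihilator of \<open>x\<close>.\<close>

lemma split_off_annihilator:
  assumes w: "w \<in> carrier (comp W n)" and xw: "act W d n x w \<in> S' (d + n)"
  obtains s e m where "s \<in> S' n" "e \<in> carrier (comp E n)" "m \<in> carrier (comp N (d + n))"
    "\<alpha> (d + n) m = act E d n x e" "w = s \<otimes>\<^bsub>comp W n\<^esub> \<beta> n e"
proof -
  obtain s where s: "s \<in> S' n" and eq: "act W d n x w = act W d n x s"
    using corrD(4)[OF xw] by blast
  have sc: "s \<in> carrier (comp W n)" using W.submodule_carrier[OF corrD(3) s] .
  let ?u = "inv\<^bsub>comp W n\<^esub> s \<otimes>\<^bsub>comp W n\<^esub> w"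
  have u: "?u \<in> carrier (comp W n)" using w sc by simp
  then obtain e where e: "e \<in> carrier (comp E n)" "?u = \<beta> n e" using \<beta>_surj by blast
  have "act W d n x ?u = \<one>\<^bsub>comp W (d + n)\<^esub>"
    using w sc eq x by (simp add: W.act_plus W.act_inv)
  then have "\<beta> (d + n) (act E d n x e) = \<one>\<^bsub>comp W (d + n)\<^esub>"
    using \<beta>_act[OF x e(1)] e(2) by simp
  then obtain m where "m \<in> carrier (comp N (d + n))" "\<alpha> (d + n) m = act E d n x e"
    using exact[OF E.act_closed[OF x e(1)]] by (metis imageE)
  moreover have "w = s \<otimes>\<^bsub>comp W n\<^esub> \<beta> n e"
    using w sc e(2)[symmetric] by (simp add: W.N.m_assoc[symmetric])
  ultimately show ?thesis using that s e by blast
qed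

lemma corresponds_act:
  assumes y: "y \<in> G k" and e: "e \<in> carrier (comp E n)" and m: "m \<in> carrier (comp N (d + n))"
    and eq: "\<alpha> (d + n) m = act E d n x e"
  shows "act N k (d + n) y m \<in> S (d + (k + n)) \<longleftrightarrow> act W k n y (\<beta> n e) \<in> S' (k + n)"
proof -
  let ?m = "N.twist (d * k) (d + n) m"
  have m': "?m \<in> carrier (comp N (d + n))" using m by simp
  have "act E d (k + n) x (act E k n y e) = act E k (d + n) y (act E d n x (E.twist (d * k) n e))"
    using E.act_swap[OF x y e] .
  also have "\<dots> = act E k (d + n) y (\<alpha> (d + n) ?m)"
    using E.act_twist[OF x e] \<alpha>_twist[OF m] eq by simp
  also have "\<dots> = \<alpha> (d + (k + n)) (act N k (d + n) y ?m)"
    using \<alpha>_act[OF y m'] by (simp add: ac_simps)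
  finally have "\<alpha> (d + (k + n)) (act N k (d + n) y ?m) = act E d (k + n) x (act E k n y e)" by simp
  moreover have "act N k (d + n) y ?m \<in> carrier (comp N (d + (k + n)))"
    using N.act_closed[OF y m'] by (simp add: ac_simps)
  ultimately have "act N k (d + n) y ?m \<in> S (d + (k + n)) \<longleftrightarrow> \<beta> (k + n) (act E k n y e) \<in> S' (k + n)"
    using corrD(5)[OF E.act_closed[OF y e]] by blast
  moreover have "act N k (d + n) y ?m \<in> S (d + (k + n)) \<longleftrightarrow> act N k (d + n) y m \<in> S (d + (k + n))"
    using N.act_twist[OF y m] N.twist_subgroup[OF corrD(1) N.act_closed[OF y m]]
    by (simp add: ac_simps)
  ultimately show ?thesis using \<beta>_act[OF y e] by simp
qed

lemma injective_mod_corresponds: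
  assumes y: "y \<in> G k"
  shows "injective_mod N S k y \<longleftrightarrow> injective_mod W S' k y"
proof
  assume inj: "injective_mod N S k y"
  have "w \<in> S' n" if "w \<in> carrier (comp W n)" "act W k n y w \<in> S' (k + n)"
    "act W (int l * d) n (x [^] (l::nat)) w = \<one>\<^bsub>comp W (int l * d + n)\<^esub>" for l n w
    using that
  proof (induction l arbitrary: n w)
    case 0
    then have "w = \<one>\<^bsub>comp W n\<^esub>" using W.act_one by simp
    then show ?case using subgroup.one_closed W.submoduleD(1)[OF corrD(3)] by metis
  next
    case (Suc l)
    note w = Suc.prems(1)
    let ?w = "act W d n x w"
    have w1: "?w \<in> carrier (comp W (d + n))" using W.act_closed[OF x w] .
    have "act W (int l * d) (d + n) (x [^] l) ?w = \<one>\<^bsub>comp W (int l * d + (d + n))\<^esub>"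
      using Suc.prems(3) W.act_pow_Suc[OF x w] by (simp add: algebra_simps)
    moreover have "act W k (d + n) y ?w \<in> S' (k + (d + n))"
    proof -
      have "act W k (d + n) y ?w = act W d (k + n) x (act W k n y (W.twist (k * d) n w))"
        using W.act_swap[OF y x w] .
      moreover have "act W k n y (W.twist (k * d) n w) \<in> S' (k + n)"
        using Suc.prems(2) W.act_twist[OF y w]
          W.twist_subgroup[OF W.submoduleD(1)[OF corrD(3)] W.act_closed[OF y w]] by simp
      ultimately have "act W k (d + n) y ?w \<in> S' (d + (k + n))"
        using W.submoduleD(2)[OF corrD(3) x] by metis
      then show ?thesis by (simp only: add.left_commute[of k d n])
    qed
    ultimately have "?w \<in> S' (d + n)" using Suc.IH w1 by blast
    then obtain s e m where s: "s \<in> S' n" and e: "e \<in> carrier (comp E n)"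
      and m: "m \<in> carrier (comp N (d + n))"
      and eq: "\<alpha> (d + n) m = act E d n x e" and weq: "w = s \<otimes>\<^bsub>comp W n\<^esub> \<beta> n e"
      using split_off_annihilator[OF w] by blast
    have sc: "s \<in> carrier (comp W n)" using W.submodule_carrier[OF corrD(3) s] .
    have sg: "subgroup (S' (k + n)) (comp W (k + n))" using W.submoduleD(1)[OF corrD(3)] .
    have ys: "act W k n y s \<in> S' (k + n)" using W.submoduleD(2)[OF corrD(3) y s] .
    have yb: "act W k n y (\<beta> n e) \<in> carrier (comp W (k + n))"
      using W.act_closed[OF y \<beta>_closed[OF e]] .
    have "act W k n y w = act W k n y s \<otimes>\<^bsub>comp W (k + n)\<^esub> act W k n y (\<beta> n e)"
      using W.act_plus[OF y sc \<beta>_closed[OF e]] weq by simp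
    then have "act W k n y (\<beta> n e) =
        inv\<^bsub>comp W (k + n)\<^esub> act W k n y s \<otimes>\<^bsub>comp W (k + n)\<^esub> act W k n y w"
      using W.act_closed[OF y sc] yb by (simp add: W.N.m_assoc[symmetric])
    then have "act W k n y (\<beta> n e) \<in> S' (k + n)"
      using subgroup.m_closed[OF sg subgroup.m_inv_closed[OF sg ys] Suc.prems(2)] by simp
    then have "act N k (d + n) y m \<in> S (k + (d + n))"
      using corresponds_act[OF y e m eq] by (simp add: ac_simps)
    then have "m \<in> S (d + n)" using inj m by (auto simp: injective_mod_def)
    then have "\<beta> n e \<in> S' n" using corrD(5)[OF e m eq] by simp
    then show ?case
      using subgroup.m_closed[OF W.submoduleD(1)[OF corrD(3)] s] weq by simp
  qed
  then show "injective_mod W S' k y"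
    unfolding injective_mod_def using torsion by blast
next
  assume inj: "injective_mod W S' k y"
  show "injective_mod N S k y"
    unfolding injective_mod_def
  proof (intro allI ballI impI)
    fix n' m assume m': "m \<in> carrier (comp N n')" and ym': "act N k n' y m \<in> S (k + n')"
    define n where "n = n' - d"
    have n': "n' = d + n" by (simp add: n_def)
    have m: "m \<in> carrier (comp N (d + n))" and ym: "act N k (d + n) y m \<in> S (d + (k + n))"
      using m' ym' by (simp_all add: n' ac_simps)
    obtain e where e: "e \<in> carrier (comp E n)" "\<alpha> (d + n) m = act E d n x e"
      using x_E_surj[OF \<alpha>_closed[OF m]] .
    have "act W k n y (\<beta> n e) \<in> S' (k + n)"
      using corresponds_act[OF y e(1) m e(2)] ym by simp
    then have "\<beta> n e \<in> S' n" using inj \<beta>_closed[OF e(1)] by (auto simp: injective_mod_def)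
    then show "m \<in> S n'" using corrD(5)[OF e(1) m e(2)] by (simp add: n')
  qed
qed

lemma corresponds_add_multiples:
  assumes y: "y \<in> G k" and inj: "injective_mod W S' k y"
  shows "corresponds (add_multiples N S k y) (add_multiples W S' k y)"
proof -
  let ?S = "add_multiples N S k y" and ?S' = "add_multiples W S' k y"
  have sgS: "subgroup (?S n) (comp N n)" for n using N.add_multiples_subgroup[OF corrD(1) y] .
  have sgS': "submodule G W ?S'" using W.add_multiples_submodule[OF corrD(3) y] .
  have sub: "S n \<subseteq> ?S n" for n
    using N.subset_add_multiples(1)[of S, OF corrD(1) y] .
  have subm: "m \<in> carrier (comp N n) \<Longrightarrow> act N k n y m \<in> ?S (k + n)" for m n
    using N.subset_add_multiples(2)[of S, OF corrD(1) y] .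
  have subW: "S' n \<subseteq> ?S' n" for n
    using W.subset_add_multiples(1)[of S', OF W.submoduleD(1)[OF corrD(3)] y] .
  have submW: "m \<in> carrier (comp W n) \<Longrightarrow> act W k n y m \<in> ?S' (k + n)" for m n
    using W.subset_add_multiples(2)[of S', OF W.submoduleD(1)[OF corrD(3)] y] .
  have div: "\<exists>s'\<in>?S' n. s = act W d n x s'" if s: "s \<in> ?S' (d + n)" for s n
  proof -
    have deg: "d + n - k = d + (n - k)" by simp
    obtain t w where t: "t \<in> S' (d + n)" and w: "w \<in> carrier (comp W (d + (n - k)))"
      and seq: "s = t \<otimes>\<^bsub>comp W (d + n)\<^esub> act W k (d + (n - k)) y w"
      using s unfolding add_multiples_def deg by blast
    obtain t' where t': "t' \<in> S' n" "t = act W d n x t'" using corrD(4)[OF t] by blast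
    obtain w' where w': "w' \<in> carrier (comp W (n - k))" "w = act W d (n - k) x w'"
      using x_W_surj[OF w] .
    let ?w = "act W k (n - k) y (W.twist (k * d) (n - k) w')"
    have wn: "?w \<in> ?S' n" using submW[OF W.twist_closed[OF w'(1)], of "k * d"] by simp
    have tn: "t' \<in> ?S' n" using subW t' by blast
    have "act W k (d + (n - k)) y w = act W d n x ?w"
      using W.act_swap[OF y x w'(1)] w'(2) by simp
    then have "s = act W d n x (t' \<otimes>\<^bsub>comp W n\<^esub> ?w)"
      using seq t'(2) W.act_plus[OF x W.submodule_carrier[OF sgS' tn] W.submodule_carrier[OF sgS' wn]]
      by simp
    moreover have "t' \<otimes>\<^bsub>comp W n\<^esub> ?w \<in> ?S' n"
      using subgroup.m_closed[OF W.submoduleD(1)[OF sgS'] tn wn] .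
    ultimately show ?thesis by blast
  qed
  have iff: "m \<in> ?S (d + n) \<longleftrightarrow> \<beta> n e \<in> ?S' n"
    if e: "e \<in> carrier (comp E n)" and m: "m \<in> carrier (comp N (d + n))"
      and eq: "\<alpha> (d + n) m = act E d n x e" for e m n
  proof
    have deg: "d + n - k = d + (n - k)" by simp
    assume "m \<in> ?S (d + n)"
    then obtain s l where s: "s \<in> S (d + n)" and l: "l \<in> carrier (comp N (d + (n - k)))"
      and meq: "m = s \<otimes>\<^bsub>comp N (d + n)\<^esub> act N k (d + (n - k)) y l"
      unfolding add_multiples_def deg by blast
    have sc: "s \<in> carrier (comp N (d + n))" using s subgroup.subset[OF corrD(1)] by blast
    obtain e1 where e1: "e1 \<in> carrier (comp E n)" "\<alpha> (d + n) s = act E d n x e1"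
      using x_E_surj[OF \<alpha>_closed[OF sc]] .
    obtain e2 where e2: "e2 \<in> carrier (comp E (n - k))" "\<alpha> (d + (n - k)) l = act E d (n - k) x e2"
      using x_E_surj[OF \<alpha>_closed[OF l]] .
    let ?e2 = "E.twist (k * d) (n - k) e2"
    have e2': "?e2 \<in> carrier (comp E (n - k))" using e2 by simp
    have ye2: "act E k (n - k) y ?e2 \<in> carrier (comp E n)" using E.act_closed[OF y e2'] by simp
    have yl: "act N k (d + (n - k)) y l \<in> carrier (comp N (d + n))"
      using N.act_closed[OF y l] by (simp add: algebra_simps)
    have "\<alpha> (d + n) (act N k (d + (n - k)) y l) = act E k (d + (n - k)) y (act E d (n - k) x e2)"
      using \<alpha>_act[OF y l] e2(2) by (simp add: algebra_simps)
    also have "\<dots> = act E d n x (act E k (n - k) y ?e2)"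
      using E.act_swap[OF y x e2(1)] by simp
    finally have "act E d n x e = act E d n x (e1 \<otimes>\<^bsub>comp E n\<^esub> act E k (n - k) y ?e2)"
      using eq meq \<alpha>_mult[OF sc yl] e1 E.act_plus[OF x e1(1) ye2] by simp
    then have "e = e1 \<otimes>\<^bsub>comp E n\<^esub> act E k (n - k) y ?e2"
      using x_E_inj[OF e E.N.m_closed[OF e1(1) ye2]] by blast
    then have "\<beta> n e = \<beta> n e1 \<otimes>\<^bsub>comp W n\<^esub> act W k (n - k) y (\<beta> (n - k) ?e2)"
      using \<beta>_mult[OF e1(1) ye2] \<beta>_act[OF y e2'] by simp
    moreover have "\<beta> n e1 \<in> S' n" using corrD(5)[OF e1(1) sc e1(2)] s by simp
    ultimately show "\<beta> n e \<in> ?S' n"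
      using \<beta>_closed[OF e2'] unfolding add_multiples_def by blast
  next
    assume "\<beta> n e \<in> ?S' n"
    then obtain s w where s: "s \<in> S' n" and w: "w \<in> carrier (comp W (n - k))"
      and beq: "\<beta> n e = s \<otimes>\<^bsub>comp W n\<^esub> act W k (n - k) y w"
      by (auto simp: add_multiples_def)
    have sc: "s \<in> carrier (comp W n)" using W.submodule_carrier[OF corrD(3) s] .
    have yw: "act W k (n - k) y w \<in> carrier (comp W n)" using W.act_closed[OF y w] by simp
    have xb: "act W d n x (\<beta> n e) = \<one>\<^bsub>comp W (d + n)\<^esub>"
      using \<beta>_act[OF x e] \<beta>_\<alpha>[OF m] eq by simp
    have xs: "act W d n x s \<in> S' (d + n)" using W.submoduleD(2)[OF corrD(3) x s] .
    have "act W d n x s \<otimes>\<^bsub>comp W (d + n)\<^esub> act W d n x (act W k (n - k) y w) = \<one>\<^bsub>comp W (d + n)\<^esub>"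
      using xb beq W.act_plus[OF x sc yw] by simp
    then have "act W d n x (act W k (n - k) y w) = inv\<^bsub>comp W (d + n)\<^esub> act W d n x s"
      using W.act_closed[OF x sc] W.act_closed[OF x yw]
      by (metis W.N.inv_equality W.N.m_comm)
    then have "act W d n x (act W k (n - k) y w) \<in> S' (d + n)"
      using subgroup.m_inv_closed[OF W.submoduleD(1)[OF corrD(3)] xs] by simp
    moreover have "act W d n x (act W k (n - k) y w) =
        act W k (d + (n - k)) y (act W d (n - k) x (W.twist (d * k) (n - k) w))"
      using W.act_swap[OF x y w] by simp
    moreover have "d + n = k + (d + (n - k))" by simp
    ultimately have "act W k (d + (n - k)) y (act W d (n - k) x (W.twist (d * k) (n - k) w))
        \<in> S' (k + (d + (n - k)))" by metis
    then have "act W d (n - k) x (W.twist (d * k) (n - k) w) \<in> S' (d + (n - k))"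
      using inj W.act_closed[OF x W.twist_closed[OF w]] by (auto simp: injective_mod_def)
    then have "act W d (n - k) x w \<in> S' (d + (n - k))"
      using W.act_twist[OF x w]
        W.twist_subgroup[OF W.submoduleD(1)[OF corrD(3)] W.act_closed[OF x w]] by simp
    \<comment> \<open>By divisibility \<open>w\<close> may be replaced by an element of the annihilator of \<open>x\<close>.\<close>
    then obtain s2 e2 m2 where s2: "s2 \<in> S' (n - k)" and e2: "e2 \<in> carrier (comp E (n - k))"
      and m2: "m2 \<in> carrier (comp N (d + (n - k)))"
      and eq2: "\<alpha> (d + (n - k)) m2 = act E d (n - k) x e2"
      and weq: "w = s2 \<otimes>\<^bsub>comp W (n - k)\<^esub> \<beta> (n - k) e2"
      using split_off_annihilator[OF w] by blast
    have s2c: "s2 \<in> carrier (comp W (n - k))" using W.submodule_carrier[OF corrD(3) s2] .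
    have ys2: "act W k (n - k) y s2 \<in> S' n" using W.submoduleD(2)[OF corrD(3) y s2] by simp
    let ?t = "s \<otimes>\<^bsub>comp W n\<^esub> act W k (n - k) y s2"
    have t: "?t \<in> S' n" using subgroup.m_closed[OF W.submoduleD(1)[OF corrD(3)] s ys2] .
    have tc: "?t \<in> carrier (comp W n)" using W.submodule_carrier[OF corrD(3) t] .
    obtain e1 where e1: "e1 \<in> carrier (comp E n)" "?t = \<beta> n e1" using \<beta>_surj tc by blast
    have ye2: "act E k (n - k) y e2 \<in> carrier (comp E n)" using E.act_closed[OF y e2] by simp
    have e12: "e1 \<otimes>\<^bsub>comp E n\<^esub> act E k (n - k) y e2 \<in> carrier (comp E n)" using e1 ye2 by simp
    have "\<beta> n e = ?t \<otimes>\<^bsub>comp W n\<^esub> act W k (n - k) y (\<beta> (n - k) e2)"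
      using beq weq W.act_plus[OF y s2c \<beta>_closed[OF e2]] sc W.submodule_carrier[OF corrD(3) ys2]
        W.act_closed[OF y \<beta>_closed[OF e2]] by (simp add: W.N.m_assoc)
    then have be: "\<beta> n e = \<beta> n (e1 \<otimes>\<^bsub>comp E n\<^esub> act E k (n - k) y e2)"
      using \<beta>_mult[OF e1(1) ye2] \<beta>_act[OF y e2] e1(2) by simp
    let ?f = "inv\<^bsub>comp E n\<^esub> (e1 \<otimes>\<^bsub>comp E n\<^esub> act E k (n - k) y e2) \<otimes>\<^bsub>comp E n\<^esub> e"
    have f: "?f \<in> carrier (comp E n)" using e12 e by simp
    have "\<beta> n ?f = \<one>\<^bsub>comp W n\<^esub>"
      using \<beta>_mult[OF E.N.inv_closed[OF e12] e] group_hom.hom_inv[OF \<beta>_group_hom e12] be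
        \<beta>_closed[OF e12] by simp
    then obtain m3 where m3: "m3 \<in> carrier (comp N n)" "?f = \<alpha> n m3" using exact[OF f] by blast
    have eeq: "e = e1 \<otimes>\<^bsub>comp E n\<^esub> act E k (n - k) y e2 \<otimes>\<^bsub>comp E n\<^esub> \<alpha> n m3"
      using m3(2)[symmetric] e12 e by (simp add: E.N.m_assoc[symmetric])
    let ?e2 = "E.twist (d * k) (n - k) e2" and ?m2 = "N.twist (d * k) (d + (n - k)) m2"
    have m2': "?m2 \<in> carrier (comp N (d + (n - k)))" using m2 by simp
    have ym2: "act N k (d + (n - k)) y ?m2 \<in> carrier (comp N (d + n))"
      using N.act_closed[OF y m2'] by (simp add: algebra_simps)
    have xye2: "act E d n x (act E k (n - k) y e2) = \<alpha> (d + n) (act N k (d + (n - k)) y ?m2)"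
    proof -
      have "act E d n x (act E k (n - k) y e2) = act E k (d + (n - k)) y (act E d (n - k) x ?e2)"
        using E.act_swap[OF x y e2] by simp
      also have "act E d (n - k) x ?e2 = \<alpha> (d + (n - k)) ?m2"
        using E.act_twist[OF x e2] \<alpha>_twist[OF m2] eq2 by simp
      also have "act E k (d + (n - k)) y (\<alpha> (d + (n - k)) ?m2) =
          \<alpha> (d + n) (act N k (d + (n - k)) y ?m2)"
        using \<alpha>_act[OF y m2'] by (simp add: algebra_simps)
      finally show ?thesis .
    qed
    \<comment> \<open>Hence \<open>x e\<^sub>1\<close> comes from \<open>N\<close> as well.\<close>
    let ?n1 = "m \<otimes>\<^bsub>comp N (d + n)\<^esub> inv\<^bsub>comp N (d + n)\<^esub>
      (act N k (d + (n - k)) y ?m2 \<otimes>\<^bsub>comp N (d + n)\<^esub> act N d n x m3)"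
    have xm3: "act N d n x m3 \<in> carrier (comp N (d + n))" using N.act_closed[OF x m3(1)] .
    let ?g = "act N k (d + (n - k)) y ?m2 \<otimes>\<^bsub>comp N (d + n)\<^esub> act N d n x m3"
    have g: "?g \<in> carrier (comp N (d + n))" using ym2 xm3 by simp
    have n1: "?n1 \<in> carrier (comp N (d + n))" using m g by simp
    have "act E d n x e = act E d n x e1 \<otimes>\<^bsub>comp E (d + n)\<^esub> \<alpha> (d + n) ?g"
      using eeq e1(1) ye2 \<alpha>_closed[OF m3(1)] xye2 \<alpha>_act[OF x m3(1)] \<alpha>_mult[OF ym2 xm3]
        E.act_closed[OF x e1(1)] \<alpha>_closed[OF ym2] E.act_closed[OF x \<alpha>_closed[OF m3(1)]]
      by (simp add: E.act_plus x E.N.m_assoc)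
    then have "\<alpha> (d + n) ?n1 = act E d n x e1"
      using eq \<alpha>_mult[OF m N.N.inv_closed[OF g]] group_hom.hom_inv[OF \<alpha>_group_hom g]
        \<alpha>_closed[OF g] E.act_closed[OF x e1(1)] by (simp add: E.N.m_assoc)
    then have "?n1 \<in> S (d + n)" using corrD(5)[OF e1(1) n1] t e1(2) by simp
    then have 1: "?n1 \<in> ?S (d + n)" using sub by blast
    have 2: "act N k (d + (n - k)) y ?m2 \<in> ?S (d + n)"
      using subm[OF m2'] by (simp add: algebra_simps)
    have 3: "act N d n x m3 \<in> ?S (d + n)" using corrD(2)[OF m3(1)] sub by blast
    have "m = ?n1 \<otimes>\<^bsub>comp N (d + n)\<^esub> ?g" using m g by (simp add: N.N.m_assoc)
    then show "m \<in> ?S (d + n)"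
      using subgroup.m_closed[OF sgS 1 subgroup.m_closed[OF sgS 2 3]] by simp
  qed
  show ?thesis
    unfolding corresponds_def using sgS sgS' corrD(2) sub div iff by blast
qed

end

lemma regular_mod_corresponds:
  assumes "corresponds S S'" "\<And>e y. (e, y) \<in> set ys \<Longrightarrow> y \<in> G e"
  shows "regular_mod N S ys \<longleftrightarrow> regular_mod W S' ys"
  using assms
proof (induction ys arbitrary: S S')
  case Nil
  then show ?case by simp
next
  case (Cons a ys)
  obtain k y where a: "a = (k, y)" by (cases a)
  have y: "y \<in> G k" using Cons.prems(2) a by simp
  have ys: "\<And>e y. (e, y) \<in> set ys \<Longrightarrow> y \<in> G e" using Cons.prems(2) by simp
  show ?case
    using injective_mod_corresponds[OF Cons.prems(1) y] Cons.IH[OF _ ys]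
      corresponds_add_multiples[OF Cons.prems(1) y] by (auto simp: a)
qed

lemma corresponds_initial: "corresponds (add_multiples N (zero_sub N) d x) (zero_sub W)"
proof -
  have sg: "subgroup (add_multiples N (zero_sub N) d x n) (comp N n)" for n
    using N.add_multiples_subgroup[OF N.submoduleD(1)[OF N.zero_sub_submodule] x] .
  have mult: "act N d n x m \<in> add_multiples N (zero_sub N) d x (d + n)"
    if "m \<in> carrier (comp N n)" for m n
    using N.subset_add_multiples(2)[OF N.submoduleD(1)[OF N.zero_sub_submodule] x that] .
  have "m \<in> add_multiples N (zero_sub N) d x (d + n) \<longleftrightarrow> \<beta> n e \<in> zero_sub W n"
    if e: "e \<in> carrier (comp E n)" and m: "m \<in> carrier (comp N (d + n))"
      and eq: "\<alpha> (d + n) m = act E d n x e" for e m n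
  proof
    assume "m \<in> add_multiples N (zero_sub N) d x (d + n)"
    then obtain l where l: "l \<in> carrier (comp N n)" "m = act N d n x l"
      using x by (auto simp: add_multiples_def zero_sub_def)
    then have "act E d n x e = act E d n x (\<alpha> n l)" using eq \<alpha>_act[OF x l(1)] by simp
    then have "e = \<alpha> n l" using x_E_inj[OF e \<alpha>_closed[OF l(1)]] by blast
    then show "\<beta> n e \<in> zero_sub W n" using \<beta>_\<alpha>[OF l(1)] by (simp add: zero_sub_def)
  next
    assume "\<beta> n e \<in> zero_sub W n"
    then obtain l where l: "l \<in> carrier (comp N n)" "e = \<alpha> n l"
      using exact[OF e] by (auto simp: zero_sub_def)
    then have "\<alpha> (d + n) m = \<alpha> (d + n) (act N d n x l)" using eq \<alpha>_act[OF x l(1)] by simp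
    then have "m = act N d n x l"
      using \<alpha>_inj[of "d + n"] m N.act_closed[OF x l(1)] by (auto simp: inj_on_def)
    then show "m \<in> add_multiples N (zero_sub N) d x (d + n)" using mult[OF l(1)] by simp
  qed
  moreover have "\<exists>s'\<in>zero_sub W n. s = act W d n x s'" if "s \<in> zero_sub W (d + n)" for s n
    using that x by (simp add: zero_sub_def)
  ultimately show ?thesis
    unfolding corresponds_def using sg mult W.zero_sub_submodule by blast
qed

text \<open>Regularity on \<open>N/xN\<close> and on \<open>W\<close> are equivalent.\<close>

lemma regular_mod_torsion:
  assumes "\<And>e y. (e, y) \<in> set ys \<Longrightarrow> y \<in> G e"
  shows "regular_mod N (add_multiples N (zero_sub N) d x) ys \<longleftrightarrow> regular_mod W (zero_sub W) ys"
  using regular_mod_corresponds[OF corresponds_initial] assms by blast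

end

text \<open>Regularity along a chain of modules, each of which computes the quotient of its predecessor.\<close>

lemma regular_mod_chain:
  assumes step: "\<And>i d x. i < length xs \<Longrightarrow> xs ! i = (d, x) \<Longrightarrow> injective_mod (N i) (zero_sub (N i)) d x \<Longrightarrow>
      regular_mod (N i) (add_multiples (N i) (zero_sub (N i)) d x) (drop (Suc i) xs) \<longleftrightarrow>
      regular_mod (N (Suc i)) (zero_sub (N (Suc i))) (drop (Suc i) xs)"
  shows "regular_mod (N 0) (zero_sub (N 0)) xs \<longleftrightarrow>
    (\<forall>i<length xs. injective_mod (N i) (zero_sub (N i)) (fst (xs ! i)) (snd (xs ! i)))"
proof -
  let ?inj = "\<lambda>i. injective_mod (N i) (zero_sub (N i)) (fst (xs ! i)) (snd (xs ! i))"
  have "regular_mod (N j) (zero_sub (N j)) (drop j xs) \<longleftrightarrow> (\<forall>i. j \<le> i \<and> i < length xs \<longrightarrow> ?inj i)"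
    if "j \<le> length xs" for j
    using that
  proof (induction j rule: inc_induct)
    case base
    then show ?case by auto
  next
    case (step j)
    obtain d x where dx: "xs ! j = (d, x)" by (cases "xs ! j")
    have "drop j xs = (d, x) # drop (Suc j) xs"
      using Cons_nth_drop_Suc[OF step(2)] dx by simp
    then have "regular_mod (N j) (zero_sub (N j)) (drop j xs) \<longleftrightarrow>
        ?inj j \<and> regular_mod (N (Suc j)) (zero_sub (N (Suc j))) (drop (Suc j) xs)"
      using assms[OF step(2) dx] dx by auto
    also have "\<dots> \<longleftrightarrow> (\<forall>i. j \<le> i \<and> i < length xs \<longrightarrow> ?inj i)"
      using step by (metis Suc_leD Suc_leI le_eq_less_or_eq)
    finally show ?case .
  qed
  from this[of 0] show ?thesis by simp
qed


section \<open>The graded module of homomorphisms\<close>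

lemma hom_module_simps [simp]:
  "comp (hom_module T \<phi> C M) n = hom_group T C (susp_obj T n M)"
  "act (hom_module T \<phi> C M) d n x = (\<lambda>f. susp_arr T n (\<phi> d x M) \<cdot>\<^bsub>T\<^esub> f)"
  by (simp_all add: hom_module_def)

context linear_triangulated_category
begin

text \<open>The graded \<open>R\<close>-module \<open>Hom\<^sup>*(C, X)\<close> is \<open>H C X\<close>.\<close>

abbreviation H :: "'o \<Rightarrow> 'o \<Rightarrow> ('r, 'm) graded_module" where
  "H \<equiv> hom_module T \<phi>"

lemma \<phi>_Hom: "x \<in> G d \<Longrightarrow> X \<in> Obj T \<Longrightarrow> \<phi> d x X \<in> Hom T X (susp_obj T d X)"
  using \<phi>_center by (auto simp: graded_center_def)

lemma \<phi>_natural: "x \<in> G d \<Longrightarrow> f \<in> Hom T X Y \<Longrightarrow> \<phi> d x Y \<cdot>\<^bsub>T\<^esub> f = susp_arr T d f \<cdot>\<^bsub>T\<^esub> \<phi> d x X"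
  using \<phi>_center HomD(4,5) by (auto simp: graded_center_def)

lemma \<phi>_SuspO: "x \<in> G d \<Longrightarrow> X \<in> Obj T \<Longrightarrow> \<phi> d x (SuspO T X) = signed T d (SuspA T (\<phi> d x X))"
  using \<phi>_center by (auto simp: graded_center_def)

lemma signed_parity: "even m = even n \<Longrightarrow> signed T m f = signed T n f"
  by (simp add: signed_def)

lemma signed_twice: "f \<in> Hom T a b \<Longrightarrow> signed T k (signed T k f) = f"
  using signed_signed[of f a b k k] signed_parity[of "k + k" 0 f] by (simp add: signed_def[of T 0])

lemma \<phi>_susp_obj:
  assumes x: "x \<in> G d" and X: "X \<in> Obj T"
  shows "\<phi> d x (susp_obj T n X) = signed T (n * d) (susp_arr T n (\<phi> d x X))"
proof (induction n rule: int_induct[where k = 0])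
  case base
  then show ?case by (simp add: signed_def)
next
  case (step1 i)
  note h = susp_arr_Hom[OF \<phi>_Hom[OF x X], of i]
  have "\<phi> d x (susp_obj T (i + 1) X) = signed T d (SuspA T (\<phi> d x (susp_obj T i X)))"
    using \<phi>_SuspO[OF x susp_obj_Obj[OF X, of i]] X by (simp add: SuspO_susp_obj)
  also have "\<dots> = signed T d (signed T (i * d) (susp_arr T (i + 1) (\<phi> d x X)))"
    using step1 susp_arr_signed[OF h, of 1] susp_arr_plus_one HomD(1)[OF \<phi>_Hom[OF x X]] by simp
  also have "\<dots> = signed T ((i + 1) * d) (susp_arr T (i + 1) (\<phi> d x X))"
    using signed_signed[OF susp_arr_Hom[OF \<phi>_Hom[OF x X]]] by (simp add: algebra_simps)
  finally show ?case .
next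
  case (step2 i)
  let ?Y = "susp_obj T (i - 1) X" and ?f = "susp_arr T (i - 1) (\<phi> d x X)"
  have Y: "?Y \<in> Obj T" using X susp_obj_Obj by blast
  note h = susp_arr_Hom[OF \<phi>_Hom[OF x X], of "i - 1"]
  have "signed T d (SuspA T (\<phi> d x ?Y)) = \<phi> d x (susp_obj T i X)"
    using \<phi>_SuspO[OF x Y] X by (simp add: SuspO_susp_obj)
  also have "\<dots> = signed T (i * d) (SuspA T ?f)"
    using step2 susp_arr_minus_one HomD(1)[OF \<phi>_Hom[OF x X]] by simp
  finally have "signed T d (signed T d (SuspA T (\<phi> d x ?Y))) = signed T d (signed T (i * d) (SuspA T ?f))"
    by simp
  then have "SuspA T (\<phi> d x ?Y) = signed T (d + i * d) (SuspA T ?f)"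
    using signed_twice[OF SuspA_Hom[OF \<phi>_Hom[OF x Y]]] signed_signed[OF SuspA_Hom[OF h]] by simp
  moreover have "signed T (d + i * d) (SuspA T ?f) = signed T ((i - 1) * d) (SuspA T ?f)"
    by (rule signed_parity) auto
  ultimately have "SuspA T (\<phi> d x ?Y) = SuspA T (signed T ((i - 1) * d) ?f)"
    using susp_arr_signed[OF h, of 1] by simp
  then show ?case
    using SuspA_inject HomD(1)[OF \<phi>_Hom[OF x Y]] HomD(1)[OF signed_Hom[OF h]] by blast
qed

lemma hom_module_graded_module:
  assumes C: "C \<in> Obj T" and X: "X \<in> Obj T"
  shows "graded_module_over R G (H C X)"
proof -
  have tgt: "susp_obj T n (susp_obj T d X) = susp_obj T (d + n) X" for d n
    using X by (simp add: susp_obj_susp_obj add.commute)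
  have \<phi>n: "susp_arr T n (\<phi> d x X) \<in> Hom T (susp_obj T n X) (susp_obj T (d + n) X)"
    if "x \<in> G d" for x d n
    using susp_arr_Hom[OF \<phi>_Hom[OF that X], of n] by (simp add: tgt)
  show ?thesis
  proof (intro graded_module_over.intro graded_module_over_axioms.intro, goal_cases)
    case 1
    show ?case by (rule graded_commutative_ring_axioms)
  next
    case (2 n)
    show ?case using hom_group[OF C susp_obj_Obj[OF X]] by simp
  next
    case (3 x d n)
    show ?case using Comp_left_hom[OF \<phi>n[OF 3] C] by simp
  next
    case (4 x d y m n)
    have "susp_arr T n (\<phi> d (x \<oplus>\<^bsub>R\<^esub> y) X) = Plus T (susp_arr T n (\<phi> d x X)) (susp_arr T n (\<phi> d y X))"
      using \<phi>_add[OF 4(1,2) X] susp_arr_Plus[OF \<phi>_Hom[OF 4(1) X] \<phi>_Hom[OF 4(2) X]] by simp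
    then show ?case
      using Comp_Plus_left[OF _ \<phi>n[OF 4(1)] \<phi>n[OF 4(2)]] 4(3) by simp
  next
    case (5 x d y e m n)
    have "susp_arr T n (\<phi> (d + e) (x \<otimes>\<^bsub>R\<^esub> y) X) =
        susp_arr T n (susp_arr T e (\<phi> d x X)) \<cdot>\<^bsub>T\<^esub> susp_arr T n (\<phi> e y X)"
      using \<phi>_mult[OF 5(1,2) X] susp_arr_Comp[OF \<phi>_Hom[OF 5(2) X] susp_arr_Hom[OF \<phi>_Hom[OF 5(1) X]]]
      by simp
    also have "susp_arr T n (susp_arr T e (\<phi> d x X)) = susp_arr T (e + n) (\<phi> d x X)"
      using susp_arr_susp_arr HomD(1)[OF \<phi>_Hom[OF 5(1) X]] by (simp add: add.commute)
    finally have eq: "susp_arr T n (\<phi> (d + e) (x \<otimes>\<^bsub>R\<^esub> y) X) =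
      susp_arr T (e + n) (\<phi> d x X) \<cdot>\<^bsub>T\<^esub> susp_arr T n (\<phi> e y X)" .
    show ?case
      using Comp_assoc[OF _ \<phi>n[OF 5(2), of n] \<phi>n[OF 5(1), of "e + n"]] 5(3) by (simp add: eq)
  next
    case (6 m n)
    then show ?case using \<phi>_one[OF X] susp_arr_Idn[OF X] Comp_Idn_left by simp
  qed
qed

lemma act_hom_module_Hom:
  assumes C: "C \<in> Obj T" and X: "X \<in> Obj T" and x: "x \<in> G d" and f: "f \<in> Hom T C (susp_obj T n X)"
  shows "susp_arr T n (\<phi> d x X) \<cdot>\<^bsub>T\<^esub> f \<in> Hom T C (susp_obj T (d + n) X)"
  using graded_module_over.act_closed[OF hom_module_graded_module[OF C X] x, of f n] f by simp

lemma postcompose_hom: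
  assumes C: "C \<in> Obj T" and g: "g \<in> Hom T X Y"
  shows "(\<lambda>f. susp_arr T n g \<cdot>\<^bsub>T\<^esub> f) \<in> hom (comp (H C X) n) (comp (H C Y) n)"
  using Comp_left_hom[OF susp_arr_Hom[OF g] C] by simp

lemma postcompose_act:
  assumes x: "x \<in> G d" and g: "g \<in> Hom T X Y" and f: "f \<in> Hom T C (susp_obj T n X)"
  shows "susp_arr T (d + n) g \<cdot>\<^bsub>T\<^esub> (susp_arr T n (\<phi> d x X) \<cdot>\<^bsub>T\<^esub> f) =
    susp_arr T n (\<phi> d x Y) \<cdot>\<^bsub>T\<^esub> (susp_arr T n g \<cdot>\<^bsub>T\<^esub> f)"
proof -
  have X: "X \<in> Obj T" and Y: "Y \<in> Obj T" and gA: "g \<in> Arr T" using HomD[OF g] by auto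
  have g': "susp_arr T n (susp_arr T d g) = susp_arr T (d + n) g"
    using susp_arr_susp_arr[OF gA] by (simp add: add.commute)
  have "susp_arr T (d + n) g \<cdot>\<^bsub>T\<^esub> (susp_arr T n (\<phi> d x X) \<cdot>\<^bsub>T\<^esub> f) =
      (susp_arr T n (susp_arr T d g) \<cdot>\<^bsub>T\<^esub> susp_arr T n (\<phi> d x X)) \<cdot>\<^bsub>T\<^esub> f"
    using Comp_assoc[OF f susp_arr_Hom[OF \<phi>_Hom[OF x X]] susp_arr_Hom[OF susp_arr_Hom[OF g]]]
    by (simp add: g')
  also have "\<dots> = susp_arr T n (susp_arr T d g \<cdot>\<^bsub>T\<^esub> \<phi> d x X) \<cdot>\<^bsub>T\<^esub> f"
    using susp_arr_Comp[OF \<phi>_Hom[OF x X] susp_arr_Hom[OF g]] by simp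
  also have "\<dots> = susp_arr T n (\<phi> d x Y \<cdot>\<^bsub>T\<^esub> g) \<cdot>\<^bsub>T\<^esub> f"
    using \<phi>_natural[OF x g] by simp
  also have "\<dots> = (susp_arr T n (\<phi> d x Y) \<cdot>\<^bsub>T\<^esub> susp_arr T n g) \<cdot>\<^bsub>T\<^esub> f"
    using susp_arr_Comp[OF g \<phi>_Hom[OF x Y]] by simp
  also have "\<dots> = susp_arr T n (\<phi> d x Y) \<cdot>\<^bsub>T\<^esub> (susp_arr T n g \<cdot>\<^bsub>T\<^esub> f)"
    using Comp_assoc[OF f susp_arr_Hom[OF g] susp_arr_Hom[OF \<phi>_Hom[OF x Y]]] by simp
  finally show ?thesis .
qed

text \<open>The action on \<open>Hom(C, \<Sigma>\<^sup>n(\<Sigma>\<^sup>k X))\<close> and on the same group \<open>Hom(C, \<Sigma>\<^sup>n\<^sup>+\<^sup>k X)\<close> agree up to sign.\<close>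

lemma act_susp_obj:
  assumes x: "x \<in> G d" and X: "X \<in> Obj T" and f: "f \<in> Hom T C (susp_obj T (n + k) X)"
  shows "susp_arr T n (\<phi> d x (susp_obj T k X)) \<cdot>\<^bsub>T\<^esub> f =
    signed T (k * d) (susp_arr T (n + k) (\<phi> d x X) \<cdot>\<^bsub>T\<^esub> f)"
proof -
  note h = \<phi>_Hom[OF x X]
  have "susp_arr T n (\<phi> d x (susp_obj T k X)) = signed T (k * d) (susp_arr T (n + k) (\<phi> d x X))"
    using \<phi>_susp_obj[OF x X] susp_arr_signed[OF susp_arr_Hom[OF h]] susp_arr_susp_arr[OF HomD(1)[OF h]]
    by simp
  then show ?thesis
    using Comp_signed_left[OF f] susp_arr_Hom[OF h, of "n + k"] X by simp
qed

lemma signed_act: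
  assumes x: "x \<in> G d" and X: "X \<in> Obj T" and f: "f \<in> Hom T C (susp_obj T n X)"
  shows "signed T k (susp_arr T n (\<phi> d x X) \<cdot>\<^bsub>T\<^esub> f) = susp_arr T n (\<phi> d x X) \<cdot>\<^bsub>T\<^esub> signed T k f"
  using Comp_signed_right[OF f susp_arr_Hom[OF \<phi>_Hom[OF x X]]] by simp

lemma signed_choice:
  "f \<in> Hom T a b \<Longrightarrow> signed T k f = f \<or> signed T k f = inv\<^bsub>hom_group T a b\<^esub> f"
  by (simp add: signed_def neg_eq_inv)


section \<open>Koszul objects\<close>

lemma koszul_triangle_simps:
  assumes X: "X \<in> Obj T" and x: "x \<in> G d" and t: "(\<phi> d x X, q, \<delta>) \<in> Tri T"
  shows "Dom T (\<phi> d x X) = X" "Dom T q = susp_obj T d X" "Cod T q = Dom T \<delta>"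
    "q \<in> Hom T (susp_obj T d X) (Dom T \<delta>)" "\<delta> \<in> Hom T (Dom T \<delta>) (SuspO T X)" "Dom T \<delta> \<in> Obj T"
  using TriD[OF t] HomD[OF \<phi>_Hom[OF x X]] by auto

context
  fixes C X d x q \<delta>
  assumes C: "C \<in> Obj T" and X: "X \<in> Obj T" and x: "x \<in> G d" and t: "(\<phi> d x X, q, \<delta>) \<in> Tri T"
begin

lemmas koszul_simps = koszul_triangle_simps[OF X x t]

lemma ghost_koszul_iff:
  "ghost T C \<delta> \<longleftrightarrow> injective_mod (H C X) (zero_sub (H C X)) d x"
proof
  assume gh: "ghost T C \<delta>"
  show "injective_mod (H C X) (zero_sub (H C X)) d x"
    unfolding injective_mod_def zero_sub_def
  proof (intro allI ballI impI, simp)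
    fix n f assume f: "f \<in> Hom T C (susp_obj T n X)"
      and xf: "susp_arr T n (\<phi> d x X) \<cdot>\<^bsub>T\<^esub> f = ZeroA T C (susp_obj T (d + n) X)"
    have f': "f \<in> Hom T C (susp_obj T (n - 1) (SuspO T X))"
      using f X by (simp add: susp_obj_SuspO)
    have "susp_arr T (n - 1) (SuspA T (\<phi> d x X)) = susp_arr T n (\<phi> d x X)"
      using susp_arr_susp_arr[OF HomD(1)[OF \<phi>_Hom[OF x X]], of "n - 1" 1] by simp
    moreover have "susp_obj T (n - 1) (SuspO T (susp_obj T d X)) = susp_obj T (d + n) X"
      using susp_obj_SuspO[OF susp_obj_Obj[OF X]] X by (simp add: susp_obj_susp_obj add.commute)
    ultimately obtain v where v: "v \<in> Hom T C (susp_obj T (n - 1) (Dom T \<delta>))"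
      "f = susp_arr T (n - 1) \<delta> \<cdot>\<^bsub>T\<^esub> v"
      using graded_exact_covariant_last[OF t, of f C "n - 1"] f' xf by (auto simp: koszul_simps)
    then have "f = ZeroA T C (susp_obj T (n - 1) (SuspO T X))"
      using gh ghost_iff[OF koszul_simps(5)] by blast
    then show "f = ZeroA T C (susp_obj T n X)" using X by (simp add: susp_obj_SuspO)
  qed
next
  assume inj: "injective_mod (H C X) (zero_sub (H C X)) d x"
  have "susp_arr T n \<delta> \<cdot>\<^bsub>T\<^esub> g = ZeroA T C (susp_obj T n (SuspO T X))"
    if g: "g \<in> Hom T C (susp_obj T n (Dom T \<delta>))" for n g
  proof -
    let ?f = "susp_arr T n \<delta> \<cdot>\<^bsub>T\<^esub> g"
    have SX: "susp_obj T n (SuspO T X) = susp_obj T (n + 1) X" using X susp_obj_SuspO by simp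
    have f: "?f \<in> Hom T C (susp_obj T (n + 1) X)"
      using Comp_Hom[OF g susp_arr_Hom[OF koszul_simps(5)]] by (simp add: SX)
    have "susp_arr T n (SuspA T (\<phi> d x X)) \<cdot>\<^bsub>T\<^esub> ?f = ZeroA T C (susp_obj T n (SuspO T (susp_obj T d X)))"
      using graded_Comp_zero[OF koszul_simps(5) SuspA_Hom[OF \<phi>_Hom[OF x X]] _ g]
        Tri_Comp_zero_last[OF t] by (simp add: koszul_simps)
    moreover have "susp_arr T n (SuspA T (\<phi> d x X)) = susp_arr T (n + 1) (\<phi> d x X)"
      using susp_arr_susp_arr[OF HomD(1)[OF \<phi>_Hom[OF x X]], of n 1] by simp
    moreover have "susp_obj T n (SuspO T (susp_obj T d X)) = susp_obj T (d + (n + 1)) X"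
      using susp_obj_SuspO[OF susp_obj_Obj[OF X]] X by (simp add: susp_obj_susp_obj ac_simps)
    ultimately have "susp_arr T (n + 1) (\<phi> d x X) \<cdot>\<^bsub>T\<^esub> ?f = ZeroA T C (susp_obj T (d + (n + 1)) X)"
      by simp
    then have "?f \<in> zero_sub (H C X) (n + 1)"
      using inj f unfolding injective_mod_def by (auto simp: zero_sub_def)
    then show ?thesis by (simp add: zero_sub_def SX)
  qed
  then show "ghost T C \<delta>" using ghost_iff[OF koszul_simps(5)] by blast
qed

text \<open>If \<open>x\<close> is a non-zero divisor, then \<open>Hom\<^sup>*(C, X//x)\<close> is \<open>Hom\<^sup>*(C, X)/x Hom\<^sup>*(C, X)\<close> up to a shift.\<close>

lemma regular_mod_koszul:
  assumes inj: "injective_mod (H C X) (zero_sub (H C X)) d x"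
    and ys: "\<And>e y. (e, y) \<in> set ys \<Longrightarrow> y \<in> G e"
  shows "regular_mod (H C X)
      (add_multiples (H C X) (zero_sub (H C X)) d x) ys \<longleftrightarrow>
    regular_mod (H C (Dom T \<delta>)) (zero_sub (H C (Dom T \<delta>))) ys"
proof -
  let ?N = "H C X" and ?N' = "H C (Dom T \<delta>)"
  have tgt: "susp_obj T (n - d) (susp_obj T d X) = susp_obj T n X" for n
    using X by (simp add: susp_obj_susp_obj)
  have gh: "susp_arr T n \<delta> \<cdot>\<^bsub>T\<^esub> g = ZeroA T C (susp_obj T n (SuspO T X))"
    if "g \<in> Hom T C (susp_obj T n (Dom T \<delta>))" for n g
    using that inj ghost_koszul_iff ghost_iff[OF koszul_simps(5)] by blast
  note NM' = hom_module_graded_module[OF C koszul_simps(6)]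
  show ?thesis
  proof (rule regular_mod_surjection[where k = "- d" and p = "\<lambda>n m. susp_arr T (n - d) q \<cdot>\<^bsub>T\<^esub> m"])
    show "graded_module_over R G ?N" by (rule hom_module_graded_module[OF C X])
    show "graded_module_over R G ?N'" by (rule NM')
    show "(\<lambda>m. susp_arr T (n - d) q \<cdot>\<^bsub>T\<^esub> m) \<in> hom (comp ?N n) (comp ?N' (n + - d))" for n
      using Comp_left_hom[OF susp_arr_Hom[OF koszul_simps(4)] C, of "n - d"] by (simp add: tgt)
    show "carrier (comp ?N' (n + - d)) \<subseteq> (\<lambda>m. susp_arr T (n - d) q \<cdot>\<^bsub>T\<^esub> m) ` carrier (comp ?N n)" for n
    proof
      fix u assume "u \<in> carrier (comp ?N' (n + - d))"
      then have u: "u \<in> Hom T C (susp_obj T (n - d) (Dom T \<delta>))" by simp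
      then obtain v where "v \<in> Hom T C (susp_obj T (n - d) (Dom T q))" "u = susp_arr T (n - d) q \<cdot>\<^bsub>T\<^esub> v"
        using graded_exact_covariant_second[OF t u] gh[OF u] by (auto simp: koszul_simps)
      then show "u \<in> (\<lambda>m. susp_arr T (n - d) q \<cdot>\<^bsub>T\<^esub> m) ` carrier (comp ?N n)"
        by (auto simp: koszul_simps tgt)
    qed
    show "\<exists>m'. (m' = m \<or> m' = inv\<^bsub>comp ?N n\<^esub> m) \<and>
        susp_arr T (e + n - d) q \<cdot>\<^bsub>T\<^esub> act ?N e n y m = act ?N' e (n + - d) y (susp_arr T (n - d) q \<cdot>\<^bsub>T\<^esub> m')"
      if y: "y \<in> G e" and m: "m \<in> carrier (comp ?N n)" for e y n m
    proof -
      let ?m = "signed T (d * e) m"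
      have m: "m \<in> Hom T C (susp_obj T n X)" using m by simp
      have sm: "?m \<in> Hom T C (susp_obj T n X)" using signed_Hom[OF m] .
      have sm': "?m \<in> Hom T C (susp_obj T (n - d) (susp_obj T d X))" using sm by (simp add: tgt)
      have "susp_arr T (n - d) (\<phi> e y (susp_obj T d X)) \<cdot>\<^bsub>T\<^esub> ?m =
          signed T (d * e) (susp_arr T n (\<phi> e y X) \<cdot>\<^bsub>T\<^esub> ?m)"
        using act_susp_obj[OF y X, of ?m C "n - d" d] sm by simp
      also have "\<dots> = susp_arr T n (\<phi> e y X) \<cdot>\<^bsub>T\<^esub> m"
        using signed_act[OF y X sm] signed_twice[OF m] by simp
      finally have "susp_arr T (e + (n - d)) q \<cdot>\<^bsub>T\<^esub> (susp_arr T n (\<phi> e y X) \<cdot>\<^bsub>T\<^esub> m) =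
          susp_arr T (n - d) (\<phi> e y (Dom T \<delta>)) \<cdot>\<^bsub>T\<^esub> (susp_arr T (n - d) q \<cdot>\<^bsub>T\<^esub> ?m)"
        using postcompose_act[OF y koszul_simps(4) sm'] by simp
      then show ?thesis
        using signed_choice[OF m, of "d * e"] by (intro exI[of _ ?m]) (simp add: algebra_simps)
    qed
    show "add_multiples ?N (zero_sub ?N) d x n =
        {m \<in> carrier (comp ?N n). susp_arr T (n - d) q \<cdot>\<^bsub>T\<^esub> m \<in> zero_sub ?N' (n + - d)}" (is "?L = ?R") for n
    proof (intro equalityI subsetI)
      have ZN: "ZeroA T C (susp_obj T n X) \<in> Hom T C (susp_obj T n X)"
        using Zero_Hom[OF C susp_obj_Obj[OF X]] .
      interpret N: graded_module_over R G ?N by (rule hom_module_graded_module[OF C X])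
      have L: "m \<in> ?L \<longleftrightarrow> (\<exists>f\<in>Hom T C (susp_obj T (n - d) X). m = susp_arr T (n - d) (\<phi> d x X) \<cdot>\<^bsub>T\<^esub> f)" for m
      proof -
        have "ZeroA T C (susp_obj T n X) \<otimes>\<^bsub>comp ?N n\<^esub> (susp_arr T (n - d) (\<phi> d x X) \<cdot>\<^bsub>T\<^esub> f) =
            susp_arr T (n - d) (\<phi> d x X) \<cdot>\<^bsub>T\<^esub> f" if "f \<in> Hom T C (susp_obj T (n - d) X)" for f
          using N.N.l_one[of _ n] act_hom_module_Hom[OF C X x that] by simp
        then show ?thesis by (auto simp: add_multiples_def zero_sub_def) metis
      qed
      {
        fix m assume "m \<in> ?L"
        then obtain f where f: "f \<in> Hom T C (susp_obj T (n - d) X)"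
          "m = susp_arr T (n - d) (\<phi> d x X) \<cdot>\<^bsub>T\<^esub> f" using L by blast
        then show "m \<in> ?R"
          using graded_Comp_zero[OF \<phi>_Hom[OF x X] koszul_simps(4) _ f(1)] Tri_Comp_zero[OF t]
            act_hom_module_Hom[OF C X x f(1)] by (simp add: koszul_simps zero_sub_def)
      next
        fix m assume "m \<in> ?R"
        then have m: "m \<in> Hom T C (susp_obj T n X)"
          and z: "susp_arr T (n - d) q \<cdot>\<^bsub>T\<^esub> m = ZeroA T C (susp_obj T (n - d) (Dom T \<delta>))"
          by (auto simp: zero_sub_def)
        then show "m \<in> ?L"
          unfolding L using graded_exact_covariant[OF t, of m C "n - d"]
          by (auto simp: koszul_simps tgt)
      }
    qed
    show "subgroup (zero_sub ?N' n) (comp ?N' n)" for n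
      using graded_module_over.submoduleD(1)[OF NM' graded_module_over.zero_sub_submodule[OF NM']] .
  qed (use ys in auto)
qed

end


section \<open>Torsion and ghost maps\<close>

text \<open>Each element of \<open>Hom\<^sup>*(C, X)\<close> is annihilated by a power of \<open>x\<close>.\<close>

definition power_torsion :: "'o \<Rightarrow> 'o \<Rightarrow> int \<Rightarrow> 'r \<Rightarrow> bool" where
  "power_torsion C X d x \<longleftrightarrow> (\<forall>n. \<forall>f\<in>Hom T C (susp_obj T n X). \<exists>k::nat.
     susp_arr T n (\<phi> (int k * d) (x [^]\<^bsub>R\<^esub> k) X) \<cdot>\<^bsub>T\<^esub> f = ZeroA T C (susp_obj T (int k * d + n) X))"

text \<open>Multiplication by \<open>x\<close> is bijective on \<open>Hom\<^sup>*(C, X)\<close>.\<close>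

definition acts_bijectively :: "'o \<Rightarrow> 'o \<Rightarrow> int \<Rightarrow> 'r \<Rightarrow> bool" where
  "acts_bijectively C X d x \<longleftrightarrow> (\<forall>n. bij_betw (\<lambda>f. susp_arr T n (\<phi> d x X) \<cdot>\<^bsub>T\<^esub> f)
     (Hom T C (susp_obj T n X)) (Hom T C (susp_obj T (d + n) X)))"

context
  fixes C A A' E c g h d x
  assumes C: "C \<in> Obj T" and x: "x \<in> G d" and t: "(c, g, h) \<in> Tri T"
    and A': "Dom T c = A'" and A: "Dom T g = A" and E: "Dom T h = E"
    and tors: "power_torsion C A' d x" and bij: "acts_bijectively C E d x"
begin

lemma tors_simps:
  "c \<in> Hom T A' A" "g \<in> Hom T A E" "h \<in> Hom T E (SuspO T A')"
  "A' \<in> Obj T" "A \<in> Obj T" "E \<in> Obj T" "SuspO T A' \<in> Obj T"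
  using TriD[OF t] A A' E susp_obj_Obj[of A' 1] by auto

text \<open>The image of \<open>Hom\<^sup>*(C, A')\<close> in \<open>Hom\<^sup>*(C, A)\<close> is the submodule of \<open>x\<close>-torsion elements.\<close>

lemma ghost_torsion_iff:
  "ghost T C c \<longleftrightarrow> injective_mod (H C A) (zero_sub (H C A)) d x"
proof
  assume gh: "ghost T C c"
  show "injective_mod (H C A) (zero_sub (H C A)) d x"
    unfolding injective_mod_def zero_sub_def
  proof (intro allI ballI impI, simp)
    fix n f assume f: "f \<in> Hom T C (susp_obj T n A)"
      and xf: "susp_arr T n (\<phi> d x A) \<cdot>\<^bsub>T\<^esub> f = ZeroA T C (susp_obj T (d + n) A)"
    let ?gf = "susp_arr T n g \<cdot>\<^bsub>T\<^esub> f"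
    have gf: "?gf \<in> Hom T C (susp_obj T n E)" using Comp_Hom[OF f susp_arr_Hom[OF tors_simps(2)]] .
    have Z: "ZeroA T C (susp_obj T n E) \<in> Hom T C (susp_obj T n E)"
      using Zero_Hom[OF C susp_obj_Obj[OF tors_simps(6)]] .
    have "susp_arr T n (\<phi> d x E) \<cdot>\<^bsub>T\<^esub> ?gf = ZeroA T C (susp_obj T (d + n) E)"
      using postcompose_act[OF x tors_simps(2) f] xf
        Comp_Zero_right[OF susp_arr_Hom[OF tors_simps(2)] C] by simp
    also have "\<dots> = susp_arr T n (\<phi> d x E) \<cdot>\<^bsub>T\<^esub> ZeroA T C (susp_obj T n E)"
      using Comp_Zero_right[OF susp_arr_Hom[OF \<phi>_Hom[OF x tors_simps(6)]] C] tors_simps(6)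
      by (simp add: susp_obj_susp_obj add.commute)
    finally have "?gf = ZeroA T C (susp_obj T n E)"
      using bij gf Z by (auto simp: acts_bijectively_def bij_betw_def inj_on_def)
    then obtain v where "v \<in> Hom T C (susp_obj T n A')" "f = susp_arr T n c \<cdot>\<^bsub>T\<^esub> v"
      using graded_exact_covariant[OF t, of f C n] f by (auto simp: A A' E)
    then show "f = ZeroA T C (susp_obj T n A)"
      using gh ghost_iff[OF tors_simps(1)] by blast
  qed
next
  assume inj: "injective_mod (H C A) (zero_sub (H C A)) d x"
  interpret N: graded_module_over R G "H C A"
    by (rule hom_module_graded_module[OF C tors_simps(5)])
  have pow: "f = ZeroA T C (susp_obj T n A)"
    if "f \<in> Hom T C (susp_obj T n A)"
      "susp_arr T n (\<phi> (int k * d) (x [^]\<^bsub>R\<^esub> k) A) \<cdot>\<^bsub>T\<^esub> f = ZeroA T C (susp_obj T (int k * d + n) A)"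
    for k n f
    using that
  proof (induction k arbitrary: n f)
    case 0
    then show ?case using N.act_one[of f n] by simp
  next
    case (Suc k)
    let ?xf = "susp_arr T n (\<phi> d x A) \<cdot>\<^bsub>T\<^esub> f"
    have "susp_arr T (d + n) (\<phi> (int k * d) (x [^]\<^bsub>R\<^esub> k) A) \<cdot>\<^bsub>T\<^esub> ?xf =
        ZeroA T C (susp_obj T (int k * d + (d + n)) A)"
      using N.act_pow_Suc[OF x, of f n k] Suc.prems by (simp add: algebra_simps)
    then have "?xf = ZeroA T C (susp_obj T (d + n) A)"
      using Suc.IH act_hom_module_Hom[OF C tors_simps(5) x Suc.prems(1)] by blast
    then show ?case
      using inj Suc.prems(1) by (auto simp: injective_mod_def zero_sub_def)
  qed
  have "susp_arr T n c \<cdot>\<^bsub>T\<^esub> f = ZeroA T C (susp_obj T n A)" if f: "f \<in> Hom T C (susp_obj T n A')" for n f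
  proof -
    obtain k :: nat where "susp_arr T n (\<phi> (int k * d) (x [^]\<^bsub>R\<^esub> k) A') \<cdot>\<^bsub>T\<^esub> f =
        ZeroA T C (susp_obj T (int k * d + n) A')"
      using tors f by (auto simp: power_torsion_def)
    then have "susp_arr T n (\<phi> (int k * d) (x [^]\<^bsub>R\<^esub> k) A) \<cdot>\<^bsub>T\<^esub> (susp_arr T n c \<cdot>\<^bsub>T\<^esub> f) =
        ZeroA T C (susp_obj T (int k * d + n) A)"
      using postcompose_act[OF G_pow[OF x] tors_simps(1) f, of k]
        Comp_Zero_right[OF susp_arr_Hom[OF tors_simps(1)] C] by simp
    then show ?thesis using pow Comp_Hom[OF f susp_arr_Hom[OF tors_simps(1)]] by blast
  qed
  then show "ghost T C c" using ghost_iff[OF tors_simps(1)] by blast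
qed

text \<open>If \<open>c\<close> is ghost, the long exact sequence breaks up into short ones, which embed \<open>Hom\<^sup>*(C, A)\<close> into
  \<open>Hom\<^sup>*(C, E)\<close> with quotient \<open>Hom\<^sup>*(C, \<Sigma> A')\<close>.\<close>

lemma regular_mod_torsion_triangle:
  assumes gh: "ghost T C c" and ys: "\<And>e y. (e, y) \<in> set ys \<Longrightarrow> y \<in> G e"
  shows "regular_mod (H C A)
      (add_multiples (H C A) (zero_sub (H C A)) d x) ys \<longleftrightarrow>
    regular_mod (H C A') (zero_sub (H C A')) ys"
proof -
  let ?N = "H C A" and ?E = "H C E"
    and ?W = "H C (SuspO T A')" and ?W' = "H C A'"
  note NM = hom_module_graded_module[OF C tors_simps(5)]
    and EM = hom_module_graded_module[OF C tors_simps(6)]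
    and WM = hom_module_graded_module[OF C tors_simps(7)]
    and WM' = hom_module_graded_module[OF C tors_simps(4)]
  interpret N: graded_module_over R G ?N by (rule NM)
  have tgt: "susp_obj T n (SuspO T A') = susp_obj T (n + 1) A'" for n
    using tors_simps(4) susp_obj_SuspO by simp
  have gh': "susp_arr T n (SuspA T c) \<cdot>\<^bsub>T\<^esub> u = ZeroA T C (susp_obj T n (SuspO T A))"
    if "u \<in> Hom T C (susp_obj T n (SuspO T A'))" for n u
    using that gh ghost_susp_arr[OF tors_simps(1), of C 1] ghost_iff[OF SuspA_Hom[OF tors_simps(1)]]
    by simp
  have tsq: "torsion_sequence R G ?N ?E ?W (\<lambda>n f. susp_arr T n g \<cdot>\<^bsub>T\<^esub> f) (\<lambda>n f. susp_arr T n h \<cdot>\<^bsub>T\<^esub> f) d x"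
  proof (intro torsion_sequence.intro NM EM WM torsion_sequence_axioms.intro, goal_cases)
    case (1 n)
    show ?case by (rule postcompose_hom[OF C tors_simps(2)])
  next
    case (2 n)
    show ?case by (rule postcompose_hom[OF C tors_simps(3)])
  next
    case (3 y e m n)
    then show ?case using postcompose_act[OF _ tors_simps(2)] by simp
  next
    case (4 y e m n)
    then show ?case using postcompose_act[OF _ tors_simps(3)] by simp
  next
    case (5 n)
    have "f = \<one>\<^bsub>comp ?N n\<^esub>" if f: "f \<in> carrier (comp ?N n)"
      and gf: "susp_arr T n g \<cdot>\<^bsub>T\<^esub> f = \<one>\<^bsub>comp ?E n\<^esub>" for f
    proof -
      obtain v where "v \<in> Hom T C (susp_obj T n A')" "f = susp_arr T n c \<cdot>\<^bsub>T\<^esub> v"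
        using graded_exact_covariant[OF t, of f C n] f gf by (auto simp: A A' E)
      then show ?thesis using gh ghost_iff[OF tors_simps(1)] by simp
    qed
    moreover have "group_hom (comp ?N n) (comp ?E n) (\<lambda>f. susp_arr T n g \<cdot>\<^bsub>T\<^esub> f)"
      using postcompose_hom[OF C tors_simps(2)] N.N.group_axioms
        Hom_group[OF C susp_obj_Obj[OF tors_simps(6)]]
      by (auto simp: group_hom_def group_hom_axioms_def)
    ultimately show ?case
      by (intro group_hom.inj_on_one_iff[THEN iffD2]) auto
  next
    case (6 n)
    show ?case
    proof
      fix w assume "w \<in> carrier (comp ?W n)"
      then have w: "w \<in> Hom T C (susp_obj T n (SuspO T A'))" by simp
      then show "w \<in> (\<lambda>f. susp_arr T n h \<cdot>\<^bsub>T\<^esub> f) ` carrier (comp ?E n)"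
        using graded_exact_covariant_last[OF t, of w C n] gh'[OF w] by (auto simp: A A' E)
    qed
  next
    case (7 f n)
    then have f: "f \<in> Hom T C (susp_obj T n E)" by simp
    have "susp_arr T n h \<cdot>\<^bsub>T\<^esub> f = ZeroA T C (susp_obj T n (SuspO T A')) \<longleftrightarrow>
        (\<exists>v \<in> Hom T C (susp_obj T n A). f = susp_arr T n g \<cdot>\<^bsub>T\<^esub> v)"
      using graded_exact_covariant_second[OF t, of f C n] f Tri_Comp_zero_second[OF t]
        graded_Comp_zero[OF tors_simps(2,3)] by (auto simp: A A' E)
    then show ?case by (simp add: image_iff)
  next
    case 8
    show ?case by (rule x)
  next
    case (9 n)
    show ?case using bij by (simp add: acts_bijectively_def)
  next
    case (10 w n)
    then have w: "w \<in> Hom T C (susp_obj T (n + 1) A')" by (simp add: tgt)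
    then obtain k :: nat where k: "susp_arr T (n + 1) (\<phi> (int k * d) (x [^]\<^bsub>R\<^esub> k) A') \<cdot>\<^bsub>T\<^esub> w =
        ZeroA T C (susp_obj T (int k * d + (n + 1)) A')"
      using tors by (auto simp: power_torsion_def)
    have Z: "ZeroA T C (susp_obj T (int k * d + (n + 1)) A') \<in> Hom T C (susp_obj T (int k * d + (n + 1)) A')"
      using Zero_Hom[OF C susp_obj_Obj[OF tors_simps(4)]] .
    have "susp_arr T n (\<phi> (int k * d) (x [^]\<^bsub>R\<^esub> k) (SuspO T A')) \<cdot>\<^bsub>T\<^esub> w =
        ZeroA T C (susp_obj T (int k * d + (n + 1)) A')"
      using act_susp_obj[OF G_pow[OF x] tors_simps(4) w, of k] k signed_eq_Zero_iff[OF Z] by simp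
    then show ?case by (intro exI[of _ k]) (simp add: tgt add.assoc)
  qed
  have "regular_mod ?N (add_multiples ?N (zero_sub ?N) d x) ys \<longleftrightarrow> regular_mod ?W (zero_sub ?W) ys"
    using torsion_sequence.regular_mod_torsion[OF tsq] ys by blast
  also have "\<dots> \<longleftrightarrow> regular_mod ?W' (zero_sub ?W') ys"
  proof (rule regular_mod_surjection[where k = 1 and p = "\<lambda>n m. m"])
    show "graded_module_over R G ?W" "graded_module_over R G ?W'" by (rule WM WM')+
    show "(\<lambda>m. m) \<in> hom (comp ?W n) (comp ?W' (n + 1))" for n
      by (auto simp: hom_def tgt)
    show "carrier (comp ?W' (n + 1)) \<subseteq> (\<lambda>m. m) ` carrier (comp ?W n)" for n
      by (auto simp: tgt)
    show "\<exists>m'. (m' = m \<or> m' = inv\<^bsub>comp ?W n\<^esub> m) \<and> act ?W e n y m = act ?W' e (n + 1) y m'"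
      if y: "y \<in> G e" and m: "m \<in> carrier (comp ?W n)" for e y n m
    proof -
      have m: "m \<in> Hom T C (susp_obj T (n + 1) A')" using m by (simp add: tgt)
      show ?thesis
        using act_susp_obj[OF y tors_simps(4) m] signed_act[OF y tors_simps(4) m, of e]
          signed_choice[OF m, of e]
        by (intro exI[of _ "signed T e m"]) (simp add: tgt)
    qed
    show "zero_sub ?W n = {m \<in> carrier (comp ?W n). m \<in> zero_sub ?W' (n + 1)}" for n
      using Zero_Hom[OF C susp_obj_Obj[OF tors_simps(4)]] by (auto simp: zero_sub_def tgt)
    show "subgroup (zero_sub ?W' n) (comp ?W' n)" for n
      using graded_module_over.submoduleD(1)[OF WM' graded_module_over.zero_sub_submodule[OF WM']] .
  qed (use ys in auto)
  finally show ?thesis .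
qed

end

end

section \<open>Compact objects\<close>

context additive_category
begin

lemma Hom_comm_monoid: "a \<in> Obj T \<Longrightarrow> b \<in> Obj T \<Longrightarrow> comm_monoid (hom_group T a b)"
  using hom_group comm_group.axioms(1) by blast

lemma finprod_Hom:
  assumes "a \<in> Obj T" "b \<in> Obj T" "\<And>i. i \<in> F \<Longrightarrow> h i \<in> Hom T a b"
  shows "finprod (hom_group T a b) h F \<in> Hom T a b"
  using comm_monoid.finprod_closed[OF Hom_comm_monoid[OF assms(1,2)], of h F] assms(3) by auto

lemma Comp_finprod_right:
  assumes g: "g \<in> Hom T b c" and a: "a \<in> Obj T" and h: "\<And>i. i \<in> F \<Longrightarrow> h i \<in> Hom T a b"
    and F: "finite F"
  shows "g \<cdot> finprod (hom_group T a b) h F = finprod (hom_group T a c) (\<lambda>i. g \<cdot> h i) F"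
  using F h
proof (induction F rule: finite_induct)
  case empty
  interpret B: comm_monoid "hom_group T a b" using Hom_comm_monoid a HomD[OF g] by blast
  interpret D: comm_monoid "hom_group T a c" using Hom_comm_monoid a HomD[OF g] by blast
  show ?case using Comp_Zero_right[OF g a] by simp
next
  case (insert i F)
  have bc: "b \<in> Obj T" "c \<in> Obj T" using HomD[OF g] by auto
  interpret B: comm_monoid "hom_group T a b" using Hom_comm_monoid a bc by blast
  interpret D: comm_monoid "hom_group T a c" using Hom_comm_monoid a bc by blast
  have "finprod (hom_group T a b) h (insert i F) = Plus T (h i) (finprod (hom_group T a b) h F)"
    using B.finprod_insert[of F i h] insert by auto
  moreover have "finprod (hom_group T a c) (\<lambda>i. g \<cdot> h i) (insert i F) =
      Plus T (g \<cdot> h i) (finprod (hom_group T a c) (\<lambda>i. g \<cdot> h i) F)"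
    using D.finprod_insert[of F i "\<lambda>i. g \<cdot> h i"] insert Comp_Hom[OF _ g] by auto
  moreover have fp: "finprod (hom_group T a b) h F \<in> Hom T a b"
    using insert.prems by (intro finprod_Hom[OF a bc(1)]) auto
  ultimately show ?case
    using Comp_Plus_right[OF insert.prems[of i] fp g] insert by simp
qed

lemma Comp_finprod_left:
  assumes f: "f \<in> Hom T a b" and c: "c \<in> Obj T" and h: "\<And>i. i \<in> F \<Longrightarrow> h i \<in> Hom T b c"
    and F: "finite F"
  shows "finprod (hom_group T b c) h F \<cdot> f = finprod (hom_group T a c) (\<lambda>i. h i \<cdot> f) F"
  using F h
proof (induction F rule: finite_induct)
  case empty
  interpret B: comm_monoid "hom_group T b c" using Hom_comm_monoid c HomD[OF f] by blast
  interpret D: comm_monoid "hom_group T a c" using Hom_comm_monoid c HomD[OF f] by blast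
  show ?case using Comp_Zero_left[OF f c] by simp
next
  case (insert i F)
  have ab: "a \<in> Obj T" "b \<in> Obj T" using HomD[OF f] by auto
  interpret B: comm_monoid "hom_group T b c" using Hom_comm_monoid c ab by blast
  interpret D: comm_monoid "hom_group T a c" using Hom_comm_monoid c ab by blast
  have "finprod (hom_group T b c) h (insert i F) = Plus T (h i) (finprod (hom_group T b c) h F)"
    using B.finprod_insert[of F i h] insert by auto
  moreover have "finprod (hom_group T a c) (\<lambda>i. h i \<cdot> f) (insert i F) =
      Plus T (h i \<cdot> f) (finprod (hom_group T a c) (\<lambda>i. h i \<cdot> f) F)"
    using D.finprod_insert[of F i "\<lambda>i. h i \<cdot> f"] insert Comp_Hom[OF f] by auto
  moreover have fp: "finprod (hom_group T b c) h F \<in> Hom T b c"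
    using insert.prems by (intro finprod_Hom[OF ab(2) c]) auto
  ultimately show ?case
    using Comp_Plus_left[OF f insert.prems[of i] fp] insert by simp
qed

text \<open>The endomorphism of a coproduct that vanishes on the summands in \<open>F\<close> and is the identity on the
  others.\<close>

definition cutoff :: "'i set \<Rightarrow> ('i \<Rightarrow> 'o) \<Rightarrow> 'o \<Rightarrow> ('i \<Rightarrow> 'm) \<Rightarrow> 'i set \<Rightarrow> 'm \<Rightarrow> bool" where
  "cutoff I X S \<iota> F c \<longleftrightarrow> c \<in> Hom T S S \<and>
     (\<forall>i\<in>I. c \<cdot> \<iota> i = (if i \<in> F then ZeroA T (X i) S else \<iota> i))"

context
  fixes I X S \<iota>
  assumes cp: "is_coproduct T I X S \<iota>"
begin

lemma coproductD: "S \<in> Obj T" "i \<in> I \<Longrightarrow> X i \<in> Obj T" "i \<in> I \<Longrightarrow> \<iota> i \<in> Hom T (X i) S"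
  using cp by (auto simp: is_coproduct_def)

lemma cutoff_exists: "\<exists>c. cutoff I X S \<iota> F c"
proof -
  have "\<exists>u \<in> Hom T S S. \<forall>i\<in>I. u \<cdot> \<iota> i = (if i \<in> F then ZeroA T (X i) S else \<iota> i)"
    using coproductD by (intro coproduct_exists[OF cp]) (auto intro: Zero_Hom)
  then show ?thesis by (auto simp: cutoff_def)
qed

lemma cutoff_Comp:
  assumes "cutoff I X S \<iota> F c" "cutoff I X S \<iota> F' c'"
  shows "cutoff I X S \<iota> (F \<union> F') (c' \<cdot> c)"
proof -
  have c: "c \<in> Hom T S S" "c' \<in> Hom T S S" using assms by (auto simp: cutoff_def)
  have "(c' \<cdot> c) \<cdot> \<iota> i = (if i \<in> F \<union> F' then ZeroA T (X i) S else \<iota> i)" if i: "i \<in> I" for i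
  proof -
    have "(c' \<cdot> c) \<cdot> \<iota> i = c' \<cdot> (c \<cdot> \<iota> i)"
      using Comp_assoc[OF coproductD(3)[OF i] c] .
    then show ?thesis
      using assms i Comp_Zero_right[OF c(2) coproductD(2)[OF i]] by (auto simp: cutoff_def)
  qed
  then show ?thesis using Comp_Hom[OF c] by (auto simp: cutoff_def)
qed

lemma projections_exist:
  "\<exists>p. \<forall>j\<in>I. p j \<in> Hom T S (X j) \<and>
     (\<forall>i\<in>I. p j \<cdot> \<iota> i = (if i = j then Idn T (X j) else ZeroA T (X i) (X j)))"
proof (rule bchoice, intro ballI)
  fix j assume j: "j \<in> I"
  have "\<exists>u \<in> Hom T S (X j). \<forall>i\<in>I. u \<cdot> \<iota> i = (if i = j then Idn T (X j) else ZeroA T (X i) (X j))"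
    using coproductD(2) j by (intro coproduct_exists[OF cp]) (auto intro: Zero_Hom Idn_Hom)
  then show "\<exists>u. u \<in> Hom T S (X j) \<and>
      (\<forall>i\<in>I. u \<cdot> \<iota> i = (if i = j then Idn T (X j) else ZeroA T (X i) (X j)))" by blast
qed

lemma finite_sum_cutoff:
  assumes C: "C \<in> Obj T" and F: "finite F" "F \<subseteq> I" and c: "cutoff I X S \<iota> F c"
    and g: "\<And>i. i \<in> F \<Longrightarrow> g i \<in> Hom T C (X i)"
  shows "c \<cdot> finprod (hom_group T C S) (\<lambda>i. \<iota> i \<cdot> g i) F = ZeroA T C S"
proof -
  have cH: "c \<in> Hom T S S" using c by (simp add: cutoff_def)
  have "c \<cdot> (\<iota> i \<cdot> g i) = ZeroA T C S" if i: "i \<in> F" for i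
  proof -
    have iI: "i \<in> I" using F(2) i by blast
    have "c \<cdot> (\<iota> i \<cdot> g i) = ZeroA T (X i) S \<cdot> g i"
      using Comp_assoc[OF g[OF i] coproductD(3)[OF iI] cH] c iI i by (simp add: cutoff_def)
    then show ?thesis using Comp_Zero_left[OF g[OF i] coproductD(1)] by simp
  qed
  moreover have "c \<cdot> finprod (hom_group T C S) (\<lambda>i. \<iota> i \<cdot> g i) F =
      finprod (hom_group T C S) (\<lambda>i. c \<cdot> (\<iota> i \<cdot> g i)) F"
    using Comp_Hom[OF g coproductD(3)] F(2) by (intro Comp_finprod_right[OF cH C _ F(1)]) auto
  ultimately show ?thesis
    using comm_monoid.finprod_one_eqI[OF Hom_comm_monoid[OF C coproductD(1)],
        of F "\<lambda>i. c \<cdot> (\<iota> i \<cdot> g i)"] by simp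
qed

lemma cutoff_finite_sum:
  assumes F: "finite F" "F \<subseteq> I" and c: "cutoff I X S \<iota> F c"
    and p: "\<And>j. j \<in> I \<Longrightarrow> p j \<in> Hom T S (X j)"
      "\<And>i j. i \<in> I \<Longrightarrow> j \<in> I \<Longrightarrow> p j \<cdot> \<iota> i = (if i = j then Idn T (X j) else ZeroA T (X i) (X j))"
    and f: "f \<in> Hom T C S" and cf: "c \<cdot> f = ZeroA T C S"
  shows "f = finprod (hom_group T C S) (\<lambda>i. \<iota> i \<cdot> (p i \<cdot> f)) F"
proof -
  have C: "C \<in> Obj T" using HomD[OF f] by simp
  note S = coproductD(1)
  interpret H: comm_group "hom_group T S S" using hom_group S by blast
  have cH: "c \<in> Hom T S S" using c by (simp add: cutoff_def)
  have ip: "\<iota> i \<cdot> p i \<in> Hom T S S" if "i \<in> I" for i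
    using Comp_Hom[OF p(1)[OF that] coproductD(3)[OF that]] .
  let ?e = "finprod (hom_group T S S) (\<lambda>i. \<iota> i \<cdot> p i) F"
  have e: "?e \<in> Hom T S S" using ip F(2) by (intro finprod_Hom[OF S S]) auto
  \<comment> \<open>The endomorphism \<open>e\<close> and the cutoff add up to the identity, as a check on each summand shows.\<close>
  have "Plus T ?e c \<cdot> \<iota> j = Idn T S \<cdot> \<iota> j" if j: "j \<in> I" for j
  proof -
    note Xj = coproductD(2)[OF j] and ij = coproductD(3)[OF j]
    interpret J: comm_group "hom_group T (X j) S" using hom_group Xj S by blast
    have val: "(\<iota> i \<cdot> p i) \<cdot> \<iota> j = (if j = i then \<iota> j else ZeroA T (X j) S)" if i: "i \<in> I" for i
      using Comp_assoc[OF ij p(1)[OF i] coproductD(3)[OF i]] p(2)[OF j i]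
        Comp_Idn_right[OF ij] Comp_Zero_right[OF coproductD(3)[OF i] Xj] by auto
    have "?e \<cdot> \<iota> j = finprod (hom_group T (X j) S) (\<lambda>i. (\<iota> i \<cdot> p i) \<cdot> \<iota> j) F"
      using ip F(2) by (intro Comp_finprod_left[OF ij S _ F(1)]) auto
    also have "\<dots> = finprod (hom_group T (X j) S)
        (\<lambda>i. if j = i then \<iota> j else \<one>\<^bsub>hom_group T (X j) S\<^esub>) F"
      using val F(2) ij J.one_closed by (intro J.finprod_cong) (auto simp: simp_implies_def)
    also have "\<dots> = (if j \<in> F then \<iota> j else ZeroA T (X j) S)"
    proof (cases "j \<in> F")
      case True
      then show ?thesis using J.finprod_singleton[OF True F(1), of "\<lambda>_. \<iota> j"] ij by simp
    next
      case False
      then show ?thesis by (auto intro!: J.finprod_one_eqI[simplified])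
    qed
    finally have "?e \<cdot> \<iota> j = (if j \<in> F then \<iota> j else ZeroA T (X j) S)" .
    moreover have "c \<cdot> \<iota> j = (if j \<in> F then ZeroA T (X j) S else \<iota> j)"
      using c j by (simp add: cutoff_def)
    ultimately show ?thesis
      using Comp_Plus_left[OF ij e cH] Comp_Idn_left[OF ij] J.r_one[of "\<iota> j"] J.l_one[of "\<iota> j"] ij
      by simp
  qed
  then have "Plus T ?e c = Idn T S"
    using coproduct_eqI[OF cp Plus_Hom[OF e cH] Idn_Hom[OF S]] by blast
  then have "f = Plus T (?e \<cdot> f) (c \<cdot> f)"
    using Comp_Plus_left[OF f e cH] Comp_Idn_left[OF f] by simp
  also have "\<dots> = ?e \<cdot> f"
    using cf monoid.r_one[OF group.is_monoid[OF Hom_group[OF C S]], of "?e \<cdot> f"] Comp_Hom[OF f e]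
    by simp
  also have "\<dots> = finprod (hom_group T C S) (\<lambda>i. (\<iota> i \<cdot> p i) \<cdot> f) F"
    using ip F(2) by (intro Comp_finprod_left[OF f S _ F(1)]) auto
  also have "\<dots> = finprod (hom_group T C S) (\<lambda>i. \<iota> i \<cdot> (p i \<cdot> f)) F"
  proof -
    interpret K: comm_group "hom_group T C S" using hom_group C S by blast
    have "\<iota> i \<cdot> (p i \<cdot> f) \<in> Hom T C S" "(\<iota> i \<cdot> p i) \<cdot> f = \<iota> i \<cdot> (p i \<cdot> f)" if "i \<in> I" for i
      using Comp_Hom[OF Comp_Hom[OF f p(1)[OF that]] coproductD(3)[OF that]]
        Comp_assoc[OF f p(1)[OF that] coproductD(3)[OF that]] by auto
    then show ?thesis using F(2) by (intro K.finprod_cong) (auto simp: simp_implies_def)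
  qed
  finally show ?thesis .
qed

text \<open>Whatever the object \<open>C\<close>, the canonical map from \<open>\<Oplus>\<^sub>i Hom(C, X\<^sub>i)\<close> is an injective homomorphism, by
  means of the projections. Its image consists of the morphisms annihilated by the cutoff of a
  finite set of summands.\<close>

lemma canonical_sum_map_iso_iff:
  assumes C: "C \<in> Obj T"
  shows "(\<lambda>g. finprod (hom_group T C S) (\<lambda>i. \<iota> i \<cdot> g i) {i \<in> I. g i \<noteq> ZeroA T C (X i)})
      \<in> iso (sum_group I (\<lambda>i. hom_group T C (X i))) (hom_group T C S) \<longleftrightarrow>
    (\<forall>f\<in>Hom T C S. \<exists>F c. finite F \<and> F \<subseteq> I \<and> cutoff I X S \<iota> F c \<and> c \<cdot> f = ZeroA T C S)"
    (is "?\<Phi> \<in> iso ?A ?B \<longleftrightarrow> ?R")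
proof -
  let ?supp = "\<lambda>g. {i \<in> I. g i \<noteq> ZeroA T C (X i)}"
  note S = coproductD(1)
  interpret H: comm_group "hom_group T C S" using hom_group C S by blast
  have grp: "group (hom_group T C (X i))" if "i \<in> I" for i using Hom_group C coproductD(2)[OF that] by blast
  have carr: "carrier ?A = {g \<in> \<Pi>\<^sub>E i\<in>I. Hom T C (X i). finite (?supp g)}"
    using carrier_sum_group[of I "\<lambda>i. hom_group T C (X i)"] grp by simp
  have gH: "g i \<in> Hom T C (X i)" if "g \<in> carrier ?A" "i \<in> I" for g i
    using that by (auto simp: carr)
  have igH: "\<iota> i \<cdot> g i \<in> Hom T C S" if "g \<in> carrier ?A" "i \<in> I" for g i
    using Comp_Hom[OF gH[OF that] coproductD(3)[OF that(2)]] .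
  have ext: "?\<Phi> g = finprod ?B (\<lambda>i. \<iota> i \<cdot> g i) F"
    if g: "g \<in> carrier ?A" and F: "finite F" "?supp g \<subseteq> F" "F \<subseteq> I" for g F
  proof (rule H.finprod_mono_neutral_cong_left)
    show "\<iota> i \<cdot> g i = \<one>\<^bsub>?B\<^esub>" if "i \<in> F - ?supp g" for i
    proof -
      have i: "i \<in> I" "g i = ZeroA T C (X i)" using that F(3) by auto
      then show ?thesis using Comp_Zero_right[OF coproductD(3) C] by simp
    qed
    show "(\<lambda>i. \<iota> i \<cdot> g i) \<in> F \<rightarrow> carrier ?B" using igH[OF g] F(3) by auto
  qed (use F in auto)
  obtain p where p: "\<And>j. j \<in> I \<Longrightarrow> p j \<in> Hom T S (X j)"
    "\<And>i j. i \<in> I \<Longrightarrow> j \<in> I \<Longrightarrow> p j \<cdot> \<iota> i = (if i = j then Idn T (X j) else ZeroA T (X i) (X j))"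
    using projections_exist by blast
  have hom: "?\<Phi> \<in> hom ?A ?B"
  proof (rule homI)
    fix g assume "g \<in> carrier ?A"
    then show "?\<Phi> g \<in> carrier ?B" using igH by (auto intro!: finprod_Hom[OF C S])
  next
    fix g g' assume g: "g \<in> carrier ?A" and g': "g' \<in> carrier ?A"
    let ?h = "g \<otimes>\<^bsub>?A\<^esub> g'" and ?F = "?supp g \<union> ?supp g'"
    have h: "?h \<in> carrier ?A"
      using group.is_monoid[OF sum_group[of I "\<lambda>i. hom_group T C (X i)"], THEN monoid.m_closed, OF grp g g'] .
    have hi: "?h i = Plus T (g i) (g' i)" if "i \<in> I" for i using that by simp
    have F: "finite ?F" "?F \<subseteq> I" using g g' by (auto simp: carr)
    have "?h i = ZeroA T C (X i)" if i: "i \<in> I" "i \<notin> ?F" for i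
      using i hi[OF i(1)] group.is_monoid[OF grp[OF i(1)], THEN monoid.r_one, of "ZeroA T C (X i)"]
        Zero_Hom[OF C coproductD(2)[OF i(1)]] by simp
    then have sub: "?supp ?h \<subseteq> ?F" by blast
    have "?\<Phi> ?h = finprod ?B (\<lambda>i. \<iota> i \<cdot> ?h i) ?F" using ext[OF h F(1) sub F(2)] .
    also have "\<dots> = finprod ?B (\<lambda>i. (\<iota> i \<cdot> g i) \<otimes>\<^bsub>?B\<^esub> (\<iota> i \<cdot> g' i)) ?F"
    proof (rule H.finprod_cong')
      show "?F = ?F" ..
      show "(\<lambda>i. (\<iota> i \<cdot> g i) \<otimes>\<^bsub>?B\<^esub> (\<iota> i \<cdot> g' i)) \<in> ?F \<rightarrow> carrier ?B"
        using F(2) igH[OF g] igH[OF g'] Plus_Hom by auto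
      show "\<iota> i \<cdot> ?h i = (\<iota> i \<cdot> g i) \<otimes>\<^bsub>?B\<^esub> (\<iota> i \<cdot> g' i)" if "i \<in> ?F" for i
      proof -
        have i: "i \<in> I" using that F(2) by blast
        show ?thesis
          using Comp_Plus_right[OF gH[OF g i] gH[OF g' i] coproductD(3)[OF i]] hi[OF i] by simp
      qed
    qed
    also have "\<dots> = finprod ?B (\<lambda>i. \<iota> i \<cdot> g i) ?F \<otimes>\<^bsub>?B\<^esub> finprod ?B (\<lambda>i. \<iota> i \<cdot> g' i) ?F"
      using F igH[OF g] igH[OF g'] by (intro H.finprod_multf) auto
    also have "\<dots> = ?\<Phi> g \<otimes>\<^bsub>?B\<^esub> ?\<Phi> g'"
      using ext[OF g F(1) _ F(2)] ext[OF g' F(1) _ F(2)] by simp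
    finally show "?\<Phi> ?h = ?\<Phi> g \<otimes>\<^bsub>?B\<^esub> ?\<Phi> g'" .
  qed
  have coeff: "p j \<cdot> ?\<Phi> g = g j" if g: "g \<in> carrier ?A" and j: "j \<in> I" for g j
  proof -
    interpret J: comm_group "hom_group T C (X j)" using hom_group C coproductD(2)[OF j] by blast
    let ?F = "insert j (?supp g)"
    have F: "finite ?F" "?F \<subseteq> I" using g j by (auto simp: carr)
    have "p j \<cdot> ?\<Phi> g = p j \<cdot> finprod ?B (\<lambda>i. \<iota> i \<cdot> g i) ?F"
      by (rule arg_cong[OF ext[OF g F(1) subset_insertI F(2)]])
    also have "\<dots> = finprod (hom_group T C (X j)) (\<lambda>i. p j \<cdot> (\<iota> i \<cdot> g i)) ?F"
      using igH[OF g] F(2) by (intro Comp_finprod_right[OF p(1)[OF j] C _ F(1)]) auto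
    also have "\<dots> = finprod (hom_group T C (X j))
        (\<lambda>i. if j = i then g j else \<one>\<^bsub>hom_group T C (X j)\<^esub>) ?F"
    proof (rule J.finprod_cong')
      show "?F = ?F" ..
      show "(\<lambda>i. if j = i then g j else \<one>\<^bsub>hom_group T C (X j)\<^esub>) \<in> ?F \<rightarrow> carrier (hom_group T C (X j))"
        using gH[OF g j] J.one_closed by auto
      show "p j \<cdot> (\<iota> i \<cdot> g i) = (if j = i then g j else \<one>\<^bsub>hom_group T C (X j)\<^esub>)" if "i \<in> ?F" for i
      proof -
        have i: "i \<in> I" using that F(2) by blast
        show ?thesis
          using Comp_assoc[OF gH[OF g i] coproductD(3)[OF i] p(1)[OF j], symmetric] p(2)[OF i j]
            Comp_Idn_left[OF gH[OF g j]] Comp_Zero_left[OF gH[OF g i] coproductD(2)[OF j]] by auto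
      qed
    qed
    also have "\<dots> = g j" using J.finprod_singleton[of j ?F "\<lambda>_. g j"] F gH[OF g j] by simp
    finally show ?thesis .
  qed
  have inj: "inj_on ?\<Phi> (carrier ?A)"
  proof (rule inj_onI)
    fix g g' assume g: "g \<in> carrier ?A" and g': "g' \<in> carrier ?A" and eq: "?\<Phi> g = ?\<Phi> g'"
    have "g j = g' j" if "j \<in> I" for j using coeff[OF g that] coeff[OF g' that] eq by simp
    then show "g = g'" using g g' by (intro PiE_ext[of g I "\<lambda>i. Hom T C (X i)"]) (auto simp: carr)
  qed
  have "f \<in> ?\<Phi> ` carrier ?A \<longleftrightarrow>
      (\<exists>F c. finite F \<and> F \<subseteq> I \<and> cutoff I X S \<iota> F c \<and> c \<cdot> f = ZeroA T C S)" (is "_ \<longleftrightarrow> ?Q f")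
    if f: "f \<in> Hom T C S" for f
  proof
    assume "f \<in> ?\<Phi> ` carrier ?A"
    then obtain g where g: "g \<in> carrier ?A" "f = ?\<Phi> g" by blast
    obtain c where c: "cutoff I X S \<iota> (?supp g) c" using cutoff_exists by blast
    have "c \<cdot> f = ZeroA T C S"
      using finite_sum_cutoff[OF C _ _ c, of g] g gH[OF g(1)] by (auto simp: carr)
    then show "?Q f" using c g by (intro exI[of _ "?supp g"] exI[of _ c]) (auto simp: carr)
  next
    assume "?Q f"
    then obtain F c where F: "finite F" "F \<subseteq> I" and c: "cutoff I X S \<iota> F c" "c \<cdot> f = ZeroA T C S"
      by blast
    define g where "g = (\<lambda>i\<in>I. if i \<in> F then p i \<cdot> f else ZeroA T C (X i))"
    have sub: "?supp g \<subseteq> F" by (auto simp: g_def)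
    have gA: "g \<in> carrier ?A"
      using finite_subset[OF sub F(1)] Comp_Hom[OF f p(1)] Zero_Hom[OF C coproductD(2)]
      by (auto simp: carr g_def)
    have "f = finprod ?B (\<lambda>i. \<iota> i \<cdot> (p i \<cdot> f)) F"
      by (rule cutoff_finite_sum[OF F c(1) p f c(2)])
    also have "\<dots> = finprod ?B (\<lambda>i. \<iota> i \<cdot> g i) F"
    proof (rule H.finprod_cong')
      show "F = F" ..
      show "(\<lambda>i. \<iota> i \<cdot> g i) \<in> F \<rightarrow> carrier ?B" using igH[OF gA] F(2) by auto
      show "\<iota> i \<cdot> (p i \<cdot> f) = \<iota> i \<cdot> g i" if "i \<in> F" for i using that F(2) by (auto simp: g_def)
    qed
    also have "\<dots> = ?\<Phi> g" using ext[OF gA F(1) sub F(2)] by simp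
    finally show "f \<in> ?\<Phi> ` carrier ?A" using gA by blast
  qed
  moreover have "?\<Phi> ` carrier ?A \<subseteq> Hom T C S" using hom by (auto simp: hom_def)
  ultimately have "?\<Phi> ` carrier ?A = Hom T C S \<longleftrightarrow> ?R" by blast
  then show ?thesis unfolding iso_iff using hom inj by simp
qed

end

lemma compact_object_iff:
  fixes U :: "'u set"
  shows "compact_object U T C \<longleftrightarrow> C \<in> Obj T \<and>
     (\<forall>(I :: 'u set) X S \<iota>. small U I \<longrightarrow> is_coproduct T I X S \<iota> \<longrightarrow>
        (\<forall>f\<in>Hom T C S. \<exists>F c. finite F \<and> F \<subseteq> I \<and> cutoff I X S \<iota> F c \<and> c \<cdot> f = ZeroA T C S))"
  unfolding compact_object_def
  by (intro conj_cong refl iff_allI imp_cong canonical_sum_map_iso_iff)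

lemma compact_objectD:
  fixes U :: "'u set" and I :: "'u set"
  assumes "compact_object U T C" "small U I" "is_coproduct T I X S \<iota>" "f \<in> Hom T C S"
  obtains F c where "finite F" "F \<subseteq> I" "cutoff I X S \<iota> F c" "c \<cdot> f = ZeroA T C S"
  using compact_object_iff[THEN iffD1, OF assms(1), THEN conjunct2, rule_format, OF assms(2-4)]
  by blast

lemma compact_object_decompose:
  fixes U :: "'u set" and I :: "'u set"
  assumes C: "compact_object U T C" and I: "small U I" and cp: "is_coproduct T I X S \<iota>"
    and f: "f \<in> Hom T C S"
  shows "\<exists>F g. finite F \<and> F \<subseteq> I \<and> (\<forall>i\<in>F. g i \<in> Hom T C (X i)) \<and>
    f = finprod (hom_group T C S) (\<lambda>i. \<iota> i \<cdot> g i) F"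
proof -
  obtain F c where F: "finite F" "F \<subseteq> I" and c: "cutoff I X S \<iota> F c" "c \<cdot> f = ZeroA T C S"
    using compact_objectD[OF C I cp f] by blast
  obtain p where p: "\<And>j. j \<in> I \<Longrightarrow> p j \<in> Hom T S (X j)"
    "\<And>i j. i \<in> I \<Longrightarrow> j \<in> I \<Longrightarrow> p j \<cdot> \<iota> i = (if i = j then Idn T (X j) else ZeroA T (X i) (X j))"
    using projections_exist[OF cp] by blast
  have "f = finprod (hom_group T C S) (\<lambda>i. \<iota> i \<cdot> (p i \<cdot> f)) F"
    by (rule cutoff_finite_sum[OF cp F c(1) p f c(2)])
  moreover have "\<forall>i\<in>F. p i \<cdot> f \<in> Hom T C (X i)" using Comp_Hom[OF f p(1)] F(2) by blast
  ultimately show ?thesis using F by (intro exI[of _ F] exI[of _ "\<lambda>i. p i \<cdot> f"]) simp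
qed

end

context triangulated_category
begin

lemma coproduct_susp:
  assumes cp: "is_coproduct T I X S \<iota>"
  shows "is_coproduct T I (\<lambda>i. susp_obj T n (X i)) (susp_obj T n S) (\<lambda>i. susp_arr T n (\<iota> i))"
  unfolding is_coproduct_def
proof (intro conjI ballI allI impI)
  note cpD = coproductD[OF cp]
  show "susp_obj T n (X i) \<in> Obj T" "susp_arr T n (\<iota> i) \<in> Hom T (susp_obj T n (X i)) (susp_obj T n S)"
    if "i \<in> I" for i
    using cpD that susp_obj_Obj susp_arr_Hom by auto
  show "susp_obj T n S \<in> Obj T" using cpD susp_obj_Obj by blast
  fix Y f assume Y: "Y \<in> Obj T" and f: "\<forall>i\<in>I. f i \<in> Hom T (susp_obj T n (X i)) Y"
  have Y': "susp_obj T (- n) Y \<in> Obj T" using Y susp_obj_Obj by blast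
  have f': "susp_arr T (- n) (f i) \<in> Hom T (X i) (susp_obj T (- n) Y)" if "i \<in> I" for i
    using susp_arr_Hom[of "f i" _ _ "- n"] f cpD(2) that by fastforce
  obtain u where u: "u \<in> Hom T S (susp_obj T (- n) Y)" "\<forall>i\<in>I. u \<cdot> \<iota> i = susp_arr T (- n) (f i)"
    using coproduct_exists[OF cp Y' f'] by blast
  show "\<exists>!u. u \<in> Hom T (susp_obj T n S) Y \<and> (\<forall>i\<in>I. u \<cdot> susp_arr T n (\<iota> i) = f i)"
  proof (rule ex1I[of _ "susp_arr T n u"])
    have "susp_arr T n u \<cdot> susp_arr T n (\<iota> i) = f i" if i: "i \<in> I" for i
      using susp_arr_Comp[OF cpD(3)[OF i] u(1), of n] u(2) f i HomD(1) by fastforce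
    then show "susp_arr T n u \<in> Hom T (susp_obj T n S) Y \<and>
        (\<forall>i\<in>I. susp_arr T n u \<cdot> susp_arr T n (\<iota> i) = f i)"
      using susp_arr_Hom[OF u(1), of n] Y by simp
  next
    fix v assume v: "v \<in> Hom T (susp_obj T n S) Y \<and> (\<forall>i\<in>I. v \<cdot> susp_arr T n (\<iota> i) = f i)"
    then have vH: "v \<in> Hom T (susp_obj T n S) Y" by blast
    have v': "susp_arr T (- n) v \<in> Hom T S (susp_obj T (- n) Y)"
      using susp_arr_Hom[OF vH, of "- n"] cpD by simp
    have "susp_arr T (- n) v \<cdot> \<iota> i = u \<cdot> \<iota> i" if i: "i \<in> I" for i
      using susp_arr_Comp[OF susp_arr_Hom[OF cpD(3)[OF i], of n] vH, of "- n"] v u(2) i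
        HomD(1)[OF cpD(3)[OF i]] by simp
    then have "susp_arr T (- n) v = u" using coproduct_eqI[OF cp v' u(1)] by blast
    then show "v = susp_arr T n u" using HomD(1)[OF vH] by auto
  qed
qed

lemma compact_object_susp:
  fixes U :: "'u set"
  assumes C: "compact_object U T C"
  shows "compact_object U T (susp_obj T k C)"
  unfolding compact_object_iff
proof (intro conjI allI impI ballI)
  have CO: "C \<in> Obj T" using C by (simp add: compact_object_def)
  then show "susp_obj T k C \<in> Obj T" using susp_obj_Obj by blast
  fix I :: "'u set" and X S \<iota> f
  assume I: "small U I" and cp: "is_coproduct T I X S \<iota>" and f: "f \<in> Hom T (susp_obj T k C) S"
  note cpD = coproductD[OF cp] and cp' = coproduct_susp[OF cp, of "- k"]
  have f': "susp_arr T (- k) f \<in> Hom T C (susp_obj T (- k) S)"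
    using susp_arr_Hom[OF f, of "- k"] CO by simp
  obtain F c' where F: "finite F" "F \<subseteq> I"
    and c': "cutoff I (\<lambda>i. susp_obj T (- k) (X i)) (susp_obj T (- k) S) (\<lambda>i. susp_arr T (- k) (\<iota> i)) F c'"
    and c'f: "c' \<cdot> susp_arr T (- k) f = ZeroA T C (susp_obj T (- k) S)"
    using compact_objectD[OF C I cp' f'] by blast
  let ?c = "susp_arr T k c'"
  have c'H: "c' \<in> Hom T (susp_obj T (- k) S) (susp_obj T (- k) S)" using c' by (simp add: cutoff_def)
  have cH: "?c \<in> Hom T S S" using susp_arr_Hom[OF c'H, of k] cpD by simp
  have "?c \<cdot> \<iota> i = (if i \<in> F then ZeroA T (X i) S else \<iota> i)" if i: "i \<in> I" for i
  proof -
    have "?c \<cdot> \<iota> i = susp_arr T k (c' \<cdot> susp_arr T (- k) (\<iota> i))"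
      using susp_arr_Comp[OF susp_arr_Hom[OF cpD(3)[OF i], of "- k"] c'H, of k]
        HomD(1)[OF cpD(3)[OF i]] by simp
    then show ?thesis
      using c' i susp_arr_Zero[of "susp_obj T (- k) (X i)" "susp_obj T (- k) S" k] cpD(1)
        cpD(2)[OF i] HomD(1)[OF cpD(3)[OF i]] susp_obj_Obj by (simp add: cutoff_def)
  qed
  then have "cutoff I X S \<iota> F ?c" using cH by (simp add: cutoff_def)
  moreover have "?c \<cdot> f = ZeroA T (susp_obj T k C) S"
    using susp_arr_Comp[OF f' c'H, of k] c'f susp_arr_Zero[OF CO susp_obj_Obj[OF cpD(1)], of k "- k"]
      HomD(1)[OF f] cpD(1) by simp
  ultimately show "\<exists>F c. finite F \<and> F \<subseteq> I \<and> cutoff I X S \<iota> F c \<and> c \<cdot> f = ZeroA T (susp_obj T k C) S"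
    using F by blast
qed

lemma compact_object_cone:
  fixes U :: "'u set"
  assumes t: "(f, g, h) \<in> Tri T"
    and cf: "compact_object U T (Dom T f)" and cg: "compact_object U T (Dom T g)"
  shows "compact_object U T (Dom T h)"
  unfolding compact_object_iff
proof (intro conjI allI impI ballI)
  note TD = TriD[OF t]
  show "Dom T h \<in> Obj T" by (rule TD(9))
  fix I :: "'u set" and X S \<iota> u
  assume I: "small U I" and cp: "is_coproduct T I X S \<iota>" and u: "u \<in> Hom T (Dom T h) S"
  have ug: "u \<cdot> g \<in> Hom T (Dom T g) S" using Comp_Hom[OF TD(2) u] .
  obtain F c where F: "finite F" "F \<subseteq> I" and c: "cutoff I X S \<iota> F c"
    and cug: "c \<cdot> (u \<cdot> g) = ZeroA T (Dom T g) S"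
    using compact_objectD[OF cg I cp ug] by blast
  have cH: "c \<in> Hom T S S" using c by (simp add: cutoff_def)
  have cu: "c \<cdot> u \<in> Hom T (Dom T h) S" using Comp_Hom[OF u cH] .
  have "(c \<cdot> u) \<cdot> g = ZeroA T (Dom T g) S" using Comp_assoc[OF TD(2) u cH] cug by simp
  then obtain v where v: "v \<in> Hom T (SuspO T (Dom T f)) S" "c \<cdot> u = v \<cdot> h"
    using Tri_exact_contravariant_last[OF t cu] by blast
  have "compact_object U T (SuspO T (Dom T f))" using compact_object_susp[OF cf, of 1] by simp
  then obtain F' c' where F': "finite F'" "F' \<subseteq> I" and c': "cutoff I X S \<iota> F' c'"
    and c'v: "c' \<cdot> v = ZeroA T (SuspO T (Dom T f)) S"
    using compact_objectD[OF _ I cp v(1)] by blast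
  have c'H: "c' \<in> Hom T S S" using c' by (simp add: cutoff_def)
  have "(c' \<cdot> c) \<cdot> u = (c' \<cdot> v) \<cdot> h"
    using Comp_assoc[OF u cH c'H] Comp_assoc[OF TD(3) v(1) c'H] v(2) by simp
  also have "\<dots> = ZeroA T (Dom T h) S"
    using c'v Comp_Zero_left[OF TD(3)] HomD[OF u] by simp
  finally show "\<exists>F c. finite F \<and> F \<subseteq> I \<and> cutoff I X S \<iota> F c \<and> c \<cdot> u = ZeroA T (Dom T h) S"
    using F F' cutoff_Comp[OF cp c c'] by (intro exI[of _ "F \<union> F'"] exI[of _ "c' \<cdot> c"]) simp
qed

end

section \<open>Localizing subcategories\<close>

context triangulated_category
begin

text \<open>Rotation reduces closure under two out of three in a triangle to closure under cones.\<close>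

lemma localizingI:
  fixes U :: "'u set"
  assumes L: "L \<subseteq> Obj T" and Z: "zero_object T Z" "Z \<in> L"
    and susp: "\<And>X k. X \<in> L \<Longrightarrow> susp_obj T k X \<in> L"
    and cone: "\<And>f g h. (f, g, h) \<in> Tri T \<Longrightarrow> Dom T f \<in> L \<Longrightarrow> Dom T g \<in> L \<Longrightarrow> Dom T h \<in> L"
    and coprod: "\<And>(I :: 'u set) X S \<iota>. small U I \<Longrightarrow> (\<And>i. i \<in> I \<Longrightarrow> X i \<in> L) \<Longrightarrow>
      is_coproduct T I X S \<iota> \<Longrightarrow> S \<in> L"
  shows "localizing U T L"
proof -
  have "Dom T f \<in> L" if t: "(f, g, h) \<in> Tri T" and gh: "Dom T g \<in> L" "Dom T h \<in> L" for f g h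
  proof -
    have "Dom T (neg T (SuspA T f)) = SuspO T (Dom T f)"
      using HomD[OF neg_Hom[OF SuspA_Hom[OF TriD(1)[OF t]]]] by auto
    then have "SuspO T (Dom T f) \<in> L" using cone[OF Tri_rotate[OF t]] gh by simp
    then have "susp_obj T (- 1) (SuspO T (Dom T f)) \<in> L" by (rule susp)
    then show ?thesis using susp_obj_inverse(2)[OF TriD(7)[OF t], of 1] by simp
  qed
  moreover have "Dom T g \<in> L" if t: "(f, g, h) \<in> Tri T" and fh: "Dom T f \<in> L" "Dom T h \<in> L" for f g h
  proof -
    have "Dom T (neg T (SuspA T f)) = SuspO T (Dom T f)" "Dom T (neg T (SuspA T g)) = SuspO T (Dom T g)"
      using HomD[OF neg_Hom[OF SuspA_Hom[OF TriD(1)[OF t]]]]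
        HomD[OF neg_Hom[OF SuspA_Hom[OF TriD(2)[OF t]]]] by auto
    moreover have "SuspO T (Dom T f) \<in> L" using susp[OF fh(1), of 1] by simp
    ultimately have "SuspO T (Dom T g) \<in> L"
      using cone[OF Tri_rotate[OF Tri_rotate[OF t]]] fh by simp
    then have "susp_obj T (- 1) (SuspO T (Dom T g)) \<in> L" by (rule susp)
    then show ?thesis using susp_obj_inverse(2)[OF TriD(8)[OF t], of 1] by simp
  qed
  ultimately show ?thesis
    unfolding localizing_def using L Z susp cone coprod by blast
qed

lemma localizing_Obj:
  fixes U :: "'u set"
  shows "localizing U T (Obj T)"
proof -
  obtain Z where "zero_object T Z" using zero_object_exists by blast
  then show ?thesis
    by (intro localizingI) (auto simp: zero_object_def susp_obj_Obj TriD is_coproduct_def)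
qed

lemma localizing_susp:
  assumes L: "localizing U T L" and X: "X \<in> L"
  shows "susp_obj T k X \<in> L"
proof -
  have step: "susp_obj T 1 Y \<in> L" "susp_obj T (- 1) Y \<in> L" if "Y \<in> L" for Y
    using L that by (auto simp: localizing_def)
  have XO: "X \<in> Obj T" using L X by (auto simp: localizing_def)
  show ?thesis
  proof (induction k rule: int_induct[where k = 0])
    case base
    then show ?case using X by simp
  next
    case (step1 i)
    then show ?case using step(1)[of "susp_obj T i X"] susp_obj_susp_obj[OF XO, of 1 i]
      by (simp add: add.commute)
  next
    case (step2 i)
    then show ?case using step(2)[of "susp_obj T i X"] susp_obj_susp_obj[OF XO, of "- 1" i] by simp
  qed
qed

lemma Loc_least: "localizing U T L \<Longrightarrow> D \<subseteq> L \<Longrightarrow> Loc U T D \<subseteq> L"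
  by (auto simp: Loc_def)

lemma generators_subset_Loc: "D \<subseteq> Loc U T D"
  by (auto simp: Loc_def)

lemma Loc_mono: "D \<subseteq> D' \<Longrightarrow> Loc U T D \<subseteq> Loc U T D'"
  by (auto simp: Loc_def)

lemma Loc_Obj: "D \<subseteq> Obj T \<Longrightarrow> Loc U T D \<subseteq> Obj T"
  by (rule Loc_least[OF localizing_Obj])

lemma Loc_susp: "X \<in> Loc U T D \<Longrightarrow> susp_obj T k X \<in> Loc U T D"
  unfolding Loc_def using localizing_susp by blast

lemma Loc_cone:
  assumes "(f, g, h) \<in> Tri T" "Dom T f \<in> Loc U T D" "Dom T g \<in> Loc U T D"
  shows "Dom T h \<in> Loc U T D"
proof -
  have "Dom T h \<in> L" if "localizing U T L" "D \<subseteq> L" for L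
    using that assms Loc_least[OF that] unfolding localizing_def by fast
  then show ?thesis by (auto simp: Loc_def)
qed

text \<open>The left orthogonal of an object in all degrees.\<close>

definition left_orthogonal :: "'o \<Rightarrow> 'o set" where
  "left_orthogonal F = {X \<in> Obj T. \<forall>n. \<forall>f\<in>Hom T X (susp_obj T n F). f = ZeroA T X (susp_obj T n F)}"

lemma left_orthogonalD:
  "X \<in> left_orthogonal F \<Longrightarrow> f \<in> Hom T X (susp_obj T n F) \<Longrightarrow> f = ZeroA T X (susp_obj T n F)"
  by (simp add: left_orthogonal_def)

lemma localizing_left_orthogonal:
  fixes U :: "'u set"
  assumes F: "F \<in> Obj T"
  shows "localizing U T (left_orthogonal F)"
proof -
  have FO: "susp_obj T n F \<in> Obj T" for n using susp_obj_Obj[OF F] .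
  obtain Z where Z: "zero_object T Z" using zero_object_exists by blast
  have susp: "susp_obj T k X \<in> left_orthogonal F" if X: "X \<in> left_orthogonal F" for X k
  proof -
    have XO: "X \<in> Obj T" using X by (simp add: left_orthogonal_def)
    have "f = ZeroA T (susp_obj T k X) (susp_obj T n F)"
      if f: "f \<in> Hom T (susp_obj T k X) (susp_obj T n F)" for f n
    proof -
      have e: "susp_obj T k (susp_obj T (n - k) F) = susp_obj T n F"
        using F by (simp add: susp_obj_susp_obj)
      obtain g where g: "g \<in> Hom T X (susp_obj T (n - k) F)" "f = susp_arr T k g"
        using susp_arr_obtain[of f k X "susp_obj T (n - k) F"] f XO FO e by metis
      then have "g = ZeroA T X (susp_obj T (n - k) F)" using left_orthogonalD[OF X] by blast
      then show ?thesis using g(2) susp_arr_Zero[OF XO FO] e by metis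
    qed
    then show ?thesis using susp_obj_Obj[OF XO] by (auto simp: left_orthogonal_def)
  qed
  show ?thesis
  proof (rule localizingI[OF _ Z _ susp])
    show "left_orthogonal F \<subseteq> Obj T" by (auto simp: left_orthogonal_def)
    show "Z \<in> left_orthogonal F"
      using Z zero_object_Hom_from[OF Z] by (auto simp: left_orthogonal_def zero_object_def)
  next
    fix f g h assume t: "(f, g, h) \<in> Tri T"
      and X: "Dom T f \<in> left_orthogonal F" and Y: "Dom T g \<in> left_orthogonal F"
    note TD = TriD[OF t]
    have "u = ZeroA T (Dom T h) (susp_obj T n F)" if u: "u \<in> Hom T (Dom T h) (susp_obj T n F)" for u n
    proof -
      have "u \<cdot> g = ZeroA T (Dom T g) (susp_obj T n F)"
        using left_orthogonalD[OF Y Comp_Hom[OF TD(2) u]] .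
      then obtain v where v: "v \<in> Hom T (SuspO T (Dom T f)) (susp_obj T n F)" "u = v \<cdot> h"
        using Tri_exact_contravariant_last[OF t u] by blast
      have "SuspO T (Dom T f) \<in> left_orthogonal F" using susp[OF X, of 1] by simp
      then have "v = ZeroA T (SuspO T (Dom T f)) (susp_obj T n F)"
        using left_orthogonalD v(1) by blast
      then show ?thesis using v(2) Comp_Zero_left[OF TD(3) FO] by simp
    qed
    then show "Dom T h \<in> left_orthogonal F" using TD by (auto simp: left_orthogonal_def)
  next
    fix I :: "'u set" and X S \<iota>
    assume X: "\<And>i. i \<in> I \<Longrightarrow> X i \<in> left_orthogonal F" and cp: "is_coproduct T I X S \<iota>"
    note cpD = coproductD[OF cp]
    have "u = ZeroA T S (susp_obj T n F)" if u: "u \<in> Hom T S (susp_obj T n F)" for u n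
    proof (rule coproduct_eqI[OF cp u Zero_Hom[OF cpD(1) FO]])
      fix i assume i: "i \<in> I"
      show "u \<cdot> \<iota> i = ZeroA T S (susp_obj T n F) \<cdot> \<iota> i"
        using left_orthogonalD[OF X[OF i] Comp_Hom[OF cpD(3)[OF i] u]]
          Comp_Zero_left[OF cpD(3)[OF i] FO] by simp
    qed
    then show "S \<in> left_orthogonal F" using cpD by (auto simp: left_orthogonal_def)
  qed
qed

text \<open>If \<open>Hom(\<Sigma>\<^sup>k D, c)\<close> is bijective for all \<open>k\<close>, then \<open>Hom\<^sup>*(D, -)\<close> vanishes on the cone of \<open>c\<close>.\<close>

lemma cone_left_orthogonal:
  assumes t: "(c, g, h) \<in> Tri T" and D: "D \<in> Obj T"
    and bij: "\<And>k. bij_betw (\<lambda>f. c \<cdot> f) (Hom T (susp_obj T k D) (Dom T c)) (Hom T (susp_obj T k D) (Dom T g))"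
  shows "D \<in> left_orthogonal (Dom T h)"
proof -
  note TD = TriD[OF t]
  have DO: "susp_obj T k D \<in> Obj T" for k using susp_obj_Obj[OF D] .
  have base: "u = ZeroA T (susp_obj T k D) (Dom T h)" if u: "u \<in> Hom T (susp_obj T k D) (Dom T h)" for u k
  proof -
    let ?D = "susp_obj T k D" and ?D' = "susp_obj T (k - 1) D"
    have D': "SuspO T ?D' = ?D" using SuspO_susp_obj[OF D] by simp
    have hu: "h \<cdot> u \<in> Hom T ?D (SuspO T (Dom T c))" using Comp_Hom[OF u TD(3)] .
    then obtain w where w: "w \<in> Hom T ?D' (Dom T c)" "h \<cdot> u = SuspA T w"
      using susp_arr_obtain[of "h \<cdot> u" 1 ?D' "Dom T c"] DO TD D' by auto
    have "SuspA T (c \<cdot> w) = SuspA T c \<cdot> (h \<cdot> u)" using SuspA_Comp[OF w(1) TD(1)] w(2) by simp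
    also have "\<dots> = ZeroA T (Dom T h) (SuspO T (Dom T g)) \<cdot> u"
      using Comp_assoc[OF u TD(3) SuspA_Hom[OF TD(1)]] Tri_Comp_zero_last[OF t] by simp
    also have "\<dots> = ZeroA T ?D (SuspO T (Dom T g))"
      using Comp_Zero_left[OF u] susp_obj_Obj[OF TD(8), of 1] by simp
    finally have "c \<cdot> w = ZeroA T ?D' (Dom T g)"
      using susp_arr_eq_Zero_iff[OF Comp_Hom[OF w(1) TD(1)], of 1] D' by simp
    also have "\<dots> = c \<cdot> ZeroA T ?D' (Dom T c)" using Comp_Zero_right[OF TD(1) DO] by simp
    finally have "w = ZeroA T ?D' (Dom T c)"
      using bij[of "k - 1"] w(1) Zero_Hom[OF DO TD(7)] by (auto simp: bij_betw_def inj_on_def)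
    then have "h \<cdot> u = ZeroA T ?D (SuspO T (Dom T c))"
      using w(2) susp_arr_Zero[OF DO TD(7), of 1] D' by simp
    then obtain v where v: "v \<in> Hom T ?D (Dom T g)" "u = g \<cdot> v"
      using graded_exact_covariant_second[OF t, of u ?D 0] u by auto
    obtain v' where v': "v' \<in> Hom T ?D (Dom T c)" "v = c \<cdot> v'"
      using bij[of k] v(1) by (auto simp: bij_betw_def)
    have "u = (g \<cdot> c) \<cdot> v'" using v v' Comp_assoc[OF v'(1) TD(1,2)] by simp
    then show ?thesis using Tri_Comp_zero[OF t] Comp_Zero_left[OF v'(1) TD(9)] by simp
  qed
  have "f = ZeroA T D (susp_obj T n (Dom T h))" if f: "f \<in> Hom T D (susp_obj T n (Dom T h))" for f n
  proof -
    have "susp_obj T n (susp_obj T (- n) D) = D" using D by simp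
    then obtain g' where g': "g' \<in> Hom T (susp_obj T (- n) D) (Dom T h)" "f = susp_arr T n g'"
      using susp_arr_obtain[of f n "susp_obj T (- n) D" "Dom T h"] f DO TD by auto
    then show ?thesis using base[OF g'(1)] susp_arr_Zero[OF DO TD(9), of n "- n"] D by simp
  qed
  then show ?thesis using D by (auto simp: left_orthogonal_def)
qed

end

section \<open>Torsion objects\<close>

context linear_triangulated_category
begin

lemma power_mono:
  assumes C: "C \<in> Obj T" and X: "X \<in> Obj T" and x: "x \<in> G d" and f: "f \<in> Hom T C (susp_obj T n X)"
    and z: "susp_arr T n (\<phi> (int k * d) (x [^]\<^bsub>R\<^esub> k) X) \<cdot>\<^bsub>T\<^esub> f = ZeroA T C (susp_obj T (int k * d + n) X)"
    and kl: "k \<le> l"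
  shows "susp_arr T n (\<phi> (int l * d) (x [^]\<^bsub>R\<^esub> l) X) \<cdot>\<^bsub>T\<^esub> f = ZeroA T C (susp_obj T (int l * d + n) X)"
proof -
  interpret N: graded_module_over R G "H C X" by (rule hom_module_graded_module[OF C X])
  have deg: "int (l - k) * d + int k * d = int l * d" using kl by (simp add: algebra_simps of_nat_diff)
  have pow: "x [^]\<^bsub>R\<^esub> (l - k) \<otimes>\<^bsub>R\<^esub> x [^]\<^bsub>R\<^esub> k = x [^]\<^bsub>R\<^esub> l"
    using nat_pow_mult[OF G_carrier[OF x], of "l - k" k] kl by simp
  have fc: "f \<in> carrier (comp (H C X) n)" using f by simp
  have "act (H C X) (int l * d) n (x [^]\<^bsub>R\<^esub> l) f =
      act (H C X) (int (l - k) * d) (int k * d + n) (x [^]\<^bsub>R\<^esub> (l - k))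
        (act (H C X) (int k * d) n (x [^]\<^bsub>R\<^esub> k) f)"
    using N.act_mult[OF G_pow[OF x] G_pow[OF x] fc, of "l - k" k] unfolding deg pow .
  also have "\<dots> = \<one>\<^bsub>comp (H C X) (int (l - k) * d + (int k * d + n))\<^esub>"
    using N.act_zero[OF G_pow[OF x, of "l - k"], of "int k * d + n"] z by simp
  also have "int (l - k) * d + (int k * d + n) = int l * d + n" using deg by simp
  finally show ?thesis by simp
qed

text \<open>Compactness of \<open>C\<close> enters through coproducts: a morphism from \<open>C\<close> to a coproduct is a finite sum of
  morphisms to the summands, so a common power of \<open>x\<close> annihilates it.\<close>

lemma localizing_power_torsion:
  fixes U :: "'u set"
  assumes C: "compact_object U T C" and x: "x \<in> G d"
  shows "localizing U T {X \<in> Obj T. power_torsion C X d x}"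
proof -
  have CO: "C \<in> Obj T" using C by (simp add: compact_object_def)
  obtain Z where Z: "zero_object T Z" using zero_object_exists by blast
  have ZO: "Z \<in> Obj T" using Z by (simp add: zero_object_def)
  show ?thesis
  proof (rule localizingI[OF _ Z])
    show "{X \<in> Obj T. power_torsion C X d x} \<subseteq> Obj T" by blast
    have "susp_arr T n (\<phi> (int 0 * d) (x [^]\<^bsub>R\<^esub> (0::nat)) Z) \<cdot>\<^bsub>T\<^esub> f = ZeroA T C (susp_obj T (int 0 * d + n) Z)"
      if f: "f \<in> Hom T C (susp_obj T n Z)" for f n
      using zero_object_Hom_to[OF zero_object_susp[OF Z] f] \<phi>_one[OF ZO] susp_arr_Idn[OF ZO]
        Comp_Idn_left[OF f] by simp
    then have "power_torsion C Z d x" unfolding power_torsion_def by blast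
    then show "Z \<in> {X \<in> Obj T. power_torsion C X d x}" using ZO by simp
  next
    fix X k assume "X \<in> {X \<in> Obj T. power_torsion C X d x}"
    then have X: "X \<in> Obj T" and tors: "power_torsion C X d x" by auto
    have "\<exists>l::nat. susp_arr T n (\<phi> (int l * d) (x [^]\<^bsub>R\<^esub> l) (susp_obj T k X)) \<cdot>\<^bsub>T\<^esub> f =
        ZeroA T C (susp_obj T (int l * d + n) (susp_obj T k X))"
      if "f \<in> Hom T C (susp_obj T n (susp_obj T k X))" for f n
    proof -
      have f: "f \<in> Hom T C (susp_obj T (n + k) X)" using that X by (simp add: susp_obj_susp_obj)
      obtain l :: nat where l: "susp_arr T (n + k) (\<phi> (int l * d) (x [^]\<^bsub>R\<^esub> l) X) \<cdot>\<^bsub>T\<^esub> f =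
          ZeroA T C (susp_obj T (int l * d + (n + k)) X)"
        using tors f by (auto simp: power_torsion_def)
      have "susp_arr T n (\<phi> (int l * d) (x [^]\<^bsub>R\<^esub> l) (susp_obj T k X)) \<cdot>\<^bsub>T\<^esub> f =
          ZeroA T C (susp_obj T (int l * d + (n + k)) X)"
        using act_susp_obj[OF G_pow[OF x] X f, of l] l
          signed_eq_Zero_iff[OF Zero_Hom[OF CO susp_obj_Obj[OF X]]] by simp
      then show ?thesis using X by (auto simp: susp_obj_susp_obj add.assoc)
    qed
    then show "susp_obj T k X \<in> {X \<in> Obj T. power_torsion C X d x}"
      using susp_obj_Obj[OF X] by (simp add: power_torsion_def)
  next
    fix f g h assume t: "(f, g, h) \<in> Tri T" and f: "Dom T f \<in> {X \<in> Obj T. power_torsion C X d x}"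
      and g: "Dom T g \<in> {X \<in> Obj T. power_torsion C X d x}"
    note TD = TriD[OF t]
    let ?X = "Dom T f" and ?Y = "Dom T g" and ?Z = "Dom T h"
    have tX: "power_torsion C ?X d x" and tY: "power_torsion C ?Y d x"
      using f g by auto
    have "\<exists>k::nat. susp_arr T n (\<phi> (int k * d) (x [^]\<^bsub>R\<^esub> k) ?Z) \<cdot>\<^bsub>T\<^esub> u =
        ZeroA T C (susp_obj T (int k * d + n) ?Z)"
      if u: "u \<in> Hom T C (susp_obj T n ?Z)" for u n
    proof -
      have SX: "susp_obj T m (SuspO T ?X) = susp_obj T (m + 1) ?X" for m
        using TD susp_obj_SuspO by simp
      have SXO: "SuspO T ?X \<in> Obj T" using susp_obj_Obj[OF TD(7), of 1] by simp
      have hu: "susp_arr T n h \<cdot>\<^bsub>T\<^esub> u \<in> Hom T C (susp_obj T (n + 1) ?X)"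
        using Comp_Hom[OF u susp_arr_Hom[OF TD(3)]] by (simp add: SX)
      obtain k :: nat where k: "susp_arr T (n + 1) (\<phi> (int k * d) (x [^]\<^bsub>R\<^esub> k) ?X) \<cdot>\<^bsub>T\<^esub> (susp_arr T n h \<cdot>\<^bsub>T\<^esub> u) =
          ZeroA T C (susp_obj T (int k * d + (n + 1)) ?X)"
        using tX hu by (auto simp: power_torsion_def)
      note xk = G_pow[OF x, of k]
      let ?xu = "susp_arr T n (\<phi> (int k * d) (x [^]\<^bsub>R\<^esub> k) ?Z) \<cdot>\<^bsub>T\<^esub> u"
      have xu: "?xu \<in> Hom T C (susp_obj T (int k * d + n) ?Z)"
        using act_hom_module_Hom[OF CO TD(9) xk u] .
      have "susp_arr T (int k * d + n) h \<cdot>\<^bsub>T\<^esub> ?xu =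
          susp_arr T n (\<phi> (int k * d) (x [^]\<^bsub>R\<^esub> k) (SuspO T ?X)) \<cdot>\<^bsub>T\<^esub> (susp_arr T n h \<cdot>\<^bsub>T\<^esub> u)"
        using postcompose_act[OF xk TD(3) u] .
      also have "\<dots> = ZeroA T C (susp_obj T (int k * d + (n + 1)) ?X)"
        using act_susp_obj[OF xk TD(7) hu] k
          signed_eq_Zero_iff[OF Zero_Hom[OF CO susp_obj_Obj[OF TD(7)]]] by simp
      finally obtain v where v: "v \<in> Hom T C (susp_obj T (int k * d + n) ?Y)"
        "?xu = susp_arr T (int k * d + n) g \<cdot>\<^bsub>T\<^esub> v"
        using graded_exact_covariant_second[OF t xu] by (auto simp: SX add.assoc)
      obtain l :: nat where l: "susp_arr T (int k * d + n) (\<phi> (int l * d) (x [^]\<^bsub>R\<^esub> l) ?Y) \<cdot>\<^bsub>T\<^esub> v =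
          ZeroA T C (susp_obj T (int l * d + (int k * d + n)) ?Y)"
        using tY v(1) by (auto simp: power_torsion_def)
      interpret N: graded_module_over R G "H C ?Z"
        by (rule hom_module_graded_module[OF CO TD(9)])
      have "susp_arr T n (\<phi> (int l * d + int k * d) (x [^]\<^bsub>R\<^esub> l \<otimes>\<^bsub>R\<^esub> x [^]\<^bsub>R\<^esub> k) ?Z) \<cdot>\<^bsub>T\<^esub> u =
          susp_arr T (int k * d + n) (\<phi> (int l * d) (x [^]\<^bsub>R\<^esub> l) ?Z) \<cdot>\<^bsub>T\<^esub> ?xu"
        using N.act_mult[OF G_pow[OF x, of l] xk, of u n] u by simp
      also have "\<dots> = susp_arr T (int l * d + (int k * d + n)) g \<cdot>\<^bsub>T\<^esub>
          (susp_arr T (int k * d + n) (\<phi> (int l * d) (x [^]\<^bsub>R\<^esub> l) ?Y) \<cdot>\<^bsub>T\<^esub> v)"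
        using postcompose_act[OF G_pow[OF x, of l] TD(2) v(1)] v(2) by simp
      also have "\<dots> = ZeroA T C (susp_obj T (int l * d + (int k * d + n)) ?Z)"
        using l Comp_Zero_right[OF susp_arr_Hom[OF TD(2)] CO] by simp
      finally show ?thesis
        using nat_pow_mult[OF G_carrier[OF x], of l k]
        by (intro exI[of _ "l + k"]) (simp add: algebra_simps)
    qed
    then show "?Z \<in> {X \<in> Obj T. power_torsion C X d x}" using TD by (simp add: power_torsion_def)
  next
    fix I :: "'u set" and X S \<iota>
    assume I: "small U I" and "\<And>i. i \<in> I \<Longrightarrow> X i \<in> {X \<in> Obj T. power_torsion C X d x}"
      and cp: "is_coproduct T I X S \<iota>"
    then have tors: "power_torsion C (X i) d x" if "i \<in> I" for i using that by blast
    note cpD = coproductD[OF cp]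
    have "\<exists>k::nat. susp_arr T n (\<phi> (int k * d) (x [^]\<^bsub>R\<^esub> k) S) \<cdot>\<^bsub>T\<^esub> f =
        ZeroA T C (susp_obj T (int k * d + n) S)"
      if f: "f \<in> Hom T C (susp_obj T n S)" for f n
    proof -
      obtain F g where F: "finite F" "F \<subseteq> I" and g: "\<forall>i\<in>F. g i \<in> Hom T C (susp_obj T n (X i))"
        and feq: "f = finprod (hom_group T C (susp_obj T n S)) (\<lambda>i. susp_arr T n (\<iota> i) \<cdot>\<^bsub>T\<^esub> g i) F"
        using compact_object_decompose[OF C I coproduct_susp[OF cp] f] by blast
      have "\<forall>i\<in>F. \<exists>k::nat. susp_arr T n (\<phi> (int k * d) (x [^]\<^bsub>R\<^esub> k) (X i)) \<cdot>\<^bsub>T\<^esub> g i =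
          ZeroA T C (susp_obj T (int k * d + n) (X i))"
        using tors F(2) g unfolding power_torsion_def by blast
      then obtain k :: "_ \<Rightarrow> nat" where k: "\<And>i. i \<in> F \<Longrightarrow>
          susp_arr T n (\<phi> (int (k i) * d) (x [^]\<^bsub>R\<^esub> k i) (X i)) \<cdot>\<^bsub>T\<^esub> g i =
          ZeroA T C (susp_obj T (int (k i) * d + n) (X i))"
        by metis
      define l where "l = sum k F"
      have kl: "k i \<le> l" if "i \<in> F" for i unfolding l_def using F(1) that by (intro member_le_sum) auto
      note xl = G_pow[OF x, of l]
      let ?x = "susp_arr T n (\<phi> (int l * d) (x [^]\<^bsub>R\<^esub> l) S)"
      have tgt: "susp_obj T n (susp_obj T (int l * d) S) = susp_obj T (int l * d + n) S"
        using cpD(1) by (simp add: susp_obj_susp_obj add.commute)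
      have xH: "?x \<in> Hom T (susp_obj T n S) (susp_obj T (int l * d + n) S)"
        using susp_arr_Hom[OF \<phi>_Hom[OF xl cpD(1)], of n] by (simp add: tgt)
      have ig: "susp_arr T n (\<iota> i) \<cdot>\<^bsub>T\<^esub> g i \<in> Hom T C (susp_obj T n S)" if "i \<in> F" for i
        using Comp_Hom[OF _ susp_arr_Hom[OF cpD(3)]] g F(2) that by blast
      have val: "?x \<cdot>\<^bsub>T\<^esub> (susp_arr T n (\<iota> i) \<cdot>\<^bsub>T\<^esub> g i) = ZeroA T C (susp_obj T (int l * d + n) S)"
        if i: "i \<in> F" for i
      proof -
        have iI: "i \<in> I" using F(2) i by blast
        have gi: "g i \<in> Hom T C (susp_obj T n (X i))" using g i by blast
        have "?x \<cdot>\<^bsub>T\<^esub> (susp_arr T n (\<iota> i) \<cdot>\<^bsub>T\<^esub> g i) = susp_arr T (int l * d + n) (\<iota> i) \<cdot>\<^bsub>T\<^esub>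
            (susp_arr T n (\<phi> (int l * d) (x [^]\<^bsub>R\<^esub> l) (X i)) \<cdot>\<^bsub>T\<^esub> g i)"
          using postcompose_act[OF xl cpD(3)[OF iI] gi] by simp
        then show ?thesis
          using power_mono[OF CO cpD(2)[OF iI] x gi k[OF i] kl[OF i]]
            Comp_Zero_right[OF susp_arr_Hom[OF cpD(3)[OF iI]] CO] by simp
      qed
      have "?x \<cdot>\<^bsub>T\<^esub> f = finprod (hom_group T C (susp_obj T (int l * d + n) S))
          (\<lambda>i. ?x \<cdot>\<^bsub>T\<^esub> (susp_arr T n (\<iota> i) \<cdot>\<^bsub>T\<^esub> g i)) F"
        unfolding feq by (rule Comp_finprod_right[OF xH CO ig F(1)])
      also have "\<dots> = ZeroA T C (susp_obj T (int l * d + n) S)"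
        using comm_monoid.finprod_one_eqI[OF Hom_comm_monoid[OF CO susp_obj_Obj[OF cpD(1)]],
            of F "\<lambda>i. ?x \<cdot>\<^bsub>T\<^esub> (susp_arr T n (\<iota> i) \<cdot>\<^bsub>T\<^esub> g i)" "int l * d + n"] val by simp
      finally show ?thesis by blast
    qed
    then show "S \<in> {X \<in> Obj T. power_torsion C X d x}" using cpD by (simp add: power_torsion_def)
  qed
qed

text \<open>For \<open>F = E//x\<close>, the group \<open>Hom\<^sup>*(D, F)\<close> vanishes if and only if \<open>x\<close> is invertible on \<open>Hom\<^sup>*(D, E)\<close>, and
  this follows from the vanishing of \<open>Hom\<^sup>*(D//x, E)\<close>.\<close>

lemma acts_bijectively_if_orthogonal:
  assumes D: "D \<in> Obj T" and E: "E \<in> Obj T" and x: "x \<in> G d" and t: "(\<phi> d x E, q, \<delta>) \<in> Tri T"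
    and orth: "D \<in> left_orthogonal (Dom T \<delta>)"
  shows "acts_bijectively D E d x"
proof -
  note ks = koszul_triangle_simps[OF E x t]
  interpret N: graded_module_over R G "H D E" by (rule hom_module_graded_module[OF D E])
  have tgt: "susp_obj T n (susp_obj T d E) = susp_obj T (d + n) E" for n
    using E by (simp add: susp_obj_susp_obj add.commute)
  have FO: "susp_obj T n (Dom T \<delta>) \<in> Obj T" for n using susp_obj_Obj[OF ks(6)] .
  have "ghost T D \<delta>"
    unfolding ghost_iff[OF ks(5)]
    using left_orthogonalD[OF orth] Comp_Zero_right[OF susp_arr_Hom[OF ks(5)] D] by metis
  then have inj: "injective_mod (H D E) (zero_sub (H D E)) d x"
    using ghost_koszul_iff[OF D E x t] by blast
  have "bij_betw (\<lambda>f. susp_arr T n (\<phi> d x E) \<cdot>\<^bsub>T\<^esub> f) (Hom T D (susp_obj T n E)) (Hom T D (susp_obj T (d + n) E))" for n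
    unfolding bij_betw_def
  proof
    show "inj_on (\<lambda>f. susp_arr T n (\<phi> d x E) \<cdot>\<^bsub>T\<^esub> f) (Hom T D (susp_obj T n E))"
      using group_hom.inj_on_one_iff[OF N.act_group_hom[OF x, of n]] inj
      by (auto simp: injective_mod_def zero_sub_def)
    show "(\<lambda>f. susp_arr T n (\<phi> d x E) \<cdot>\<^bsub>T\<^esub> f) ` Hom T D (susp_obj T n E) = Hom T D (susp_obj T (d + n) E)"
    proof (intro equalityI subsetI)
      fix u assume u: "u \<in> Hom T D (susp_obj T (d + n) E)"
      then have u': "u \<in> Hom T D (susp_obj T n (Dom T q))" by (simp add: ks tgt)
      have "susp_arr T n q \<cdot>\<^bsub>T\<^esub> u = ZeroA T D (susp_obj T n (Dom T \<delta>))"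
        using left_orthogonalD[OF orth] Comp_Hom[OF u' susp_arr_Hom] ks(2,4) by simp
      then obtain v where "v \<in> Hom T D (susp_obj T n E)" "u = susp_arr T n (\<phi> d x E) \<cdot>\<^bsub>T\<^esub> v"
        using graded_exact_covariant[OF t u'] by (auto simp: ks)
      then show "u \<in> (\<lambda>f. susp_arr T n (\<phi> d x E) \<cdot>\<^bsub>T\<^esub> f) ` Hom T D (susp_obj T n E)" by blast
    qed (use act_hom_module_Hom[OF D E x] in auto)
  qed
  then show ?thesis by (simp add: acts_bijectively_def)
qed

lemma orthogonal_if_acts_bijectively:
  assumes D: "D \<in> Obj T" and E: "E \<in> Obj T" and x: "x \<in> G d" and t: "(\<phi> d x E, q, \<delta>) \<in> Tri T"
    and bij: "acts_bijectively D E d x"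
  shows "D \<in> left_orthogonal (Dom T \<delta>)"
proof -
  note ks = koszul_triangle_simps[OF E x t]
  interpret N: graded_module_over R G "H D E" by (rule hom_module_graded_module[OF D E])
  have tgt: "susp_obj T n (susp_obj T d E) = susp_obj T (d + n) E" for n
    using E by (simp add: susp_obj_susp_obj add.commute)
  have inj: "injective_mod (H D E) (zero_sub (H D E)) d x"
    unfolding injective_mod_def zero_sub_def
  proof (intro allI ballI impI)
    fix n m assume m: "m \<in> carrier (comp (H D E) n)"
      and "act (H D E) d n x m \<in> {\<one>\<^bsub>comp (H D E) (d + n)\<^esub>}"
    then have "act (H D E) d n x m = act (H D E) d n x \<one>\<^bsub>comp (H D E) n\<^esub>"
      using N.act_zero[OF x] by simp
    moreover have "inj_on (act (H D E) d n x) (carrier (comp (H D E) n))"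
      using bij by (simp add: acts_bijectively_def bij_betw_def)
    ultimately show "m \<in> {\<one>\<^bsub>comp (H D E) n\<^esub>}"
      using inj_onD[OF _ _ m N.N.one_closed] by (metis singletonI)
  qed
  have gh: "ghost T D \<delta>" using ghost_koszul_iff[OF D E x t] inj by blast
  have "u = ZeroA T D (susp_obj T n (Dom T \<delta>))" if u: "u \<in> Hom T D (susp_obj T n (Dom T \<delta>))" for u n
  proof -
    have "susp_arr T n \<delta> \<cdot>\<^bsub>T\<^esub> u = ZeroA T D (susp_obj T n (SuspO T E))"
      using gh u ghost_iff[OF ks(5)] by blast
    then obtain v where v: "v \<in> Hom T D (susp_obj T (d + n) E)" "u = susp_arr T n q \<cdot>\<^bsub>T\<^esub> v"
      using graded_exact_covariant_second[OF t u] by (auto simp: ks tgt)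
    then obtain v' where v': "v' \<in> Hom T D (susp_obj T n E)" "v = susp_arr T n (\<phi> d x E) \<cdot>\<^bsub>T\<^esub> v'"
      using bij by (auto simp: acts_bijectively_def bij_betw_def)
    show ?thesis
      using graded_Comp_zero[OF \<phi>_Hom[OF x E] ks(4) _ v'(1)] Tri_Comp_zero[OF t] v v'
      by (simp add: ks)
  qed
  then show ?thesis using D by (auto simp: left_orthogonal_def)
qed

lemma acts_bijectively_if_koszul_orthogonal:
  assumes D: "D \<in> Obj T" and E: "E \<in> Obj T" and x: "x \<in> G d" and t: "(\<phi> d x D, q, \<delta>) \<in> Tri T"
    and orth: "Dom T \<delta> \<in> left_orthogonal E"
  shows "acts_bijectively D E d x"
proof -
  note ks = koszul_triangle_simps[OF D x t]
  interpret N: graded_module_over R G "H D E" by (rule hom_module_graded_module[OF D E])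
  have EO: "susp_obj T n E \<in> Obj T" for n using susp_obj_Obj[OF E] .
  have DO: "susp_obj T n D \<in> Obj T" for n using susp_obj_Obj[OF D] .
  have tgt: "susp_obj T d (susp_obj T n E) = susp_obj T (d + n) E" for n
    using E by (simp add: susp_obj_susp_obj)
  \<comment> \<open>The action on \<open>Hom\<^sup>*(D, E)\<close> is, up to sign, precomposition with the action on \<open>D\<close>.\<close>
  have act: "susp_arr T n (\<phi> d x E) \<cdot>\<^bsub>T\<^esub> f = signed T (n * d) (susp_arr T d f \<cdot>\<^bsub>T\<^esub> \<phi> d x D)"
    if f: "f \<in> Hom T D (susp_obj T n E)" for f n
  proof -
    note h = susp_arr_Hom[OF \<phi>_Hom[OF x E], of n]
    have sf: "susp_arr T d f \<cdot>\<^bsub>T\<^esub> \<phi> d x D = \<phi> d x (susp_obj T n E) \<cdot>\<^bsub>T\<^esub> f" using \<phi>_natural[OF x f] by simp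
    have "\<phi> d x (susp_obj T n E) \<cdot>\<^bsub>T\<^esub> f = signed T (n * d) (susp_arr T n (\<phi> d x E) \<cdot>\<^bsub>T\<^esub> f)"
      using \<phi>_susp_obj[OF x E] Comp_signed_left[OF f h] by simp
    then show ?thesis using sf signed_twice[OF Comp_Hom[OF f h]] by simp
  qed
  have "bij_betw (\<lambda>f. susp_arr T n (\<phi> d x E) \<cdot>\<^bsub>T\<^esub> f) (Hom T D (susp_obj T n E)) (Hom T D (susp_obj T (d + n) E))" for n
    unfolding bij_betw_def
  proof
    have "f = ZeroA T D (susp_obj T n E)" if f: "f \<in> Hom T D (susp_obj T n E)"
      and z: "susp_arr T n (\<phi> d x E) \<cdot>\<^bsub>T\<^esub> f = ZeroA T D (susp_obj T (d + n) E)" for f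
    proof -
      have sf: "susp_arr T d f \<in> Hom T (susp_obj T d D) (susp_obj T (d + n) E)"
        using susp_arr_Hom[OF f, of d] by (simp add: tgt)
      have "susp_arr T d f \<cdot>\<^bsub>T\<^esub> \<phi> d x D = ZeroA T D (susp_obj T (d + n) E)"
        using z act[OF f] signed_eq_Zero_iff[OF Comp_Hom[OF \<phi>_Hom[OF x D] sf]] by simp
      then obtain v where v: "v \<in> Hom T (Dom T \<delta>) (susp_obj T (d + n) E)" "susp_arr T d f = v \<cdot>\<^bsub>T\<^esub> q"
        using Tri_exact_contravariant[OF t, of "susp_arr T d f"] sf by (auto simp: ks)
      then have "susp_arr T d f = ZeroA T (susp_obj T d D) (susp_obj T (d + n) E)"
        using left_orthogonalD[OF orth v(1)] Comp_Zero_left[OF ks(4) EO] by simp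
      then show ?thesis using susp_arr_eq_Zero_iff[OF f, of d] by (simp add: tgt)
    qed
    then show "inj_on (\<lambda>f. susp_arr T n (\<phi> d x E) \<cdot>\<^bsub>T\<^esub> f) (Hom T D (susp_obj T n E))"
      using group_hom.inj_on_one_iff[OF N.act_group_hom[OF x, of n]] by simp
    show "(\<lambda>f. susp_arr T n (\<phi> d x E) \<cdot>\<^bsub>T\<^esub> f) ` Hom T D (susp_obj T n E) = Hom T D (susp_obj T (d + n) E)"
    proof (intro equalityI subsetI)
      fix u assume u: "u \<in> Hom T D (susp_obj T (d + n) E)"
      let ?W = "SuspO T (susp_obj T (d + n) E)"
      have W: "?W = susp_obj T (d + n + 1) E" using SuspO_susp_obj[OF E] by simp
      have Su: "SuspA T u \<in> Hom T (SuspO T D) ?W" using SuspA_Hom[OF u] .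
      have Sf: "SuspA T (\<phi> d x D) \<in> Hom T (SuspO T D) (SuspO T (susp_obj T d D))"
        using SuspA_Hom[OF \<phi>_Hom[OF x D]] .
      have "SuspA T u \<cdot>\<^bsub>T\<^esub> \<delta> = ZeroA T (Dom T \<delta>) ?W"
        using left_orthogonalD[OF orth] Comp_Hom[OF ks(5) Su] W by metis
      moreover have "Dom T (neg T (SuspA T (\<phi> d x D))) = SuspO T D"
        using HomD[OF neg_Hom[OF Sf]] by simp
      ultimately obtain v where v: "v \<in> Hom T (SuspO T (susp_obj T d D)) ?W"
        "SuspA T u = v \<cdot>\<^bsub>T\<^esub> neg T (SuspA T (\<phi> d x D))"
        using Tri_exact_contravariant_last[OF Tri_rotate[OF t], of "SuspA T u" ?W] Su
        by (auto simp: ks)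
      obtain w where w: "w \<in> Hom T (susp_obj T d D) (susp_obj T (d + n) E)" "neg T v = SuspA T w"
        using susp_arr_obtain[of "neg T v" 1 "susp_obj T d D" "susp_obj T (d + n) E"]
          neg_Hom[OF v(1)] DO EO by auto
      have "SuspA T u = neg T v \<cdot>\<^bsub>T\<^esub> SuspA T (\<phi> d x D)"
        using v(2) Comp_neg_right[OF Sf v(1)] Comp_neg_left[OF Sf v(1)] by simp
      also have "\<dots> = SuspA T (w \<cdot>\<^bsub>T\<^esub> \<phi> d x D)"
        using w(2) SuspA_Comp[OF \<phi>_Hom[OF x D] w(1)] by simp
      finally have ueq: "u = w \<cdot>\<^bsub>T\<^esub> \<phi> d x D"
        using SuspA_inject HomD(1)[OF u] HomD(1)[OF Comp_Hom[OF \<phi>_Hom[OF x D] w(1)]] by blast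
      obtain f where f: "f \<in> Hom T D (susp_obj T n E)" "w = susp_arr T d f"
        using susp_arr_obtain[of w d D "susp_obj T n E"] w(1) D EO by (auto simp: tgt)
      let ?f = "signed T (n * d) f"
      have "susp_arr T n (\<phi> d x E) \<cdot>\<^bsub>T\<^esub> ?f = signed T (n * d) (susp_arr T n (\<phi> d x E) \<cdot>\<^bsub>T\<^esub> f)"
        using signed_act[OF x E f(1)] by simp
      also have "\<dots> = u"
        using act[OF f(1)] f(2) ueq signed_twice[OF u] by simp
      finally show "u \<in> (\<lambda>f. susp_arr T n (\<phi> d x E) \<cdot>\<^bsub>T\<^esub> f) ` Hom T D (susp_obj T n E)"
        using signed_Hom[OF f(1)] by (metis image_eqI)
    qed (use act_hom_module_Hom[OF D E x] in auto)
  qed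
  then show ?thesis by (simp add: acts_bijectively_def)
qed

end

section \<open>Compact objects with prescribed support\<close>

text \<open>The generators of the torsion subcategory of a specialization closed set.\<close>

definition torsion_compacts ::
    "'u set \<Rightarrow> ('r, 'y) ring_scheme \<Rightarrow> (int \<Rightarrow> 'r set) \<Rightarrow> ('o, 'm, 'z) triangulated_category_scheme \<Rightarrow>
      (int \<Rightarrow> 'r \<Rightarrow> 'o \<Rightarrow> 'm) \<Rightarrow> 'r set set \<Rightarrow> 'o set" where
  "torsion_compacts U R G T \<phi> V = {D. compact_object U T D \<and>
     (\<forall>\<pp> \<in> Spec R G - V. localization_vanishes R G \<pp> (hom_module T \<phi> D D))}"

lemma torsion_subcategory_eq: "torsion_subcategory U R G T \<phi> V = Loc U T (torsion_compacts U R G T \<phi> V)"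
  by (simp add: torsion_subcategory_def torsion_compacts_def)

lemma torsion_compacts_mono:
  "V \<subseteq> W \<Longrightarrow> torsion_compacts U R G T \<phi> V \<subseteq> torsion_compacts U R G T \<phi> W"
  by (auto simp: torsion_compacts_def)

context linear_triangulated_category
begin

lemma SpecD:
  assumes "\<pp> \<in> Spec R G"
  shows "ideal \<pp> R" "\<one>\<^bsub>R\<^esub> \<notin> \<pp>"
    "x \<in> G m \<Longrightarrow> y \<in> G n \<Longrightarrow> x \<otimes>\<^bsub>R\<^esub> y \<in> \<pp> \<Longrightarrow> x \<in> \<pp> \<or> y \<in> \<pp>"
proof -
  show I: "ideal \<pp> R" using assms by (auto simp: Spec_def homogeneous_ideal_def)
  show "\<one>\<^bsub>R\<^esub> \<notin> \<pp>" using assms ideal.one_imp_carrier[OF I] by (auto simp: Spec_def)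
  show "x \<in> G m \<Longrightarrow> y \<in> G n \<Longrightarrow> x \<otimes>\<^bsub>R\<^esub> y \<in> \<pp> \<Longrightarrow> x \<in> \<pp> \<or> y \<in> \<pp>"
    using assms by (auto simp: Spec_def)
qed

text \<open>The localisation of \<open>End\<^sup>*(D)\<close> at \<open>\<pp>\<close> vanishes if and only if some homogeneous element outside \<open>\<pp>\<close>
  annihilates \<open>D\<close>; the identity of \<open>D\<close> is the only endomorphism to be tested.\<close>

lemma localization_vanishes_imp_annihilator:
  assumes p: "\<pp> \<in> Spec R G" and D: "D \<in> Obj T"
    and van: "localization_vanishes R G \<pp> (H D D)"
  shows "\<exists>b. \<exists>u\<in>G b. u \<notin> \<pp> \<and> \<phi> b u D = ZeroA T D (susp_obj T b D)"
proof -
  let ?N = "H D D"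
  interpret N: graded_module_over R G ?N by (rule hom_module_graded_module[OF D D])
  have id: "Idn T D \<in> carrier (comp ?N (0 + 0))" using Idn_Hom[OF D] by simp
  have fr: "(0, \<one>\<^bsub>R\<^esub>, Idn T D) \<in> fractions G \<pp> ?N 0"
    using id one_degree SpecD(2)[OF p] by (simp add: fractions_def)
  have "\<one>\<^bsub>R\<^esub> \<otimes>\<^bsub>R\<^esub> \<one>\<^bsub>R\<^esub> \<notin> \<pp>" using SpecD(2)[OF p] by simp
  then have "((0, \<one>\<^bsub>R\<^esub>, Idn T D), (0, \<one>\<^bsub>R\<^esub>, Idn T D)) \<in> fraction_rel R G \<pp> ?N 0"
    using fr one_degree unfolding fraction_rel_def by blast
  then have "(0, \<one>\<^bsub>R\<^esub>, Idn T D) \<in> fraction_rel R G \<pp> ?N 0 `` {(0, \<one>\<^bsub>R\<^esub>, Idn T D)}" by blast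
  moreover have "fraction_rel R G \<pp> ?N 0 `` {(0, \<one>\<^bsub>R\<^esub>, Idn T D)} \<in> localization R G \<pp> ?N 0"
    using fr by (simp add: localization_def quotientI)
  then have "fraction_rel R G \<pp> ?N 0 `` {(0, \<one>\<^bsub>R\<^esub>, Idn T D)} =
      fraction_rel R G \<pp> ?N 0 `` {(0, \<one>\<^bsub>R\<^esub>, \<one>\<^bsub>comp ?N 0\<^esub>)}"
    using van unfolding localization_vanishes_def by blast
  ultimately have "((0, \<one>\<^bsub>R\<^esub>, \<one>\<^bsub>comp ?N 0\<^esub>), (0, \<one>\<^bsub>R\<^esub>, Idn T D)) \<in> fraction_rel R G \<pp> ?N 0" by blast
  then obtain b b' u u' where b: "b + 0 = b' + 0" and u: "u \<in> G b" and u': "u' \<in> G b'"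
    and eq: "u \<otimes>\<^bsub>R\<^esub> \<one>\<^bsub>R\<^esub> = u' \<otimes>\<^bsub>R\<^esub> \<one>\<^bsub>R\<^esub>" and up: "u \<otimes>\<^bsub>R\<^esub> \<one>\<^bsub>R\<^esub> \<notin> \<pp>"
    and act: "act ?N b (0 + 0) u \<one>\<^bsub>comp ?N 0\<^esub> = act ?N b' (0 + 0) u' (Idn T D)"
    unfolding fraction_rel_def by blast
  have uu: "u' = u" "b' = b" using eq b G_carrier[OF u] G_carrier[OF u'] by auto
  have "\<phi> b u D \<cdot>\<^bsub>T\<^esub> Idn T D = ZeroA T D (susp_obj T b D)"
    using act N.act_zero[OF u, of 0] by (simp add: uu)
  then have "\<phi> b u D = ZeroA T D (susp_obj T b D)"
    using Comp_Idn_right[OF \<phi>_Hom[OF u D]] by simp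
  moreover have "u \<notin> \<pp>" using up G_carrier[OF u] by simp
  ultimately show ?thesis using u by blast
qed

lemma annihilator_imp_localization_vanishes:
  assumes p: "\<pp> \<in> Spec R G" and D: "D \<in> Obj T" and v: "v \<in> G e" "v \<notin> \<pp>"
    and vD: "\<phi> e v D = ZeroA T D (susp_obj T e D)"
  shows "localization_vanishes R G \<pp> (H D D)"
proof -
  let ?N = "H D D"
  interpret N: graded_module_over R G ?N by (rule hom_module_graded_module[OF D D])
  have kill: "act ?N e n v m = \<one>\<^bsub>comp ?N (e + n)\<^esub>" if m: "m \<in> carrier (comp ?N n)" for m n
  proof -
    have "susp_arr T n (\<phi> e v D) = ZeroA T (susp_obj T n D) (susp_obj T (e + n) D)"
      using vD susp_arr_Zero[OF D susp_obj_Obj[OF D], of n e] D by (simp add: susp_obj_susp_obj add.commute)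
    then show ?thesis using m Comp_Zero_left[of m D "susp_obj T n D"] susp_obj_Obj[OF D] by simp
  qed
  have killm: "act ?N (e + k) n (v \<otimes>\<^bsub>R\<^esub> r) m = \<one>\<^bsub>comp ?N (e + (k + n))\<^esub>"
    if r: "r \<in> G k" and m: "m \<in> carrier (comp ?N n)" for r k m n
    using N.act_mult[OF v(1) r m] kill[OF N.act_closed[OF r m]] by simp
  \<comment> \<open>Any two fractions are equal: take the common denominator \<open>v s' s\<close>.\<close>
  have rel: "((a, s, m), (a', s', m')) \<in> fraction_rel R G \<pp> ?N n"
    if z: "(a, s, m) \<in> fractions G \<pp> ?N n" and z': "(a', s', m') \<in> fractions G \<pp> ?N n"
    for a s m a' s' m' n
  proof -
    have s: "s \<in> G a" "s \<notin> \<pp>" and m: "m \<in> carrier (comp ?N (a + n))"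
      and s': "s' \<in> G a'" "s' \<notin> \<pp>" and m': "m' \<in> carrier (comp ?N (a' + n))"
      using z z' by (auto simp: fractions_def)
    have car: "v \<in> carrier R" "s \<in> carrier R" "s' \<in> carrier R"
      using v(1) s(1) s'(1) G_carrier by blast+
    let ?u = "v \<otimes>\<^bsub>R\<^esub> s'" and ?t = "if even (a' * a) then s else \<ominus>\<^bsub>R\<^esub> s"
    let ?u' = "v \<otimes>\<^bsub>R\<^esub> ?t"
    have t: "?t \<in> G a" using s(1) G_closed(3) by simp
    have u: "?u \<in> G (e + a')" and u': "?u' \<in> G (e + a)"
      using mult_degree[OF v(1) s'(1)] mult_degree[OF v(1) t] by blast+
    have "?u \<otimes>\<^bsub>R\<^esub> s = v \<otimes>\<^bsub>R\<^esub> (s' \<otimes>\<^bsub>R\<^esub> s)" using car by (simp add: m_assoc)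
    also have "s' \<otimes>\<^bsub>R\<^esub> s = ?t \<otimes>\<^bsub>R\<^esub> s'"
      using graded_commute[OF s'(1) s(1)] car by (simp add: l_minus)
    also have "v \<otimes>\<^bsub>R\<^esub> (?t \<otimes>\<^bsub>R\<^esub> s') = ?u' \<otimes>\<^bsub>R\<^esub> s'"
      using m_assoc[OF car(1) G_carrier[OF t] car(3)] by simp
    finally have eq: "?u \<otimes>\<^bsub>R\<^esub> s = ?u' \<otimes>\<^bsub>R\<^esub> s'" .
    have notin: "?u \<otimes>\<^bsub>R\<^esub> s \<notin> \<pp>"
      using SpecD(3)[OF p u s(1)] SpecD(3)[OF p v(1) s'(1)] v(2) s(2) s'(2) by blast
    have acts: "act ?N (e + a') (a + n) ?u m = act ?N (e + a) (a' + n) ?u' m'"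
      using killm[OF s'(1) m] killm[OF t m'] by (simp add: ac_simps)
    have deg: "(e + a') + a = (e + a) + a'" by simp
    show ?thesis
      unfolding fraction_rel_def using z z' u u' eq notin acts deg by blast
  qed
  have Z: "(0, \<one>\<^bsub>R\<^esub>, \<one>\<^bsub>comp ?N n\<^esub>) \<in> fractions G \<pp> ?N n" for n
    using one_degree SpecD(2)[OF p] N.N.one_closed[of n] by (simp add: fractions_def)
  have cls: "fraction_rel R G \<pp> ?N n `` {z} = fractions G \<pp> ?N n" if "z \<in> fractions G \<pp> ?N n" for z n
  proof
    show "fraction_rel R G \<pp> ?N n `` {z} \<subseteq> fractions G \<pp> ?N n" by (auto simp: fraction_rel_def)
    obtain a s m where z: "z = (a, s, m)" by (cases z)
    show "fractions G \<pp> ?N n \<subseteq> fraction_rel R G \<pp> ?N n `` {z}"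
      using rel that unfolding z by auto
  qed
  have "localization R G \<pp> ?N n = {fractions G \<pp> ?N n}" for n
    unfolding localization_def quotient_def using cls Z[of n] by auto
  then show ?thesis unfolding localization_vanishes_def using cls[OF Z] by simp
qed

text \<open>Some power of \<open>x\<close> annihilates every \<open>D\<close> supported where \<open>x\<close> vanishes. Otherwise a homogeneous prime
  containing the annihilator of \<open>D\<close> but not \<open>x\<close> would belong to the support of \<open>D\<close>.\<close>

lemma power_annihilates_torsion_compact:
  assumes DV: "D \<in> torsion_compacts U R G T \<phi> V" and x: "x \<in> G d"
    and V: "\<And>\<pp>. \<pp> \<in> Spec R G \<Longrightarrow> x \<notin> \<pp> \<Longrightarrow> \<pp> \<notin> V"
  shows "\<exists>k::nat. \<phi> (int k * d) (x [^]\<^bsub>R\<^esub> k) D = ZeroA T D (susp_obj T (int k * d) D)"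
proof (rule ccontr)
  assume neg: "\<not> ?thesis"
  have D: "D \<in> Obj T" using DV by (simp add: torsion_compacts_def compact_object_def)
  interpret N: graded_module_over R G "H D D" by (rule hom_module_graded_module[OF D D])
  have id: "Idn T D \<in> carrier (comp (H D D) 0)" using Idn_Hom[OF D] by simp
  define J where "J n = {r \<in> G n. \<phi> n r D = ZeroA T D (susp_obj T n D)}" for n
  have JD: "r \<in> J n \<longleftrightarrow> r \<in> G n \<and> act (H D D) n 0 r (Idn T D) = \<one>\<^bsub>comp (H D D) (n + 0)\<^esub>" for r n
    using Comp_Idn_right[OF \<phi>_Hom[OF _ D]] Comp_Idn_right[OF Zero_Hom[OF D susp_obj_Obj[OF D]]]
    by (auto simp: J_def)
  have "subgroup (J n) (add_monoid R)" for n
  proof (rule add.subgroupI)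
    show "J n \<subseteq> carrier R" using G_carrier by (auto simp: J_def)
    have "\<zero>\<^bsub>R\<^esub> \<in> J n" using N.zero_act[OF id] G_closed(2) by (simp only: JD)
    then show "J n \<noteq> {}" by blast
  next
    fix a assume "a \<in> J n"
    then show "\<ominus>\<^bsub>R\<^esub> a \<in> J n" unfolding JD using N.minus_act[OF _ id] G_closed(3) N.N.inv_one by metis
  next
    fix a b assume "a \<in> J n" "b \<in> J n"
    then show "a \<oplus>\<^bsub>R\<^esub> b \<in> J n"
      unfolding JD using N.act_add[OF _ _ id] G_closed(1) N.N.r_one N.N.one_closed by metis
  qed
  moreover have "r \<otimes>\<^bsub>R\<^esub> p \<in> J (m + n)" if r: "r \<in> G m" and p: "p \<in> J n" for r p m n
  proof -
    have pG: "p \<in> G n" and pz: "act (H D D) n 0 p (Idn T D) = \<one>\<^bsub>comp (H D D) (n + 0)\<^esub>"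
      using p by (simp_all only: JD)
    have "act (H D D) (m + n) 0 (r \<otimes>\<^bsub>R\<^esub> p) (Idn T D) = \<one>\<^bsub>comp (H D D) (m + (n + 0))\<^esub>"
      using N.act_mult[OF r pG id] pz N.act_zero[OF r] by metis
    then show ?thesis unfolding JD using mult_degree[OF r pG] by (simp add: add.assoc)
  qed
  ultimately have J: "graded_ideal R G J"
    by (auto simp: graded_ideal_def additive_subgroup_def J_def)
  have "x [^]\<^bsub>R\<^esub> k \<notin> J (int k * d)" for k :: nat using neg by (auto simp: J_def)
  then obtain \<pp> where p: "\<pp> \<in> Spec R G" "\<And>n. J n \<subseteq> \<pp>" "x \<notin> \<pp>"
    using exists_prime_avoiding_powers[OF J x] by blast
  then have "localization_vanishes R G \<pp> (H D D)"
    using DV V by (auto simp: torsion_compacts_def)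
  then obtain b u where "u \<in> G b" "u \<notin> \<pp>" "\<phi> b u D = ZeroA T D (susp_obj T b D)"
    using localization_vanishes_imp_annihilator[OF p(1) D] by blast
  then show False using p(2)[of b] by (auto simp: J_def)
qed

lemma power_torsion_of_annihilated:
  assumes C: "C \<in> Obj T" and D: "D \<in> Obj T" and x: "x \<in> G d"
    and z: "\<phi> (int k * d) (x [^]\<^bsub>R\<^esub> k) D = ZeroA T D (susp_obj T (int k * d) D)"
  shows "power_torsion C D d x"
  unfolding power_torsion_def
proof (intro allI ballI exI[of _ k])
  fix n f assume f: "f \<in> Hom T C (susp_obj T n D)"
  have "susp_arr T n (\<phi> (int k * d) (x [^]\<^bsub>R\<^esub> k) D) =
      ZeroA T (susp_obj T n D) (susp_obj T (int k * d + n) D)"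
    using z susp_arr_Zero[OF D susp_obj_Obj[OF D], of n "int k * d"] D
    by (simp add: susp_obj_susp_obj add.commute)
  then show "susp_arr T n (\<phi> (int k * d) (x [^]\<^bsub>R\<^esub> k) D) \<cdot>\<^bsub>T\<^esub> f = ZeroA T C (susp_obj T (int k * d + n) D)"
    using Comp_Zero_left[OF f susp_obj_Obj[OF D]] by simp
qed

lemma torsion_subcategory_power_torsion:
  fixes U :: "'u set"
  assumes C: "compact_object U T C" and x: "x \<in> G d"
    and V: "\<And>\<pp>. \<pp> \<in> Spec R G \<Longrightarrow> x \<notin> \<pp> \<Longrightarrow> \<pp> \<notin> V"
    and X: "X \<in> torsion_subcategory U R G T \<phi> V"
  shows "power_torsion C X d x"
proof -
  have CO: "C \<in> Obj T" using C by (simp add: compact_object_def)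
  have "torsion_compacts U R G T \<phi> V \<subseteq> {X \<in> Obj T. power_torsion C X d x}"
  proof
    fix D assume D: "D \<in> torsion_compacts U R G T \<phi> V"
    then have "D \<in> Obj T" by (simp add: torsion_compacts_def compact_object_def)
    then show "D \<in> {X \<in> Obj T. power_torsion C X d x}"
      using power_annihilates_torsion_compact[OF D x V] power_torsion_of_annihilated[OF CO _ x] by blast
  qed
  then show ?thesis
    using Loc_least[OF localizing_power_torsion[OF C x]] X by (auto simp: torsion_subcategory_eq)
qed

text \<open>A product of two elements annihilates the third object of an exact triangle as soon as the factors
  annihilate the two morphisms adjacent to it.\<close>

lemma product_annihilates:
  assumes t: "(f, g, h) \<in> Tri T" and u: "u \<in> G a" and v: "v \<in> G b"
    and uh: "\<phi> a u (Cod T h) \<cdot>\<^bsub>T\<^esub> h = ZeroA T (Dom T h) (susp_obj T a (Cod T h))"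
    and vg: "\<phi> b v (Dom T h) \<cdot>\<^bsub>T\<^esub> g = ZeroA T (Dom T g) (susp_obj T b (Dom T h))"
  shows "\<phi> (b + a) (v \<otimes>\<^bsub>R\<^esub> u) (Dom T h) = ZeroA T (Dom T h) (susp_obj T (b + a) (Dom T h))"
proof -
  note TD = TriD[OF t]
  let ?K = "Dom T h"
  have uK: "\<phi> a u ?K \<in> Hom T ?K (susp_obj T a ?K)" using \<phi>_Hom[OF u TD(9)] .
  have "susp_arr T a h \<cdot>\<^bsub>T\<^esub> \<phi> a u ?K = ZeroA T ?K (susp_obj T a (SuspO T (Dom T f)))"
    using \<phi>_natural[OF u TD(3)] uh TD(6) by simp
  then obtain w where w: "w \<in> Hom T ?K (susp_obj T a (Dom T g))" "\<phi> a u ?K = susp_arr T a g \<cdot>\<^bsub>T\<^esub> w"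
    using graded_exact_covariant_second[OF t uK] by blast
  have vK: "susp_arr T a (\<phi> b v ?K) \<in> Hom T (susp_obj T a ?K) (susp_obj T (b + a) ?K)"
    using susp_arr_Hom[OF \<phi>_Hom[OF v TD(9)], of a] TD(9) by (simp add: susp_obj_susp_obj add.commute)
  have "susp_arr T a (\<phi> b v ?K) \<cdot>\<^bsub>T\<^esub> \<phi> a u ?K = susp_arr T a (\<phi> b v ?K \<cdot>\<^bsub>T\<^esub> g) \<cdot>\<^bsub>T\<^esub> w"
    using w Comp_assoc[OF w(1) susp_arr_Hom[OF TD(2)] vK] susp_arr_Comp[OF TD(2) \<phi>_Hom[OF v TD(9)]] by simp
  also have "\<dots> = ZeroA T (susp_obj T a (Dom T g)) (susp_obj T (b + a) ?K) \<cdot>\<^bsub>T\<^esub> w"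
    using vg susp_arr_Zero[OF TD(8) susp_obj_Obj[OF TD(9)], of a b] TD(9)
    by (simp add: susp_obj_susp_obj add.commute)
  also have "\<dots> = ZeroA T ?K (susp_obj T (b + a) ?K)"
    using Comp_Zero_left[OF w(1) susp_obj_Obj[OF TD(9)]] by simp
  finally show ?thesis using \<phi>_mult[OF v u TD(9)] by simp
qed

lemma square_annihilates_koszul:
  assumes D: "D \<in> Obj T" and x: "x \<in> G d" and t: "(\<phi> d x D, q, \<delta>) \<in> Tri T"
  shows "\<phi> (d + d) (x \<otimes>\<^bsub>R\<^esub> x) (Dom T \<delta>) = ZeroA T (Dom T \<delta>) (susp_obj T (d + d) (Dom T \<delta>))"
proof (rule product_annihilates[OF t x x])
  note ks = koszul_triangle_simps[OF D x t]
  have C\<delta>: "Cod T \<delta> = SuspO T D" using HomD[OF ks(5)] by simp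
  have SD: "SuspO T D \<in> Obj T" using HomD[OF ks(5)] by simp
  have Sd: "susp_obj T d (SuspO T D) = SuspO T (susp_obj T d D)"
    using susp_obj_SuspO[OF D] SuspO_susp_obj[OF D] by simp
  have "\<phi> d x (SuspO T D) \<cdot>\<^bsub>T\<^esub> \<delta> = signed T d (SuspA T (\<phi> d x D) \<cdot>\<^bsub>T\<^esub> \<delta>)"
    using \<phi>_SuspO[OF x D] Comp_signed_left[OF ks(5) SuspA_Hom[OF \<phi>_Hom[OF x D]]] by simp
  also have "\<dots> = ZeroA T (Dom T \<delta>) (SuspO T (susp_obj T d D))"
    using Tri_Comp_zero_last[OF t] signed_eq_Zero_iff[OF Comp_Hom[OF ks(5) SuspA_Hom[OF \<phi>_Hom[OF x D]]]]
    by (simp add: ks)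
  finally show "\<phi> d x (Cod T \<delta>) \<cdot>\<^bsub>T\<^esub> \<delta> = ZeroA T (Dom T \<delta>) (susp_obj T d (Cod T \<delta>))"
    by (simp add: C\<delta> Sd)
  have h: "susp_arr T d (\<phi> d x D) \<in> Hom T (susp_obj T d D) (susp_obj T d (susp_obj T d D))"
    using susp_arr_Hom[OF \<phi>_Hom[OF x D]] .
  have "\<phi> d x (Dom T \<delta>) \<cdot>\<^bsub>T\<^esub> q = susp_arr T d q \<cdot>\<^bsub>T\<^esub> signed T (d * d) (susp_arr T d (\<phi> d x D))"
    using \<phi>_natural[OF x ks(4)] \<phi>_susp_obj[OF x D] by simp
  also have "\<dots> = signed T (d * d) (susp_arr T d (q \<cdot>\<^bsub>T\<^esub> \<phi> d x D))"
    using Comp_signed_right[OF h susp_arr_Hom[OF ks(4)]] susp_arr_Comp[OF \<phi>_Hom[OF x D] ks(4)] by simp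
  also have "\<dots> = ZeroA T (susp_obj T d D) (susp_obj T d (Dom T \<delta>))"
    using Tri_Comp_zero[OF t] susp_arr_Zero[OF D ks(6)]
      signed_eq_Zero_iff[OF Zero_Hom[OF susp_obj_Obj[OF D] susp_obj_Obj[OF ks(6)]]] by (simp add: ks)
  finally show "\<phi> d x (Dom T \<delta>) \<cdot>\<^bsub>T\<^esub> q = ZeroA T (Dom T q) (susp_obj T d (Dom T \<delta>))" by (simp add: ks)
qed

text \<open>Passing to \<open>D//x\<close> cuts down the support by the locus of \<open>x\<close>.\<close>

lemma koszul_torsion_compact:
  fixes U :: "'u set"
  assumes DV: "D \<in> torsion_compacts U R G T \<phi> V" and x: "x \<in> G d" and t: "(\<phi> d x D, q, \<delta>) \<in> Tri T"
    and V': "\<And>\<pp>. \<pp> \<in> Spec R G \<Longrightarrow> \<pp> \<notin> V' \<Longrightarrow> \<pp> \<notin> V \<or> x \<notin> \<pp>"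
  shows "Dom T \<delta> \<in> torsion_compacts U R G T \<phi> V'"
proof -
  have Dc: "compact_object U T D" using DV by (simp add: torsion_compacts_def)
  then have D: "D \<in> Obj T" by (simp add: compact_object_def)
  note ks = koszul_triangle_simps[OF D x t]
  have "compact_object U T (Dom T \<delta>)"
    using compact_object_cone[OF t, of U] Dc compact_object_susp[OF Dc] by (simp add: ks)
  moreover have "localization_vanishes R G \<pp> (H (Dom T \<delta>) (Dom T \<delta>))"
    if p: "\<pp> \<in> Spec R G" "\<pp> \<notin> V'" for \<pp>
  proof (cases "x \<in> \<pp>")
    case False
    then have "x \<otimes>\<^bsub>R\<^esub> x \<notin> \<pp>" using SpecD(3)[OF p(1) x x] by blast
    then show ?thesis
      using annihilator_imp_localization_vanishes[OF p(1) ks(6) mult_degree[OF x x]]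
        square_annihilates_koszul[OF D x t] by blast
  next
    case True
    then have "\<pp> \<notin> V" using V' p by blast
    then obtain b u where u: "u \<in> G b" "u \<notin> \<pp>" and uD: "\<phi> b u D = ZeroA T D (susp_obj T b D)"
      using DV p(1) localization_vanishes_imp_annihilator[OF p(1) D] by (auto simp: torsion_compacts_def)
    have uS: "\<phi> b u (susp_obj T n D) = ZeroA T (susp_obj T n D) (susp_obj T b (susp_obj T n D))" for n
      using \<phi>_susp_obj[OF u(1) D, of n] uD susp_arr_Zero[OF D susp_obj_Obj[OF D], of n b]
        signed_eq_Zero_iff[OF Zero_Hom[OF susp_obj_Obj[OF D] susp_obj_Obj[OF D]]] D
      by (simp add: susp_obj_susp_obj add.commute)
    have "\<phi> (b + b) (u \<otimes>\<^bsub>R\<^esub> u) (Dom T \<delta>) = ZeroA T (Dom T \<delta>) (susp_obj T (b + b) (Dom T \<delta>))"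
    proof (rule product_annihilates[OF t u(1) u(1)])
      have C\<delta>: "Cod T \<delta> = SuspO T D" using HomD[OF ks(5)] by simp
      show "\<phi> b u (Cod T \<delta>) \<cdot>\<^bsub>T\<^esub> \<delta> = ZeroA T (Dom T \<delta>) (susp_obj T b (Cod T \<delta>))"
        using uS[of 1] Comp_Zero_left[OF ks(5)] susp_obj_Obj HomD[OF ks(5)] by (simp add: C\<delta>)
      have "\<phi> b u (Dom T \<delta>) \<cdot>\<^bsub>T\<^esub> q = susp_arr T b q \<cdot>\<^bsub>T\<^esub> \<phi> b u (susp_obj T d D)"
        using \<phi>_natural[OF u(1) ks(4)] .
      then show "\<phi> b u (Dom T \<delta>) \<cdot>\<^bsub>T\<^esub> q = ZeroA T (Dom T q) (susp_obj T b (Dom T \<delta>))"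
        using uS[of d] Comp_Zero_right[OF susp_arr_Hom[OF ks(4)] susp_obj_Obj[OF D]] by (simp add: ks)
    qed
    moreover have "u \<otimes>\<^bsub>R\<^esub> u \<notin> \<pp>" using SpecD(3)[OF p(1) u(1) u(1)] u(2) by blast
    ultimately show ?thesis
      using annihilator_imp_localization_vanishes[OF p(1) ks(6) mult_degree[OF u(1) u(1)]] by blast
  qed
  ultimately show ?thesis by (simp add: torsion_compacts_def)
qed

end

section \<open>Local cohomology\<close>

context linear_triangulated_category
begin

text \<open>The canonical map \<open>\<Gamma>\<^sub>V M \<rightarrow> \<Gamma>\<^sub>W M\<close> is again a coreflection of its target. The Yoneda lemma provides
  the inverse that is part of its definition.\<close>

lemma canonical_map_coreflection:
  assumes rV: "coreflection T L (\<Gamma>o V) (\<Gamma>a V) (\<theta> V)" and rW: "coreflection T L' (\<Gamma>o W) (\<Gamma>a W) (\<theta> W)"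
    and LL': "L \<subseteq> L'" "L' \<subseteq> Obj T" and M: "M \<in> Obj T"
  shows "canonical_map T \<Gamma>o \<Gamma>a \<theta> V W M \<in> Hom T (\<Gamma>o V M) (\<Gamma>o W M)"
    "\<And>D. D \<in> L \<Longrightarrow> bij_betw (\<lambda>f. canonical_map T \<Gamma>o \<Gamma>a \<theta> V W M \<cdot>\<^bsub>T\<^esub> f) (Hom T D (\<Gamma>o V M)) (Hom T D (\<Gamma>o W M))"
proof -
  let ?A = "\<Gamma>o V M" and ?B = "\<Gamma>o W M"
  let ?C = "\<Gamma>o V ?B"
  have V: "\<And>X. X \<in> Obj T \<Longrightarrow> \<Gamma>o V X \<in> L" "\<And>X. X \<in> Obj T \<Longrightarrow> \<theta> V X \<in> Hom T (\<Gamma>o V X) X"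
    "\<And>X Y f. f \<in> Hom T X Y \<Longrightarrow> \<Gamma>a V f \<in> Hom T (\<Gamma>o V X) (\<Gamma>o V Y)"
    "\<And>X Y f. f \<in> Hom T X Y \<Longrightarrow> \<theta> V Y \<cdot>\<^bsub>T\<^esub> \<Gamma>a V f = f \<cdot>\<^bsub>T\<^esub> \<theta> V X"
    "\<And>D X. D \<in> L \<Longrightarrow> X \<in> Obj T \<Longrightarrow> bij_betw (\<lambda>g. \<theta> V X \<cdot>\<^bsub>T\<^esub> g) (Hom T D (\<Gamma>o V X)) (Hom T D X)"
    using rV HomD(4,5) unfolding coreflection_def by (metis, metis, metis, metis, metis)
  have W: "\<Gamma>o W M \<in> L'" "\<theta> W M \<in> Hom T ?B M"
    "\<And>D. D \<in> L' \<Longrightarrow> bij_betw (\<lambda>g. \<theta> W M \<cdot>\<^bsub>T\<^esub> g) (Hom T D ?B) (Hom T D M)"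
    using rW M unfolding coreflection_def by (metis, metis, metis)
  have B: "?B \<in> Obj T" using W(1) LL' by blast
  let ?e = "\<Gamma>a V (\<theta> W M)"
  have e: "?e \<in> Hom T ?C ?A" using V(3)[OF W(2)] .
  have nat: "\<theta> V M \<cdot>\<^bsub>T\<^esub> ?e = \<theta> W M \<cdot>\<^bsub>T\<^esub> \<theta> V ?B" using V(4)[OF W(2)] .
  have ebij: "bij_betw (\<lambda>f. ?e \<cdot>\<^bsub>T\<^esub> f) (Hom T D ?C) (Hom T D ?A)" if D: "D \<in> L" for D
  proof -
    have "bij_betw ((\<lambda>g. \<theta> W M \<cdot>\<^bsub>T\<^esub> g) \<circ> (\<lambda>g. \<theta> V ?B \<cdot>\<^bsub>T\<^esub> g)) (Hom T D ?C) (Hom T D M)"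
      using bij_betw_trans[OF V(5)[OF D B] W(3)] D LL' by blast
    moreover have "((\<lambda>g. \<theta> W M \<cdot>\<^bsub>T\<^esub> g) \<circ> (\<lambda>g. \<theta> V ?B \<cdot>\<^bsub>T\<^esub> g)) f = ((\<lambda>g. \<theta> V M \<cdot>\<^bsub>T\<^esub> g) \<circ> (\<lambda>f. ?e \<cdot>\<^bsub>T\<^esub> f)) f"
      if f: "f \<in> Hom T D ?C" for f
      using Comp_assoc[OF f V(2)[OF B] W(2)] Comp_assoc[OF f e V(2)[OF M]] nat by simp
    ultimately have "bij_betw ((\<lambda>g. \<theta> V M \<cdot>\<^bsub>T\<^esub> g) \<circ> (\<lambda>f. ?e \<cdot>\<^bsub>T\<^esub> f)) (Hom T D ?C) (Hom T D M)"
      using bij_betw_cong[of "Hom T D ?C"] by blast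
    moreover have "(\<lambda>f. ?e \<cdot>\<^bsub>T\<^esub> f) ` Hom T D ?C \<subseteq> Hom T D ?A" using Comp_Hom[OF _ e] by blast
    ultimately show ?thesis using bij_betw_comp_iff2[OF V(5)[OF D M]] by blast
  qed
  have AL: "?A \<in> L" and CL: "?C \<in> L" using V(1) M B by auto
  have A: "?A \<in> Obj T" and CO: "?C \<in> Obj T" using HomD[OF e] by auto
  obtain r where r: "r \<in> Hom T ?A ?C" "?e \<cdot>\<^bsub>T\<^esub> r = Idn T ?A"
    using ebij[OF AL] Idn_Hom[OF A] unfolding bij_betw_def by (metis imageE)
  have "?e \<cdot>\<^bsub>T\<^esub> (r \<cdot>\<^bsub>T\<^esub> ?e) = ?e \<cdot>\<^bsub>T\<^esub> Idn T ?C"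
    using Comp_assoc[OF e r(1) e] r(2) Comp_Idn_left[OF e] Comp_Idn_right[OF e] by simp
  then have re: "r \<cdot>\<^bsub>T\<^esub> ?e = Idn T ?C"
    using inj_onD[OF bij_betw_imp_inj_on[OF ebij[OF CL]]] Comp_Hom[OF e r(1)] Idn_Hom[OF CO] by blast
  have "inverse_arr T ?e r"
    using HomD[OF e] r re by (simp add: inverse_arr_def)
  then have c: "canonical_map T \<Gamma>o \<Gamma>a \<theta> V W M = \<theta> V ?B \<cdot>\<^bsub>T\<^esub> r"
    by (simp add: canonical_map_def the_inverse_eq)
  show "canonical_map T \<Gamma>o \<Gamma>a \<theta> V W M \<in> Hom T ?A ?B"
    unfolding c using Comp_Hom[OF r(1) V(2)[OF B]] .
  show "bij_betw (\<lambda>f. canonical_map T \<Gamma>o \<Gamma>a \<theta> V W M \<cdot>\<^bsub>T\<^esub> f) (Hom T D ?A) (Hom T D ?B)" if D: "D \<in> L" for D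
  proof -
    have "bij_betw (\<lambda>f. r \<cdot>\<^bsub>T\<^esub> f) (Hom T D ?A) (Hom T D ?C)"
    proof (rule bij_betw_byWitness[where f' = "\<lambda>f. ?e \<cdot>\<^bsub>T\<^esub> f"])
      show "\<forall>f\<in>Hom T D ?A. ?e \<cdot>\<^bsub>T\<^esub> (r \<cdot>\<^bsub>T\<^esub> f) = f"
        using Comp_assoc[OF _ r(1) e] r(2) Comp_Idn_left by simp
      show "\<forall>f\<in>Hom T D ?C. r \<cdot>\<^bsub>T\<^esub> (?e \<cdot>\<^bsub>T\<^esub> f) = f"
        using Comp_assoc[OF _ e r(1)] re Comp_Idn_left by simp
    qed (use Comp_Hom[OF _ r(1)] Comp_Hom[OF _ e] in auto)
    then have "bij_betw ((\<lambda>g. \<theta> V ?B \<cdot>\<^bsub>T\<^esub> g) \<circ> (\<lambda>f. r \<cdot>\<^bsub>T\<^esub> f)) (Hom T D ?A) (Hom T D ?B)"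
      using bij_betw_trans V(5)[OF D B] by blast
    moreover have "((\<lambda>g. \<theta> V ?B \<cdot>\<^bsub>T\<^esub> g) \<circ> (\<lambda>f. r \<cdot>\<^bsub>T\<^esub> f)) f = canonical_map T \<Gamma>o \<Gamma>a \<theta> V W M \<cdot>\<^bsub>T\<^esub> f"
      if "f \<in> Hom T D ?A" for f
      using Comp_assoc[OF that r(1) V(2)[OF B]] by (simp add: c)
    ultimately show ?thesis using bij_betw_cong[of "Hom T D ?A"] by blast
  qed
qed

lemma torsion_subcategory_Obj: "torsion_subcategory U R G T \<phi> V \<subseteq> Obj T"
  unfolding torsion_subcategory_eq
  by (rule Loc_Obj) (auto simp: torsion_compacts_def compact_object_def)

text \<open>Let \<open>c\<close> be a coreflection of \<open>A\<close> into the torsion subcategory of \<open>V'\<close>, where \<open>V'\<close> is the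
  intersection of \<open>V\<close> and the locus of \<open>x\<close>. Suppose that \<open>A\<close> belongs to the torsion subcategory of \<open>V\<close>,
  or that \<open>C\<close> is one of its generators. Then \<open>x\<close> is invertible on \<open>Hom\<^sup>*(C, E)\<close> for the cone \<open>E\<close> of \<open>c\<close>.
  Indeed \<open>F = E//x\<close> is right orthogonal to the torsion subcategory of \<open>V\<close>, since \<open>E\<close> is right orthogonal
  to \<open>D//x\<close> for its generators \<open>D\<close>. If \<open>A\<close> belongs to this subcategory, so do \<open>E\<close> and \<open>F\<close>, whence
  \<open>F = 0\<close>.\<close>

lemma coreflection_torsion:
  fixes U :: "'u set"
  assumes C: "compact_object U T C" and x: "x \<in> G d" and t: "(c, g, h) \<in> Tri T"
    and V'V: "V' \<subseteq> V"
    and V'x: "\<And>\<pp>. \<pp> \<in> Spec R G \<Longrightarrow> x \<notin> \<pp> \<Longrightarrow> \<pp> \<notin> V'"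
    and V': "\<And>\<pp>. \<pp> \<in> Spec R G \<Longrightarrow> \<pp> \<notin> V' \<Longrightarrow> \<pp> \<notin> V \<or> x \<notin> \<pp>"
    and cV': "Dom T c \<in> torsion_subcategory U R G T \<phi> V'"
    and bij: "\<And>D. D \<in> torsion_subcategory U R G T \<phi> V' \<Longrightarrow>
      bij_betw (\<lambda>f. c \<cdot>\<^bsub>T\<^esub> f) (Hom T D (Dom T c)) (Hom T D (Dom T g))"
    and A: "C \<in> torsion_compacts U R G T \<phi> V \<or> Dom T g \<in> torsion_subcategory U R G T \<phi> V"
  shows "power_torsion C (Dom T c) d x" "acts_bijectively C (Dom T h) d x"
proof -
  let ?E = "Dom T h"
  let ?L = "torsion_subcategory U R G T \<phi> V" and ?L' = "torsion_subcategory U R G T \<phi> V'"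
  note TD = TriD[OF t]
  have CO: "C \<in> Obj T" using C by (simp add: compact_object_def)
  show "power_torsion C (Dom T c) d x"
    using torsion_subcategory_power_torsion[OF C x V'x cV'] by blast
  have orthE: "D \<in> left_orthogonal ?E" if D: "D \<in> ?L'" for D
  proof (rule cone_left_orthogonal[OF t])
    show "D \<in> Obj T" using D torsion_subcategory_Obj by blast
    show "bij_betw (\<lambda>f. c \<cdot>\<^bsub>T\<^esub> f) (Hom T (susp_obj T k D) (Dom T c)) (Hom T (susp_obj T k D) (Dom T g))" for k
      using bij Loc_susp D unfolding torsion_subcategory_eq by blast
  qed
  obtain q \<delta> where tE: "(\<phi> d x ?E, q, \<delta>) \<in> Tri T"
    using TR1_cone HomD(1)[OF \<phi>_Hom[OF x TD(9)]] by blast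
  note ks = koszul_triangle_simps[OF TD(9) x tE]
  let ?F = "Dom T \<delta>"
  have "D \<in> left_orthogonal ?F" if D: "D \<in> torsion_compacts U R G T \<phi> V" for D
  proof -
    have DO: "D \<in> Obj T" using D by (simp add: torsion_compacts_def compact_object_def)
    obtain q' \<delta>' where tD: "(\<phi> d x D, q', \<delta>') \<in> Tri T"
      using TR1_cone HomD(1)[OF \<phi>_Hom[OF x DO]] by blast
    have "Dom T \<delta>' \<in> torsion_compacts U R G T \<phi> V'" using koszul_torsion_compact[OF D x tD V'] by blast
    then have "Dom T \<delta>' \<in> left_orthogonal ?E"
      using orthE generators_subset_Loc unfolding torsion_subcategory_eq by blast
    then have "acts_bijectively D ?E d x"
      by (rule acts_bijectively_if_koszul_orthogonal[OF DO TD(9) x tD])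
    then show ?thesis by (rule orthogonal_if_acts_bijectively[OF DO TD(9) x tE])
  qed
  then have gensF: "torsion_compacts U R G T \<phi> V \<subseteq> left_orthogonal ?F" by blast
  then have LF: "?L \<subseteq> left_orthogonal ?F"
    unfolding torsion_subcategory_eq by (rule Loc_least[OF localizing_left_orthogonal[OF ks(6)]])
  have "C \<in> left_orthogonal ?F"
    using A
  proof
    assume "C \<in> torsion_compacts U R G T \<phi> V"
    then show ?thesis using gensF by blast
  next
    assume A: "Dom T g \<in> ?L"
    have "?L' \<subseteq> ?L" unfolding torsion_subcategory_eq by (rule Loc_mono[OF torsion_compacts_mono[OF V'V]])
    then have "Dom T c \<in> ?L" using cV' by blast
    then have E: "?E \<in> ?L" using A Loc_cone[OF t] unfolding torsion_subcategory_eq by blast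
    then have "susp_obj T d ?E \<in> ?L" using Loc_susp unfolding torsion_subcategory_eq by blast
    then have "?F \<in> ?L" using E Loc_cone[OF tE] unfolding torsion_subcategory_eq ks by blast
    then have "?F \<in> left_orthogonal ?F" using LF by blast
    then have "Idn T ?F = ZeroA T ?F ?F"
      using left_orthogonalD[of ?F ?F "Idn T ?F" 0] Idn_Hom[OF ks(6)] by simp
    then have zF: "zero_object T ?F" using ks(6) by (simp add: zero_object_def)
    have "f = ZeroA T C (susp_obj T n ?F)" if "f \<in> Hom T C (susp_obj T n ?F)" for f n
      using zero_object_Hom_to[OF zero_object_susp[OF zF] that] .
    then show ?thesis using CO by (auto simp: left_orthogonal_def)
  qed
  then show "acts_bijectively C ?E d x"
    by (rule acts_bijectively_if_orthogonal[OF CO TD(9) x tE])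
qed


section \<open>The equivalences\<close>

lemma weakly_regular_iff_koszul_ghost:
  assumes C: "C \<in> Obj T" and M: "M \<in> Obj T" and xs: "\<And>d x. (d, x) \<in> set xs \<Longrightarrow> x \<in> G d"
    and K: "koszul_triangles T \<phi> M xs K q \<delta>"
  shows "weakly_regular R G (H C M) xs \<longleftrightarrow>
    (\<forall>i<length xs. ghost T C (susp_arr T (- int (Suc i)) (\<delta> i)))"
proof -
  have K0: "K 0 = M" using K by (simp add: koszul_triangles_def)
  have tri: "(\<phi> (fst (xs ! i)) (snd (xs ! i)) (K i), q i, \<delta> i) \<in> Tri T" "Cod T (q i) = K (Suc i)"
    if "i < length xs" for i
    using K that by (auto simp: koszul_triangles_def)
  have xi: "snd (xs ! i) \<in> G (fst (xs ! i))" if "i < length xs" for i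
    using xs that by (metis nth_mem prod.collapse)
  have KO: "K i \<in> Obj T" if "i \<le> length xs" for i
    using that
  proof (induction i)
    case 0
    then show ?case using M K0 by simp
  next
    case (Suc i)
    then show ?case using TriD[OF tri(1)[of i]] tri(2)[of i] by simp
  qed
  have D\<delta>: "Dom T (\<delta> i) = K (Suc i)" if "i < length xs" for i
    using TriD(5)[OF tri(1)[OF that]] tri(2)[OF that] by simp
  have gh: "ghost T C (susp_arr T (- int (Suc i)) (\<delta> i)) \<longleftrightarrow>
      injective_mod (H C (K i)) (zero_sub (H C (K i))) (fst (xs ! i)) (snd (xs ! i))"
    if i: "i < length xs" for i
    using ghost_susp_arr[OF TriD(3)[OF tri(1)[OF i]]]
      ghost_koszul_iff[OF C KO[OF less_imp_le[OF i]] xi[OF i] tri(1)[OF i]] by simp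
  have "weakly_regular R G (H C M) xs \<longleftrightarrow>
      regular_mod (H C (K 0)) (zero_sub (H C (K 0))) xs"
    using graded_module_over.weakly_regular_iff[OF hom_module_graded_module[OF C M]] xs K0 by simp
  also have "\<dots> \<longleftrightarrow> (\<forall>i<length xs. injective_mod (H C (K i))
      (zero_sub (H C (K i))) (fst (xs ! i)) (snd (xs ! i)))"
  proof (rule regular_mod_chain[where N = "\<lambda>i. H C (K i)"])
    fix i d x assume i: "i < length xs" and dx: "xs ! i = (d, x)"
      and inj: "injective_mod (H C (K i)) (zero_sub (H C (K i))) d x"
    have ys: "y \<in> G e" if "(e, y) \<in> set (drop (Suc i) xs)" for e y
      using that xs by (meson in_set_dropD)
    show "regular_mod (H C (K i))
        (add_multiples (H C (K i)) (zero_sub (H C (K i))) d x) (drop (Suc i) xs) \<longleftrightarrow>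
      regular_mod (H C (K (Suc i))) (zero_sub (H C (K (Suc i)))) (drop (Suc i) xs)"
      using regular_mod_koszul[OF C KO[OF less_imp_le[OF i]] _ _ inj ys] xi[OF i] tri(1)[OF i] dx D\<delta>[OF i]
      by simp
  qed
  finally show ?thesis using gh by blast
qed

lemma weakly_regular_iff_local_cohomology_ghost:
  fixes U :: "'u set"
  assumes C: "compact_object U T C" and M: "M \<in> Obj T" and xs: "\<And>d x. (d, x) \<in> set xs \<Longrightarrow> x \<in> G d"
    and lc: "local_cohomology U R G T \<phi> \<Gamma>o \<Gamma>a \<theta>"
  shows "weakly_regular R G (H C M) xs \<longleftrightarrow>
    (\<forall>i<length xs. ghost T C (local_cohomology_map R G T \<Gamma>o \<Gamma>a \<theta> xs M i))"
proof -
  define V where "V = (\<lambda>i. Vset R G (initial_ideal R xs i))"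
  define A where "A = (\<lambda>i. if i = 0 then M else \<Gamma>o (V i) M)"
  let ?c = "local_cohomology_map R G T \<Gamma>o \<Gamma>a \<theta> xs M"
  let ?L = "\<lambda>i. torsion_subcategory U R G T \<phi> (V i)"
  have CO: "C \<in> Obj T" using C by (simp add: compact_object_def)
  have xi: "snd (xs ! i) \<in> G (fst (xs ! i))" if "i < length xs" for i
    using xs that by (metis nth_mem prod.collapse)
  have gens: "snd ` set (take i xs) \<subseteq> carrier R" for i
    using G_carrier[OF xs] by (auto dest: in_set_takeD)
  have VD: "\<pp> \<in> V i \<longleftrightarrow> \<pp> \<in> Spec R G \<and> snd ` set (take i xs) \<subseteq> \<pp>" for \<pp> i
  proof -
    have "initial_ideal R xs i \<subseteq> \<pp> \<longleftrightarrow> snd ` set (take i xs) \<subseteq> \<pp>" if "\<pp> \<in> Spec R G"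
      using genideal_self[OF gens[of i]] genideal_minimal[OF SpecD(1)[OF that], of "snd ` set (take i xs)"]
      unfolding initial_ideal_def by blast
    then show ?thesis by (auto simp: V_def Vset_def)
  qed
  have VSuc: "\<pp> \<in> V (Suc i) \<longleftrightarrow> \<pp> \<in> V i \<and> snd (xs ! i) \<in> \<pp>" if "i < length xs" for \<pp> i
    using that by (auto simp: VD take_Suc_conv_app_nth)
  have sc: "specialization_closed R G (V i)" for i
    unfolding specialization_closed_def using VD by blast
  have cor: "coreflection T (?L i) (\<Gamma>o (V i)) (\<Gamma>a (V i)) (\<theta> (V i))" for i
    using lc sc by (simp add: local_cohomology_def)
  have LL: "?L (Suc i) \<subseteq> ?L i" if "i < length xs" for i
    unfolding torsion_subcategory_eq using VSuc[OF that] by (intro Loc_mono torsion_compacts_mono) auto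
  have AL: "A (Suc i) \<in> ?L (Suc i)" for i
    using cor[of "Suc i"] M by (auto simp: A_def coreflection_def)
  have AO: "A i \<in> Obj T" for i
    using AL[of "i - 1"] torsion_subcategory_Obj M by (cases i) (auto simp: A_def)
  have c: "?c i \<in> Hom T (A (Suc i)) (A i) \<and>
      (\<forall>D\<in>?L (Suc i). bij_betw (\<lambda>f. ?c i \<cdot>\<^bsub>T\<^esub> f) (Hom T D (A (Suc i))) (Hom T D (A i)))"
    if i: "i < length xs" for i
  proof (cases "i = 0")
    case True
    then have "?c i = \<theta> (V 1) M" by (simp add: local_cohomology_map_def V_def)
    then show ?thesis using cor[of 1] M True by (simp add: A_def coreflection_def)
  next
    case False
    then have "?c i = canonical_map T \<Gamma>o \<Gamma>a \<theta> (V (Suc i)) (V i) M"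
      by (simp add: local_cohomology_map_def V_def)
    then show ?thesis
      using canonical_map_coreflection[OF cor cor LL[OF i] torsion_subcategory_Obj M] False
      by (simp add: A_def)
  qed
  have step: "\<exists>g h. (?c i, g, h) \<in> Tri T \<and> Dom T (?c i) = A (Suc i) \<and> Dom T g = A i \<and>
      power_torsion C (A (Suc i)) (fst (xs ! i)) (snd (xs ! i)) \<and>
      acts_bijectively C (Dom T h) (fst (xs ! i)) (snd (xs ! i))" if i: "i < length xs" for i
  proof -
    note cH = conjunct1[OF c[OF i]]
    obtain g h where t: "(?c i, g, h) \<in> Tri T" using TR1_cone HomD(1)[OF cH] by blast
    have dom: "Dom T (?c i) = A (Suc i)" "Dom T g = A i" using HomD[OF cH] TriD(4)[OF t] by auto
    \<comment> \<open>For \<open>i = 0\<close> the object \<open>A 0 = M\<close> is arbitrary, but \<open>V 0\<close> is the whole spectrum.\<close>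
    have "C \<in> torsion_compacts U R G T \<phi> (V i) \<or> A i \<in> ?L i"
    proof (cases i)
      case 0
      have no_primes: "Spec R G - V 0 = {}" by (auto simp: VD)
      show ?thesis unfolding torsion_compacts_def 0 no_primes using C by simp
    next
      case (Suc j)
      then show ?thesis using AL by simp
    qed
    then have "power_torsion C (Dom T (?c i)) (fst (xs ! i)) (snd (xs ! i))"
      "acts_bijectively C (Dom T h) (fst (xs ! i)) (snd (xs ! i))"
      using coreflection_torsion[OF C xi[OF i] t, of "V (Suc i)" "V i"] VSuc[OF i] AL[of i] c[OF i]
      by (auto simp: dom)
    then show ?thesis using t dom by auto
  qed
  have gh: "ghost T C (?c i) \<longleftrightarrow> injective_mod (H C (A i))
      (zero_sub (H C (A i))) (fst (xs ! i)) (snd (xs ! i))" if i: "i < length xs" for i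
    using step[OF i] ghost_torsion_iff[OF CO xi[OF i] _ _ _ refl] by blast
  have "weakly_regular R G (H C M) xs \<longleftrightarrow>
      regular_mod (H C (A 0)) (zero_sub (H C (A 0))) xs"
    using graded_module_over.weakly_regular_iff[OF hom_module_graded_module[OF CO M]] xs by (simp add: A_def)
  also have "\<dots> \<longleftrightarrow> (\<forall>i<length xs. injective_mod (H C (A i))
      (zero_sub (H C (A i))) (fst (xs ! i)) (snd (xs ! i)))"
  proof (rule regular_mod_chain[where N = "\<lambda>i. H C (A i)"])
    fix i d x assume i: "i < length xs" and dx: "xs ! i = (d, x)"
      and inj: "injective_mod (H C (A i)) (zero_sub (H C (A i))) d x"
    have ys: "y \<in> G e" if "(e, y) \<in> set (drop (Suc i) xs)" for e y
      using that xs by (meson in_set_dropD)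
    obtain g h where t: "(?c i, g, h) \<in> Tri T" "Dom T (?c i) = A (Suc i)" "Dom T g = A i"
      "power_torsion C (A (Suc i)) d x" "acts_bijectively C (Dom T h) d x"
      using step[OF i] dx by auto
    have x: "x \<in> G d" using xi[OF i] dx by simp
    show "regular_mod (H C (A i))
        (add_multiples (H C (A i)) (zero_sub (H C (A i))) d x) (drop (Suc i) xs) \<longleftrightarrow>
      regular_mod (H C (A (Suc i))) (zero_sub (H C (A (Suc i)))) (drop (Suc i) xs)"
    proof (rule regular_mod_torsion_triangle[OF CO x t(1-3) refl t(4,5)])
      show "ghost T C (?c i)" using gh[OF i] inj dx by simp
    qed (rule ys)
  qed
  finally show ?thesis using gh by blast
qed

end

theorem theoremA:
  fixes R :: "('r, 'y) ring_scheme" and G :: "int \<Rightarrow> 'r set"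
    and T :: "('o, 'm, 'z) triangulated_category_scheme"
    and \<phi> :: "int \<Rightarrow> 'r \<Rightarrow> 'o \<Rightarrow> 'm"
    and C M :: 'o
    and xs :: "(int \<times> 'r) list"
    and K :: "nat \<Rightarrow> 'o" and q \<delta> :: "nat \<Rightarrow> 'm"
    and U :: "'u set"
    and \<Gamma>o :: "'r set set \<Rightarrow> 'o \<Rightarrow> 'o" and \<Gamma>a :: "'r set set \<Rightarrow> 'm \<Rightarrow> 'm"
    and \<theta> :: "'r set set \<Rightarrow> 'o \<Rightarrow> 'm"
  assumes "linear_triangulated_category R G T \<phi>"
    and "C \<in> Obj T" and "M \<in> Obj T"
    and "\<forall>(d, x) \<in> set xs. x \<in> G d"
    and "koszul_triangles T \<phi> M xs K q \<delta>"
  shows "let cond1 = weakly_regular R G (hom_module T \<phi> C M) xs;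
             cond2 = (\<forall>i<length xs. ghost T C (susp_arr T (- int (Suc i)) (\<delta> i)));
             cond3 = (\<forall>i<length xs. ghost T C (local_cohomology_map R G T \<Gamma>o \<Gamma>a \<theta> xs M i))
         in (cond1 \<longleftrightarrow> cond2) \<and>
            (graded_noetherian R G \<and> compactly_generated U T \<and> compact_object U T C \<and>
               local_cohomology U R G T \<phi> \<Gamma>o \<Gamma>a \<theta> \<longrightarrow>
             (cond1 \<longleftrightarrow> cond3) \<and> (cond2 \<longleftrightarrow> cond3))"
proof -
  interpret linear_triangulated_category R G T \<phi> by (rule assms(1))
  have xs: "x \<in> G d" if "(d, x) \<in> set xs" for d x
    using assms(4) that by blast
  show ?thesis
    using weakly_regular_iff_koszul_ghost[OF assms(2,3) xs assms(5)]
      weakly_regular_iff_local_cohomology_ghost[OF _ assms(3) xs]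
    unfolding Let_def by blast
qed

end
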